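(* Let $k$ be an algebraically closed field of characteristic zero. Let $A$ be an integral $k$-algebra of finite type and let $\mathcal{F}$ be a family of $k$-derivations on $A$. Then $M_{\mathcal{F},\min}$ is a non-empty residual subset of $M_{\mathcal{F}}$.
   Context: "Integral" means that $A$ is an integral domain. A $k$-derivation on $A$ is a $k$-linear map $d:A\to A$ satisfying the Leibniz rule. $\ker\mathcal{F}=\bigcap_{d\in\mathcal{F}}\ker d$. $M_{\mathcal{F}}$ is the $A$-module spanned by the elements of $\mathcal{F}$ (inside the $A$-module of $k$-derivations on $A$). A $k$-derivation $d\in M_{\mathcal{F}}$ is $\mathcal{F}$-minimal if $\ker d=\ker\mathcal{F}$; $M_{\mathcal{F},\min}\subseteq M_{\mathcal{F}}$ is the set of all $\mathcal{F}$-minimal derivations. Residuality: for a $k$-vector space $E$, a subset $\Omega\subseteq E$ is residual in $E$ if, for any finite-dimensional $k$-subspace $F$ of $E$, the set $\Omega\cap F$ is a countable intersection of Zariski open sets of $F$ (possibly empty), where $F$ is viewed as an affine space over $k$. *)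

theory Defs
  imports "HOL-Computational_Algebra.Polynomial" "HOL-Library.Function_Algebras"
begin

section \<open>Commutative algebras over a field\<close>

text \<open>
  The ring is the whole type \<open>'a\<close>; a \<open>k\<close>-algebra structure on it is a scalar multiplication by \<open>k\<close>.
\<close>

locale k_algebra = vector_space scale
  for scale :: "'k::field \<Rightarrow> 'a::comm_ring_1 \<Rightarrow> 'a" +
  assumes scale_mult_left: "scale c (x * y) = scale c x * y"

definition subalgebra :: "('k::field \<Rightarrow> 'a::comm_ring_1 \<Rightarrow> 'a) \<Rightarrow> 'a set \<Rightarrow> bool" where
  "subalgebra scale B \<longleftrightarrow>
     module.subspace scale B \<and> 1 \<in> B \<and> (\<forall>x\<in>B. \<forall>y\<in>B. x * y \<in> B)"

definition finite_type :: "('k::field \<Rightarrow> 'a::comm_ring_1 \<Rightarrow> 'a) \<Rightarrow> bool" where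
  "finite_type scale \<longleftrightarrow> (\<exists>S. finite S \<and> subalgebra scale hull S = UNIV)"

section \<open>Derivations\<close>

definition derivation :: "('k::field \<Rightarrow> 'a::comm_ring_1 \<Rightarrow> 'a) \<Rightarrow> ('a \<Rightarrow> 'a) \<Rightarrow> bool" where
  "derivation scale d \<longleftrightarrow>
     Vector_Spaces.linear scale scale d \<and> (\<forall>x y. d (x * y) = x * d y + d x * y)"

definition der_ker :: "('a::zero \<Rightarrow> 'a) \<Rightarrow> 'a set" where
  "der_ker d = {x. d x = 0}"

definition family_ker :: "('a::zero \<Rightarrow> 'a) set \<Rightarrow> 'a set" where
  "family_ker \<F> = (\<Inter>d\<in>\<F>. der_ker d)"

definition fun_scale :: "('r \<Rightarrow> 'a \<Rightarrow> 'a) \<Rightarrow> 'r \<Rightarrow> ('a \<Rightarrow> 'a) \<Rightarrow> 'a \<Rightarrow> 'a" where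
  "fun_scale s c d = (\<lambda>x. s c (d x))"

lemma module_fun_scale_mult: "module (fun_scale ((*) :: 'a::comm_ring_1 \<Rightarrow> _))"
  by unfold_locales (auto simp: fun_scale_def fun_eq_iff algebra_simps)

lemma vector_space_fun_scale:
  assumes "vector_space scale"
  shows "vector_space (fun_scale scale)"
proof -
  interpret vector_space scale by (fact assms)
  show ?thesis
    by unfold_locales (auto simp: fun_scale_def fun_eq_iff scale_right_distrib scale_left_distrib)
qed

text \<open>
  The span is taken in the \<open>A\<close>-module of all maps \<open>A \<rightarrow> A\<close>.  For a family of derivations this is
  the span inside the module of derivations, as derivations are a submodule
  (see \<open>der_module_derivation\<close>).
\<close>

definition der_module :: "('a::comm_ring_1 \<Rightarrow> 'a) set \<Rightarrow> ('a \<Rightarrow> 'a) set" where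
  "der_module \<F> = module.span (fun_scale (*)) \<F>"

definition minimal_derivations :: "('a::comm_ring_1 \<Rightarrow> 'a) set \<Rightarrow> ('a \<Rightarrow> 'a) set" where
  "minimal_derivations \<F> = {d \<in> der_module \<F>. der_ker d = family_ker \<F>}"

lemma der_module_derivation:
  assumes "k_algebra scale" and "\<And>d. d \<in> \<F> \<Longrightarrow> derivation scale d" and "d \<in> der_module \<F>"
  shows "derivation scale d"
proof -
  interpret k_algebra scale by (fact assms(1))
  interpret M: module "fun_scale ((*) :: 'b \<Rightarrow> _)" by (rule module_fun_scale_mult)
  have scale_right: "a * scale c x = scale c (a * x)" for a c x
    by (metis scale_mult_left mult.commute)
  have lin: "Vector_Spaces.linear scale scale f \<longleftrightarrow>
      (\<forall>x y. f (x + y) = f x + f y) \<and> (\<forall>c x. f (scale c x) = scale c (f x))" for f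
    using linear_iff_module_hom vector_space_axioms module_axioms
    by (auto simp: module_hom_iff_linear[symmetric] module_hom_iff)
  have "d \<in> M.span \<F>" using assms(3) by (simp add: der_module_def)
  then show ?thesis
  proof (induction rule: M.span_induct_alt)
    case base
    show ?case by (auto simp: derivation_def lin)
  next
    case (step a f g)
    then have "derivation scale f" using assms(2) by blast
    with step show ?case
      by (auto simp: derivation_def lin fun_scale_def algebra_simps scale_right scale_right_distrib)
  qed
qed

section \<open>The Zariski topology and residual sets\<close>

text \<open>
  Regular functions on a finite-dimensional space \<open>F\<close> viewed as an affine space: the polynomial
  expressions in linear forms on \<open>F\<close>.  Only the values on \<open>F\<close> are relevant.
\<close>

definition linear_form_on :: "('k::field \<Rightarrow> 'v::ab_group_add \<Rightarrow> 'v) \<Rightarrow> 'v set \<Rightarrow> ('v \<Rightarrow> 'k) \<Rightarrow> bool" where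
  "linear_form_on s F l \<longleftrightarrow>
     (\<forall>x\<in>F. \<forall>y\<in>F. l (x + y) = l x + l y) \<and> (\<forall>c. \<forall>x\<in>F. l (s c x) = c * l x)"

inductive polynomial_function_on ::
  "('k::field \<Rightarrow> 'v::ab_group_add \<Rightarrow> 'v) \<Rightarrow> 'v set \<Rightarrow> ('v \<Rightarrow> 'k) \<Rightarrow> bool"
  for s F
where
  const: "polynomial_function_on s F (\<lambda>x. c)"
| linear: "linear_form_on s F l \<Longrightarrow> polynomial_function_on s F l"
| add: "polynomial_function_on s F p \<Longrightarrow> polynomial_function_on s F q \<Longrightarrow>
    polynomial_function_on s F (\<lambda>x. p x + q x)"
| mult: "polynomial_function_on s F p \<Longrightarrow> polynomial_function_on s F q \<Longrightarrow>
    polynomial_function_on s F (\<lambda>x. p x * q x)"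

definition zariski_closed_in ::
  "('k::field \<Rightarrow> 'v::ab_group_add \<Rightarrow> 'v) \<Rightarrow> 'v set \<Rightarrow> 'v set \<Rightarrow> bool" where
  "zariski_closed_in s F Z \<longleftrightarrow>
     (\<exists>P. (\<forall>p\<in>P. polynomial_function_on s F p) \<and> Z = {x \<in> F. \<forall>p\<in>P. p x = 0})"

definition zariski_open_in ::
  "('k::field \<Rightarrow> 'v::ab_group_add \<Rightarrow> 'v) \<Rightarrow> 'v set \<Rightarrow> 'v set \<Rightarrow> bool" where
  "zariski_open_in s F U \<longleftrightarrow> U \<subseteq> F \<and> zariski_closed_in s F (F - U)"

definition finite_dimensional_subspace ::
  "('k::field \<Rightarrow> 'v::ab_group_add \<Rightarrow> 'v) \<Rightarrow> 'v set \<Rightarrow> bool" where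
  "finite_dimensional_subspace s F \<longleftrightarrow> (\<exists>B. finite B \<and> F = module.span s B)"

text \<open>
  \<open>E\<close> is meant to be a subspace of the ambient space \<open>'v\<close>.  Indexing by \<open>nat\<close> also covers finite
  intersections, since repetitions are allowed and \<open>F\<close> is open in itself.
\<close>

definition residual_in ::
  "('k::field \<Rightarrow> 'v::ab_group_add \<Rightarrow> 'v) \<Rightarrow> 'v set \<Rightarrow> 'v set \<Rightarrow> bool" where
  "residual_in s E \<Omega> \<longleftrightarrow> \<Omega> \<subseteq> E \<and>
     (\<forall>F. finite_dimensional_subspace s F \<and> F \<subseteq> E \<longrightarrow>
        (\<exists>U :: nat \<Rightarrow> 'v set. (\<forall>n. zariski_open_in s F (U n)) \<and> \<Omega> \<inter> F = (\<Inter>n. U n)))"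

end

(*
It suffices to combine two derivations d and e into one whose kernel is the common kernel.  If
ker e is not contained in ker d, there is x with e x = 0, and after scaling d x = 1.  For a generic t
the iterated brackets of d + t e with e span, over the fraction field, a space stable under brackets
with d and e: otherwise the first variation in t would increase its rank.  Replace d by d + t e.

Near a k-point of a localisation of A with x = 0 one can then choose a feedback q, linear in
coordinates dual to the iterated brackets with poles in x, such that the derivation x d + q e
contracts a weighted blow-up of the trajectory of d through the point: modulo x it acts locally
finitely on a finitely generated ring A2 with eigenvalues in the natural numbers.  If f is killed by
x d + q e, the derivatives of f along the iterated brackets form a linear system whose eigenvalues
modulo x are negative, so they are divisible by every power of x.  As A2 is noetherian and x is not a
unit in A2, they vanish, and f is killed by d and e.

For residuality, a derivation in a finite-dimensional space F fails to be minimal iff it maps one of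
countably many finite families, independent modulo the kernel of the whole family of derivations, to
a dependent one, and each of these conditions is Zariski closed in F.
*)

theory Submission
  imports Defs "Jordan_Normal_Form.Determinant" "HOL-Library.Countable_Set"
begin

hide_const (open) module.smult

section \<open>Subrings of commutative rings\<close>

text \<open>Why there are poles: by transport along d one gets derivations \<open>Eflat i\<close>
  with e = \<Sum> x^i / i! * \<open>Eflat i\<close>, so on x = 0 the derivation e moves, to first
  order, only one of the r dual coordinates \<open>ybar l\<close>. The others can be steered only
  for x \<noteq> 0, at the price of dividing by powers of x; the weights r + l in
  \<open>zeta l = ybar l / x ^ (r + l)\<close> absorb these poles. Modulo x, the closed loop on the
  \<open>zeta l\<close> is a diagonal matrix with entries -(r + l) plus a matrix of rank one.
  Placing its eigenvalues at s + 1 is a linear problem for the Cauchy matrix 1 / (l + s + r + 1).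
  The derivatives of a first integral obey the negated transpose shifted by -r, with eigenvalues -(s
  + r + 1). No natural number is of this form; this absence of resonance yields the divisibility by
  x. Why brackets with e are controlled: the rank argument concerns only the variation, a
  differential operator in its direction s. Commuting it repeatedly with multiplication by x, where
  d x = 1 and e x = 0, lowers the order until a nonzero multiple of one bracket of e with an
  iterated bracket remains.\<close>

definition is_subring :: "'f::comm_ring_1 set \<Rightarrow> bool" where
  "is_subring R \<longleftrightarrow> 1 \<in> R \<and> (\<forall>a\<in>R. \<forall>b\<in>R. a - b \<in> R \<and> a * b \<in> R)"

context
  fixes R :: "'f::comm_ring_1 set"
  assumes R: "is_subring R"
begin

lemma subring_one: "1 \<in> R" using R by (auto simp: is_subring_def)
lemma subring_diff: "a \<in> R \<Longrightarrow> b \<in> R \<Longrightarrow> a - b \<in> R" using R by (auto simp: is_subring_def)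
lemma subring_mult: "a \<in> R \<Longrightarrow> b \<in> R \<Longrightarrow> a * b \<in> R" using R by (auto simp: is_subring_def)
lemma subring_zero: "0 \<in> R" using subring_diff[OF subring_one subring_one] by simp
lemma subring_uminus: "a \<in> R \<Longrightarrow> - a \<in> R" using subring_diff[OF subring_zero, of a] by simp
lemma subring_add: "a \<in> R \<Longrightarrow> b \<in> R \<Longrightarrow> a + b \<in> R"
  using subring_diff[of a "- b"] subring_uminus[of b] by simp
lemma subring_power: "a \<in> R \<Longrightarrow> a ^ n \<in> R"
  by (induction n) (auto intro: subring_one subring_mult)
lemma subring_sum: "(\<And>i. i \<in> I \<Longrightarrow> f i \<in> R) \<Longrightarrow> (\<Sum>i\<in>I. f i) \<in> R"
  by (induction I rule: infinite_finite_induct) (auto intro: subring_zero subring_add)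

lemmas subring_intros =
  subring_one subring_zero subring_diff subring_uminus subring_add subring_mult subring_power subring_sum

end

section \<open>Polynomials over a subring and adjunction of one element\<close>

definition polys_over :: "'f::comm_ring_1 set \<Rightarrow> 'f poly set" where
  "polys_over R = {P. \<forall>i. coeff P i \<in> R}"

definition adjoin :: "'f::comm_ring_1 set \<Rightarrow> 'f \<Rightarrow> 'f set" where
  "adjoin R u = (\<lambda>P. poly P u) ` polys_over R"

lemma polys_overD: "P \<in> polys_over R \<Longrightarrow> coeff P i \<in> R"
  by (simp add: polys_over_def)

context
  fixes R :: "'f::comm_ring_1 set"
  assumes R: "is_subring R"
begin

lemma polys_over_diff: "P \<in> polys_over R \<Longrightarrow> Q \<in> polys_over R \<Longrightarrow> P - Q \<in> polys_over R"
  by (auto simp: polys_over_def intro: subring_diff[OF R])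

lemma polys_over_add: "P \<in> polys_over R \<Longrightarrow> Q \<in> polys_over R \<Longrightarrow> P + Q \<in> polys_over R"
  by (auto simp: polys_over_def intro: subring_add[OF R])

lemma polys_over_mult: "P \<in> polys_over R \<Longrightarrow> Q \<in> polys_over R \<Longrightarrow> P * Q \<in> polys_over R"
  by (auto simp: polys_over_def coeff_mult intro!: subring_sum[OF R] subring_mult[OF R])

lemma polys_over_monom: "c \<in> R \<Longrightarrow> monom c n \<in> polys_over R"
  by (auto simp: polys_over_def subring_zero[OF R])

lemma polys_over_const: "c \<in> R \<Longrightarrow> [:c:] \<in> polys_over R"
  using polys_over_monom[of c 0] by (simp add: monom_0)

lemma polys_over_smult: "c \<in> R \<Longrightarrow> P \<in> polys_over R \<Longrightarrow> smult c P \<in> polys_over R"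
  by (auto simp: polys_over_def intro: subring_mult[OF R])

lemma polys_over_zero: "0 \<in> polys_over R"
  by (auto simp: polys_over_def subring_zero[OF R])

lemma polys_over_one: "1 \<in> polys_over R"
  using polys_over_const[OF subring_one[OF R]] by (simp add: one_pCons)

lemma polys_over_sum: "(\<And>i. i \<in> I \<Longrightarrow> f i \<in> polys_over R) \<Longrightarrow> (\<Sum>i\<in>I. f i) \<in> polys_over R"
  by (induction I rule: infinite_finite_induct) (auto intro: polys_over_zero polys_over_add)

lemma is_subring_adjoin: "is_subring (adjoin R u)"
proof -
  have "1 \<in> adjoin R u"
    using polys_over_one by (auto simp: adjoin_def image_iff intro: bexI[of _ 1])
  moreover have "a - b \<in> adjoin R u \<and> a * b \<in> adjoin R u"
    if ab: "a \<in> adjoin R u" "b \<in> adjoin R u" for a b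
  proof -
    obtain P Q where "P \<in> polys_over R" "a = poly P u" "Q \<in> polys_over R" "b = poly Q u"
      using ab unfolding adjoin_def by (elim imageE) blast
    then have "a - b = poly (P - Q) u" "a * b = poly (P * Q) u"
      "P - Q \<in> polys_over R" "P * Q \<in> polys_over R"
      by (auto intro: polys_over_diff polys_over_mult)
    then show ?thesis unfolding adjoin_def by blast
  qed
  ultimately show ?thesis by (simp add: is_subring_def)
qed

lemma subset_adjoin: "R \<subseteq> adjoin R u"
proof
  fix a assume "a \<in> R"
  then show "a \<in> adjoin R u"
    using polys_over_const[of a] by (auto simp: adjoin_def image_iff intro!: bexI[of _ "[:a:]"])
qed

lemma gen_in_adjoin: "u \<in> adjoin R u"
  using polys_over_monom[OF subring_one[OF R], of 1]
  by (auto simp: adjoin_def image_iff poly_monom intro!: bexI[of _ "monom 1 1"])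

text \<open>Over a ring that is no field, each reduction of the degree costs one factor of the
  leading coefficient, so only a power of it times \<open>B\<close> can be divided.\<close>

lemma pseudo_division_over:
  assumes P: "P \<in> polys_over R" and B: "B \<in> polys_over R"
  shows "\<exists>e S T. S \<in> polys_over R \<and> T \<in> polys_over R \<and>
    smult (lead_coeff P ^ e) B = P * S + T \<and> (T = 0 \<or> degree T < degree P)"
  using B
proof (induction "degree B" arbitrary: B rule: less_induct)
  case less
  show ?case
  proof (cases "B = 0 \<or> degree B < degree P")
    case True
    then show ?thesis
      using less.prems polys_over_zero by (intro exI[of _ 0] exI[of _ B]) auto
  next
    case False
    let ?c = "lead_coeff P"
    define X where "X = monom (lead_coeff B) (degree B - degree P)"
    define C where "C = smult ?c B - P * X"
    have X: "X \<in> polys_over R"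
      using less.prems unfolding X_def by (intro polys_over_monom) (auto intro: polys_overD)
    have C: "C \<in> polys_over R"
      unfolding C_def using less.prems P X
      by (intro polys_over_diff polys_over_smult polys_over_mult) (auto intro: polys_overD)
    have degC: "degree C \<le> degree B"
      unfolding C_def X_def using False
      by (intro degree_diff_le degree_smult_le order.trans[OF degree_mult_le]
          order.trans[OF add_left_mono[OF degree_monom_le]]) auto
    have top: "coeff C (degree B) = 0"
      using False unfolding C_def X_def
      by (simp add: mult.commute[of P] coeff_monom_mult)
    show ?thesis
    \<comment> \<open>The leading terms cancel in \<open>C\<close>, but in degree 0 the degree
      cannot drop further; there \<open>C\<close> is zero outright.\<close>
    proof (cases "degree B = 0")
      case True
      then have "C = 0"
        using degC top by (metis degree_0_id le_zero_eq lead_coeff_pCons(2) pCons_0_0 coeff_pCons_0)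
      then have "smult ?c B = P * X" by (simp add: C_def)
      then show ?thesis
        using X polys_over_zero by (intro exI[of _ 1] exI[of _ X] exI[of _ 0]) auto
    next
      case False
      have "degree C < degree B"
        using degC top False by (metis degree_0 leading_coeff_0_iff order.not_eq_order_implies_strict bot_nat_0.not_eq_extremum)
      from less.hyps[OF this C] obtain e S T where
        *: "S \<in> polys_over R" "T \<in> polys_over R"
        "smult (?c ^ e) C = P * S + T" "T = 0 \<or> degree T < degree P"
        by blast
      have "smult (?c ^ Suc e) B = smult (?c ^ e) C + smult (?c ^ e) (P * X)"
        unfolding C_def by (simp add: smult_diff_right mult.commute)
      also have "\<dots> = P * (S + smult (?c ^ e) X) + T"
        using * by (simp add: algebra_simps)
      finally have "smult (?c ^ Suc e) B = P * (S + smult (?c ^ e) X) + T" .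
      moreover have "S + smult (?c ^ e) X \<in> polys_over R"
        using * X P by (intro polys_over_add polys_over_smult subring_power[OF R]) (auto intro: polys_overD)
      ultimately show ?thesis using * by blast
    qed
  qed
qed

end

section \<open>Noetherian subrings\<close>

text \<open>The ascending chain condition, phrased through sequences of ring elements.\<close>

definition noetherian :: "'f::comm_ring_1 set \<Rightarrow> bool" where
  "noetherian R \<longleftrightarrow>
     (\<forall>a :: nat \<Rightarrow> 'f. range a \<subseteq> R \<longrightarrow> (\<exists>n c. (\<forall>i<n. c i \<in> R) \<and> a n = (\<Sum>i<n. c i * a i)))"

inductive_set ideal_span :: "'f::comm_ring_1 set \<Rightarrow> 'f set \<Rightarrow> 'f set" for R T where
  zero: "0 \<in> ideal_span R T"
| step: "c \<in> R \<Longrightarrow> t \<in> T \<Longrightarrow> y \<in> ideal_span R T \<Longrightarrow> c * t + y \<in> ideal_span R T"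

lemma ideal_span_mono:
  assumes "T \<subseteq> T'" "x \<in> ideal_span R T"
  shows "x \<in> ideal_span R T'"
  using assms(2)
  by (induction rule: ideal_span.induct) (use assms(1) in \<open>auto intro: ideal_span.intros\<close>)

lemma ideal_span_add: "x \<in> ideal_span R T \<Longrightarrow> y \<in> ideal_span R T \<Longrightarrow> x + y \<in> ideal_span R T"
  by (induction rule: ideal_span.induct) (auto intro: ideal_span.intros simp: add.assoc)

lemma ideal_span_mult:
  assumes "is_subring R" "r \<in> R" "x \<in> ideal_span R T"
  shows "r * x \<in> ideal_span R T"
  using assms(3)
  by (induction rule: ideal_span.induct)
     (use assms in \<open>auto intro: ideal_span.intros simp: distrib_left mult.assoc[symmetric] subring_mult\<close>)

lemma ideal_span_base:
  assumes "is_subring R" "t \<in> T" shows "t \<in> ideal_span R T"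
  using ideal_span.step[OF subring_one[OF assms(1)] assms(2) ideal_span.zero] by simp

lemma ideal_span_subset:
  assumes "is_subring R" "T' \<subseteq> ideal_span R T" "x \<in> ideal_span R T'"
  shows "x \<in> ideal_span R T"
  using assms(3)
  by (induction rule: ideal_span.induct)
     (use assms in \<open>auto intro: ideal_span.zero intro!: ideal_span_add ideal_span_mult\<close>)

lemma ideal_span_finite_support:
  "x \<in> ideal_span R (range f) \<Longrightarrow> \<exists>n::nat. x \<in> ideal_span R (f ` {..<n})"
proof (induction rule: ideal_span.induct)
  case zero
  show ?case by (auto intro: ideal_span.zero)
next
  case (step c t y)
  then obtain n i where n: "y \<in> ideal_span R (f ` {..<n})" and i: "t = f i" by auto
  have "y \<in> ideal_span R (f ` {..<max n (Suc i)})"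
    by (rule ideal_span_mono[OF _ n]) auto
  then have "c * t + y \<in> ideal_span R (f ` {..<max n (Suc i)})"
    using step i by (intro ideal_span.step) auto
  then show ?case ..
qed

lemma ideal_span_finite_lincomb:
  assumes "is_subring R" "x \<in> ideal_span R (a ` {..<n::nat})"
  shows "\<exists>c. (\<forall>i<n. c i \<in> R) \<and> x = (\<Sum>i<n. c i * a i)"
  using assms(2)
proof (induction rule: ideal_span.induct)
  case zero
  then show ?case by (intro exI[of _ "\<lambda>_. 0"]) (auto intro: subring_zero assms)
next
  case (step c t y)
  then obtain e where e: "\<forall>i<n. e i \<in> R" "y = (\<Sum>i<n. e i * a i)" by auto
  obtain j where j: "j < n" "t = a j" using step by auto
  have "c * t = (\<Sum>i<n. (if i = j then c else 0) * a i)"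
    using j by (simp add: if_distrib[of "\<lambda>u. u * _"] sum.delta cong: if_cong)
  then show ?case using e step(1)
    by (intro exI[of _ "\<lambda>i. (if i = j then c else 0) + e i"])
       (auto simp: distrib_right sum.distrib intro: subring_add assms)
qed

lemma lincomb_in_ideal_span:
  assumes "is_subring R" "\<And>i. i < n \<Longrightarrow> c i \<in> R"
  shows "(\<Sum>i<n::nat. c i * a i) \<in> ideal_span R (a ` {..<n})"
proof -
  have "(\<Sum>i\<in>I. c i * a i) \<in> ideal_span R (a ` {..<n})" if "finite I" "I \<subseteq> {..<n}" for I
    using that assms by (induction I rule: finite_induct) (auto intro!: ideal_span.intros)
  then show ?thesis by auto
qed

text \<open>Hilbert's basis theorem, choosing polynomials of minimal degree outside the ideal generated by
  the previous choices.\<close>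

lemma noetherian_adjoin:
  fixes R :: "'f::comm_ring_1 set"
  assumes R: "is_subring R" and N: "noetherian R"
  shows "noetherian (adjoin R u)"
proof -
  let ?B = "adjoin R u"
  have B: "is_subring ?B" by (rule is_subring_adjoin[OF R])
  have False if f: "range f \<subseteq> ?B"
    and no: "\<And>n::nat. f n \<notin> ideal_span ?B (f ` {..<n})" for f :: "nat \<Rightarrow> 'f"
  proof -
    define I where "I = ideal_span ?B (range f)"
    have notfg: "\<not> I \<subseteq> ideal_span ?B (g ` {..<n})"
      if "\<And>i. i < n \<Longrightarrow> g i \<in> I" for g and n :: nat
    proof
      assume sub: "I \<subseteq> ideal_span ?B (g ` {..<n})"
      have "\<exists>m. g ` {..<n} \<subseteq> ideal_span ?B (f ` {..<m})" using that
      proof (induction n)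
        case (Suc n)
        then obtain m where m: "g ` {..<n} \<subseteq> ideal_span ?B (f ` {..<m})" by auto
        obtain m' where m': "g n \<in> ideal_span ?B (f ` {..<m'})"
          using Suc.prems[of n] ideal_span_finite_support unfolding I_def by blast
        have "ideal_span ?B (f ` {..<m}) \<subseteq> ideal_span ?B (f ` {..<max m m'})"
          "ideal_span ?B (f ` {..<m'}) \<subseteq> ideal_span ?B (f ` {..<max m m'})"
          by (auto elim!: ideal_span_mono[rotated])
        then show ?case using m m' by (intro exI[of _ "max m m'"]) (auto simp: lessThan_Suc)
      qed auto
      then obtain m where m: "g ` {..<n} \<subseteq> ideal_span ?B (f ` {..<m})" by blast
      have "f m \<in> I" unfolding I_def by (auto intro: ideal_span_base[OF B])
      then have "f m \<in> ideal_span ?B (g ` {..<n})" using sub by blast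
      then show False using ideal_span_subset[OF B m] no by blast
    qed
    define cand where "cand = (\<lambda>(P :: nat \<Rightarrow> 'f poly) n Q. Q \<in> polys_over R \<and> poly Q u \<in> I \<and>
      poly Q u \<notin> ideal_span ?B ((\<lambda>i. poly (P i) u) ` {..<n}))"
    \<comment> \<open>The premise makes a choice exist after any prefix, also one that has left
      \<open>I\<close>; \<open>inI\<close> shows that it always holds.\<close>
    define best where "best = (\<lambda>P n Q. (\<forall>i<n. poly (P i) u \<in> I) \<longrightarrow>
      cand P n Q \<and> (\<forall>Q'. cand P n Q' \<longrightarrow> degree Q \<le> degree Q'))"
    have "\<exists>P. \<forall>n. best P n (P n)"
    proof (rule dependent_wellorder_choice)
      fix r and P P' :: "nat \<Rightarrow> 'f poly" and n assume eq: "\<And>m. m < n \<Longrightarrow> P m = P' m"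
      have "(\<lambda>i. poly (P i) u) ` {..<n} = (\<lambda>i. poly (P' i) u) ` {..<n}"
        using eq by (auto simp: image_iff)
      then show "best P n r = best P' n r" using eq by (simp add: best_def cand_def)
    next
      fix n and P :: "nat \<Rightarrow> 'f poly"
      show "\<exists>Q. best P n Q"
      proof (cases "\<forall>i<n. poly (P i) u \<in> I")
        case True
        then obtain b where b: "b \<in> I" "b \<notin> ideal_span ?B ((\<lambda>i. poly (P i) u) ` {..<n})"
          using notfg[of n "\<lambda>i. poly (P i) u"] by auto
        have "I \<subseteq> ?B"
        proof
          fix z assume "z \<in> I"
          then show "z \<in> ?B" unfolding I_def
            by (induction rule: ideal_span.induct)
               (use f in \<open>auto intro!: subring_intros[OF B]\<close>)
        qed
        then obtain Q where "Q \<in> polys_over R" "b = poly Q u" using b by (auto simp: adjoin_def)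
        then have "cand P n Q" using b by (simp add: cand_def)
        from ex_has_least_nat[of "cand P n", OF this, of degree] show ?thesis
          by (auto simp: best_def)
      qed (auto simp: best_def)
    qed
    then obtain P where P: "\<And>n. best P n (P n)" by blast
    have inI: "poly (P n) u \<in> I" for n
    proof (induction n rule: less_induct)
      case (less n)
      then show ?case using P[of n] by (auto simp: best_def cand_def)
    qed
    have cnd: "cand P n (P n)" for n using P[of n] inI by (auto simp: best_def)
    have mini: "cand P n Q \<Longrightarrow> degree (P n) \<le> degree Q" for n Q
      using P[of n] inI by (auto simp: best_def)
    \<comment> \<open>A later choice avoids a larger ideal, so it was already a candidate
      earlier.\<close>
    have deg: "degree (P i) \<le> degree (P n)" if "i \<le> n" for i n
    proof (rule mini)
      show "cand P i (P n)"
        using cnd[of n] ideal_span_mono[OF image_mono, of "{..<i}" "{..<n}"] that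
        unfolding cand_def by (meson lessThan_subset_iff)
    qed
    have Pov: "P n \<in> polys_over R" for n using cnd[of n] by (simp add: cand_def)
    have "range (\<lambda>n. lead_coeff (P n)) \<subseteq> R" using Pov by (auto intro: polys_overD)
    then obtain n c where c: "\<And>i. i < n \<Longrightarrow> c i \<in> R"
      and lead: "lead_coeff (P n) = (\<Sum>i<n. c i * lead_coeff (P i))"
      using N unfolding noetherian_def by (elim allE[of _ "\<lambda>n. lead_coeff (P n)"]) blast
    \<comment> \<open>By the relation between leading coefficients, \<open>E\<close> has the leading
      term of \<open>P n\<close>, yet its value at \<open>u\<close> lies in the ideal of the earlier
      choices. So \<open>P n - E\<close> is a candidate of too small a degree.\<close>
    define E where "E = (\<Sum>i<n. monom (c i) (degree (P n) - degree (P i)) * P i)"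
    define Q where "Q = P n - E"
    have Q: "Q \<in> polys_over R" unfolding Q_def E_def
      using Pov c by (intro polys_over_diff[OF R] polys_over_sum[OF R] polys_over_mult[OF R]
          polys_over_monom[OF R]) auto
    have "poly E u = (\<Sum>i<n. (c i * u ^ (degree (P n) - degree (P i))) * poly (P i) u)"
      unfolding E_def by (simp add: poly_sum poly_monom)
    also have "\<dots> \<in> ideal_span ?B ((\<lambda>i. poly (P i) u) ` {..<n})"
      using c subset_adjoin[OF R, of u] gen_in_adjoin[OF R, of u]
      by (intro lincomb_in_ideal_span[OF B]) (auto intro!: subring_intros[OF B])
    finally have E: "poly E u \<in> ideal_span ?B ((\<lambda>i. poly (P i) u) ` {..<n})" .
    have Qnot: "poly Q u \<notin> ideal_span ?B ((\<lambda>i. poly (P i) u) ` {..<n})"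
    proof
      assume "poly Q u \<in> ideal_span ?B ((\<lambda>i. poly (P i) u) ` {..<n})"
      from ideal_span_add[OF this E] show False
        using cnd[of n] by (simp add: Q_def cand_def)
    qed
    have "poly E u \<in> I"
      using ideal_span_subset[OF B _ E, of "range f"] inI by (auto simp: I_def)
    then have "poly Q u \<in> I"
      using ideal_span_add[of "poly (P n) u" ?B "range f" "(- 1) * poly E u"]
        ideal_span_mult[OF B subring_uminus[OF B subring_one[OF B]]] inI[of n]
      by (auto simp: I_def Q_def)
    then have "degree (P n) \<le> degree Q" using mini Q Qnot by (auto simp: cand_def)
    moreover have "degree E \<le> degree (P n)"
      unfolding E_def
    proof (intro degree_sum_le)
      fix i assume "i \<in> {..<n}"
      then show "degree (monom (c i) (degree (P n) - degree (P i)) * P i) \<le> degree (P n)"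
        using deg[of i n] by (intro order.trans[OF degree_mult_le]
          order.trans[OF add_right_mono[OF degree_monom_le]]) auto
    qed auto
    moreover have "coeff E (degree (P n)) = lead_coeff (P n)"
      unfolding E_def lead coeff_sum
    proof (intro sum.cong refl)
      fix i assume "i \<in> {..<n}"
      then have "degree (P i) \<le> degree (P n)" using deg by auto
      then show "coeff (monom (c i) (degree (P n) - degree (P i)) * P i) (degree (P n)) =
          c i * lead_coeff (P i)"
        by (simp add: coeff_monom_mult)
    qed
    then have "coeff Q (degree (P n)) = 0" by (simp add: Q_def)
    moreover have "degree Q \<le> degree (P n)"
      unfolding Q_def using calculation(2) by (intro degree_diff_le) auto
    ultimately have "Q = 0" by (metis leading_coeff_0_iff le_antisym)
    then show False using Qnot ideal_span.zero by auto
  qed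
  then show ?thesis
    unfolding noetherian_def using ideal_span_finite_lincomb[OF B] by metis
qed

text \<open>Krull's intersection theorem in a domain. All b / x^m lie in \<open>R\<close>, so some b
  / x^n is a combination of its predecessors; multiplying by x^n / b exhibits 1 as a multiple of
  x.\<close>

lemma noetherian_powers_inter:
  fixes R :: "'f::field set"
  assumes R: "is_subring R" and N: "noetherian R"
    and x: "x \<in> R" "x \<noteq> 0" and nonunit: "\<And>y. y \<in> R \<Longrightarrow> x * y \<noteq> 1"
    and b: "\<And>m. \<exists>a\<in>R. b = x ^ m * a"
  shows "b = 0"
proof (rule ccontr)
  assume "b \<noteq> 0"
  have "b / x ^ m \<in> R" for m
  proof -
    obtain a where "a \<in> R" "b = x ^ m * a" using b by blast
    then show ?thesis using x by simp
  qed
  then have "range (\<lambda>m. b / x ^ m) \<subseteq> R" by auto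
  then obtain n c where c: "\<And>i. i < n \<Longrightarrow> c i \<in> R" and eq: "b / x ^ n = (\<Sum>i<n. c i * (b / x ^ i))"
    using N unfolding noetherian_def by (elim allE[of _ "\<lambda>m. b / x ^ m"]) blast
  have "1 = (b / x ^ n) * (x ^ n / b)" using \<open>b \<noteq> 0\<close> x by simp
  also have "\<dots> = (\<Sum>i<n. c i * (b / x ^ i) * (x ^ n / b))" by (subst eq) (simp only: sum_distrib_right)
  also have "\<dots> = (\<Sum>i<n. x * (c i * x ^ (n - Suc i)))"
  proof (intro sum.cong refl)
    fix i assume i: "i \<in> {..<n}"
    have "c i * (b / x ^ i) * (x ^ n / b) = c i * (x ^ n / x ^ i)"
      using \<open>b \<noteq> 0\<close> by simp
    also have "x ^ n / x ^ i = x ^ (n - i)" using i x by (simp add: power_diff)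
    also have "\<dots> = x * x ^ (n - Suc i)"
      using i by (metis Suc_diff_Suc lessThan_iff power_Suc)
    finally show "c i * (b / x ^ i) * (x ^ n / b) = x * (c i * x ^ (n - Suc i))" by simp
  qed
  also have "\<dots> = x * (\<Sum>i<n. c i * x ^ (n - Suc i))" by (simp add: sum_distrib_left)
  finally show False
    using nonunit[of "\<Sum>i<n. c i * x ^ (n - Suc i)"] c x by (auto intro!: subring_intros[OF R])
qed

section \<open>Finitely generated algebras inside a field\<close>

locale scalar_embedding =
  fixes emb :: "'k::{alg_closed_field, field_char_0} \<Rightarrow> 'f::field"
  assumes emb_one [simp]: "emb 1 = 1"
    and emb_add: "emb (a + b) = emb a + emb b"
    and emb_mult: "emb (a * b) = emb a * emb b"
begin

lemma emb_zero [simp]: "emb 0 = 0" by (metis add_cancel_right_right add_0_right emb_add)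
lemma emb_uminus: "emb (- a) = - emb a" using emb_add[of a "- a"] by (simp add: add_eq_0_iff)
lemma emb_diff: "emb (a - b) = emb a - emb b" using emb_add[of a "- b"] emb_uminus[of b] by simp
lemma emb_of_nat [simp]: "emb (of_nat n) = of_nat n" by (induction n) (auto simp: emb_add)
lemma emb_sum: "emb (\<Sum>i\<in>I. f i) = (\<Sum>i\<in>I. emb (f i))"
  by (induction I rule: infinite_finite_induct) (auto simp: emb_add)
lemma emb_eq_0_iff [simp]: "emb a = 0 \<longleftrightarrow> a = 0"
proof
  assume "emb a = 0"
  then have "emb (a * inverse a) = 0" by (simp add: emb_mult)
  then show "a = 0" by (cases "a = 0") auto
qed auto
lemma emb_inverse: "emb (inverse a) = inverse (emb a)"
proof (cases "a = 0")
  case False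
  then have "emb a * emb (inverse a) = 1" by (simp flip: emb_mult)
  then show ?thesis by (simp add: inverse_unique)
qed auto
lemma emb_divide: "emb (a / b) = emb a / emb b" by (simp add: divide_inverse emb_mult emb_inverse)
lemma of_nat_eq_0_field [simp]: "(of_nat n :: 'f) = 0 \<longleftrightarrow> n = 0"
  using emb_eq_0_iff[of "of_nat n"] by simp
lemma inj_of_nat_field: "inj (of_nat :: nat \<Rightarrow> 'f)"
proof (rule injI)
  fix m n :: nat assume "(of_nat m :: 'f) = of_nat n"
  then have "emb (of_nat m - of_nat n) = 0" by (simp add: emb_diff)
  then show "m = n" by simp
qed

section \<open>Algebras generated by a set of field elements\<close>

inductive_set gen :: "'f set \<Rightarrow> 'f set" for S where
  scalar: "emb c \<in> gen S"
| base: "s \<in> S \<Longrightarrow> s \<in> gen S"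
| add: "a \<in> gen S \<Longrightarrow> b \<in> gen S \<Longrightarrow> a + b \<in> gen S"
| mult: "a \<in> gen S \<Longrightarrow> b \<in> gen S \<Longrightarrow> a * b \<in> gen S"

lemma is_subring_gen: "is_subring (gen S)"
  unfolding is_subring_def
proof (intro conjI ballI)
  show "1 \<in> gen S" using gen.scalar[of 1] by simp
  fix a b assume ab: "a \<in> gen S" "b \<in> gen S"
  have "a + emb (- 1) * b \<in> gen S" using ab by (blast intro: gen.intros)
  then show "a - b \<in> gen S" by (simp add: emb_uminus)
  show "a * b \<in> gen S" using ab by (rule gen.mult)
qed

lemma gen_minimal:
  assumes "is_subring R" "range emb \<subseteq> R" "S \<subseteq> R"
  shows "gen S \<subseteq> R"
proof
  fix x assume "x \<in> gen S"
  then show "x \<in> R"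
    by (induction rule: gen.induct) (use assms in \<open>auto intro: subring_add subring_mult\<close>)
qed

lemma gen_empty: "gen {} = range emb"
proof
  have "is_subring (range emb)"
    unfolding is_subring_def
  proof (intro conjI ballI)
    show "1 \<in> range emb" by (rule range_eqI[of _ _ 1]) simp
    fix a b assume "a \<in> range emb" "b \<in> range emb"
    then obtain c d where "a = emb c" "b = emb d" by blast
    then have "a - b = emb (c - d)" "a * b = emb (c * d)" by (simp_all add: emb_diff emb_mult)
    then show "a - b \<in> range emb" "a * b \<in> range emb" by blast+
  qed
  then show "gen {} \<subseteq> range emb" by (intro gen_minimal) auto
  show "range emb \<subseteq> gen {}" by (auto intro: gen.scalar)
qed

lemma gen_mono: "S \<subseteq> T \<Longrightarrow> gen S \<subseteq> gen T"
  by (intro gen_minimal is_subring_gen) (auto intro: gen.intros)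

lemma gen_insert: "gen (insert u S) = adjoin (gen S) u"
proof
  show "gen (insert u S) \<subseteq> adjoin (gen S) u"
    using subset_adjoin[OF is_subring_gen, of S u] gen_in_adjoin[OF is_subring_gen, of u S]
    by (intro gen_minimal is_subring_adjoin is_subring_gen) (auto intro: gen.intros)
  show "adjoin (gen S) u \<subseteq> gen (insert u S)"
  proof
    fix z assume "z \<in> adjoin (gen S) u"
    then obtain P where P: "P \<in> polys_over (gen S)" "z = poly P u" by (auto simp: adjoin_def)
    have "coeff P i \<in> gen (insert u S)" for i
      using P gen_mono[of S "insert u S"] by (auto simp: polys_over_def)
    then show "z \<in> gen (insert u S)"
      unfolding P(2) poly_altdef
      by (intro subring_intros[OF is_subring_gen]) (auto intro: gen.base)
  qed
qed

lemma noetherian_gen: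
  assumes "finite S" shows "noetherian (gen S)"
  using assms
proof (induction S rule: finite_induct)
  case empty
  have "\<exists>n c. (\<forall>i<n. c i \<in> gen {}) \<and> a n = (\<Sum>i<n. c i * a i)"
    if a: "range a \<subseteq> gen {}" for a :: "nat \<Rightarrow> 'f"
  proof (cases "a 0 = 0")
    case True
    then show ?thesis by (intro exI[of _ 0]) auto
  next
    case False
    obtain c d where cd: "a 0 = emb c" "a 1 = emb d" using a gen_empty by blast
    have "a 1 = emb (d / c) * a 0" using cd False by (simp add: emb_divide)
    then show ?thesis by (intro exI[of _ 1] exI[of _ "\<lambda>_. emb (d / c)"]) (auto intro: gen.scalar)
  qed
  then show ?case unfolding noetherian_def by blast
next
  case (insert u S)
  then show ?case by (simp add: gen_insert noetherian_adjoin is_subring_gen)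
qed

section \<open>Points with values in the ground field\<close>

definition point :: "'f set \<Rightarrow> ('f \<Rightarrow> 'k) \<Rightarrow> bool" where
  "point R \<phi> \<longleftrightarrow> (\<forall>c. \<phi> (emb c) = c) \<and>
     (\<forall>a\<in>R. \<forall>b\<in>R. \<phi> (a + b) = \<phi> a + \<phi> b \<and> \<phi> (a * b) = \<phi> a * \<phi> b)"

lemma point_zero: "point R \<phi> \<Longrightarrow> \<phi> 0 = 0"
  by (metis emb_zero point_def)

lemma point_one: "point R \<phi> \<Longrightarrow> \<phi> 1 = 1"
  by (metis emb_one point_def)

lemma point_sum:
  assumes "is_subring R" "point R \<phi>" "\<And>i. i \<in> I \<Longrightarrow> f i \<in> R"
  shows "\<phi> (\<Sum>i\<in>I. f i) = (\<Sum>i\<in>I. \<phi> (f i))"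
  using assms(3)
proof (induction I rule: infinite_finite_induct)
  case (insert i I)
  then have "(\<Sum>j\<in>I. f j) \<in> R" by (intro subring_sum[OF assms(1)]) auto
  then show ?case using insert assms(2) by (auto simp: point_def)
qed (use point_zero[OF assms(2)] in auto)

lemma coeff_map_point: "point R \<phi> \<Longrightarrow> coeff (map_poly \<phi> P) i = \<phi> (coeff P i)"
  by (simp add: coeff_map_poly point_zero)

lemma map_point_add:
  assumes "point R \<phi>" "P \<in> polys_over R" "Q \<in> polys_over R"
  shows "map_poly \<phi> (P + Q) = map_poly \<phi> P + map_poly \<phi> Q"
  using assms by (intro poly_eqI) (auto simp: coeff_map_point polys_over_def point_def)

lemma map_point_mult:
  assumes "is_subring R" "point R \<phi>" "P \<in> polys_over R" "Q \<in> polys_over R"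
  shows "map_poly \<phi> (P * Q) = map_poly \<phi> P * map_poly \<phi> Q"
proof (intro poly_eqI)
  fix n
  have "\<phi> (coeff (P * Q) n) = (\<Sum>i\<le>n. \<phi> (coeff P i * coeff Q (n - i)))"
    unfolding coeff_mult using assms
    by (intro point_sum) (auto intro!: subring_mult[OF assms(1)] simp: polys_over_def)
  also have "\<dots> = (\<Sum>i\<le>n. \<phi> (coeff P i) * \<phi> (coeff Q (n - i)))"
    using assms by (intro sum.cong) (auto simp: point_def polys_over_def)
  finally show "coeff (map_poly \<phi> (P * Q)) n = coeff (map_poly \<phi> P * map_poly \<phi> Q) n"
    using assms(2) by (simp add: coeff_map_point coeff_mult)
qed

text \<open>Sending \<open>u\<close> to \<open>\<xi>\<close> is consistent as soon as
  \<open>\<xi>\<close> satisfies the image of every relation of \<open>u\<close> over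
  \<open>R\<close>.\<close>

lemma point_adjoin:
  assumes R: "is_subring R" "range emb \<subseteq> R" and \<phi>: "point R \<phi>"
    and wd: "\<And>P. P \<in> polys_over R \<Longrightarrow> poly P u = 0 \<Longrightarrow> poly (map_poly \<phi> P) \<xi> = 0"
  shows "\<exists>\<phi>'. point (adjoin R u) \<phi>' \<and> (\<forall>P\<in>polys_over R. \<phi>' (poly P u) = poly (map_poly \<phi> P) \<xi>)"
proof -
  define \<phi>' where "\<phi>' z = poly (map_poly \<phi> (SOME P. P \<in> polys_over R \<and> z = poly P u)) \<xi>" for z
  have eq: "\<phi>' (poly P u) = poly (map_poly \<phi> P) \<xi>" if P: "P \<in> polys_over R" for P
  proof -
    define Q where "Q = (SOME Q. Q \<in> polys_over R \<and> poly P u = poly Q u)"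
    have Q: "Q \<in> polys_over R" "poly P u = poly Q u"
      using someI[of "\<lambda>Q. Q \<in> polys_over R \<and> poly P u = poly Q u" P] P by (auto simp: Q_def)
    have D: "P - Q \<in> polys_over R" using P Q R polys_over_diff by blast
    have "poly (map_poly \<phi> (P - Q)) \<xi> = 0" by (rule wd[OF D]) (use Q in simp)
    moreover have "map_poly \<phi> P = map_poly \<phi> (P - Q) + map_poly \<phi> Q"
      using map_point_add[OF \<phi> D Q(1)] by simp
    ultimately show ?thesis by (simp add: \<phi>'_def Q_def)
  qed
  have "\<phi>' (emb c) = c" for c
  proof -
    have c: "emb c \<in> R" using R by auto
    have "map_poly \<phi> [:emb c:] = [:c:]"
      using \<phi> by (intro poly_eqI) (auto simp: coeff_map_point coeff_pCons point_def point_zero[OF \<phi>] split: nat.splits)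
    then show ?thesis using eq[OF polys_over_const[OF R(1) c]] by simp
  qed
  moreover have "\<phi>' (a + b) = \<phi>' a + \<phi>' b \<and> \<phi>' (a * b) = \<phi>' a * \<phi>' b"
    if ab: "a \<in> adjoin R u" "b \<in> adjoin R u" for a b
  proof -
    obtain P Q where PQ: "P \<in> polys_over R" "a = poly P u" "Q \<in> polys_over R" "b = poly Q u"
      using ab unfolding adjoin_def by (elim imageE) blast
    have "\<phi>' (poly (P + Q) u) = \<phi>' a + \<phi>' b"
      using PQ \<phi> R eq[OF polys_over_add[OF R(1) PQ(1,3)]] by (simp add: eq map_point_add)
    moreover have "\<phi>' (poly (P * Q) u) = \<phi>' a * \<phi>' b"
      using PQ \<phi> R eq[OF polys_over_mult[OF R(1) PQ(1,3)]] by (simp add: eq map_point_mult)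
    ultimately show ?thesis using PQ by simp
  qed
  ultimately show ?thesis using eq by (intro exI[of _ \<phi>']) (auto simp: point_def)
qed

text \<open>Chevalley's theorem for one generator: the image of the nonvanishing locus of
  \<open>v\<close> contains that of some \<open>w\<close>. The choice of \<open>w\<close> makes the
  degrees that matter survive specialisation.\<close>

lemma extend_point:
  assumes R: "is_subring R" "range emb \<subseteq> R" and v: "v \<in> adjoin R u" "v \<noteq> 0"
  shows "\<exists>w\<in>R. w \<noteq> 0 \<and> (\<forall>\<phi>. point R \<phi> \<longrightarrow> \<phi> w \<noteq> 0 \<longrightarrow>
    (\<exists>\<phi>'. point (adjoin R u) \<phi>' \<and> \<phi>' v \<noteq> 0))"
proof -
  obtain V where V: "V \<in> polys_over R" "v = poly V u" using v by (auto simp: adjoin_def)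
  have [simp]: "V \<noteq> 0" using V v by auto
  show ?thesis
  proof (cases "\<forall>P\<in>polys_over R. poly P u = 0 \<longrightarrow> P = 0")
    case True
    show ?thesis
    proof (intro bexI conjI allI impI)
      show "lead_coeff V \<in> R" using V by (auto intro: polys_overD)
      fix \<phi> assume \<phi>: "point R \<phi>" "\<phi> (lead_coeff V) \<noteq> 0"
      have "map_poly \<phi> V \<noteq> 0" using \<phi> by (metis coeff_map_point coeff_0)
      then have "finite {\<xi>. poly (map_poly \<phi> V) \<xi> = 0}" by (rule poly_roots_finite)
      \<comment> \<open>A transcendental \<open>u\<close> may take any value, so it suffices to
        avoid finitely many roots in the infinite field k.\<close>
      then obtain \<xi> where \<xi>: "poly (map_poly \<phi> V) \<xi> \<noteq> 0"
        using ex_new_if_finite[OF infinite_UNIV_char_0] by blast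
      obtain \<phi>' where "point (adjoin R u) \<phi>'"
        "\<forall>P\<in>polys_over R. \<phi>' (poly P u) = poly (map_poly \<phi> P) \<xi>"
        using point_adjoin[OF R \<phi>(1), of u \<xi>] True by (metis map_poly_0 poly_0)
      then show "\<exists>\<phi>'. point (adjoin R u) \<phi>' \<and> \<phi>' v \<noteq> 0" using V \<xi> by auto
    qed auto
  next
    case False
    define rel where "rel P \<longleftrightarrow> P \<in> polys_over R \<and> poly P u = 0 \<and> P \<noteq> 0" for P
    obtain P where P: "rel P" and Pmin: "\<And>Q. rel Q \<Longrightarrow> degree P \<le> degree Q"
      using False ex_has_least_nat[of rel _ degree] unfolding rel_def by blast
    have Pz: "Q = 0" if "Q \<in> polys_over R" "poly Q u = 0" "degree Q < degree P" for Q
      using Pmin[of Q] that by (auto simp: rel_def)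
    have degP: "degree P > 0"
      using P by (cases P) (auto simp: rel_def split: if_splits)
    \<comment> \<open>A combination \<open>T\<close> of least degree replaces the gcd of
      \<open>V\<close> and \<open>P\<close> over the fraction field; \<open>dv\<close> says that it
      divides both up to powers of its leading coefficient.\<close>
    define I where "I T \<longleftrightarrow> T \<noteq> 0 \<and> (\<exists>A\<in>polys_over R. \<exists>B\<in>polys_over R. T = A * V + B * P)" for T
    have "V = 1 * V + 0 * P" by simp
    then have "I V"
      unfolding I_def using polys_over_one[OF R(1)] polys_over_zero[OF R(1)] \<open>V \<noteq> 0\<close> by blast
    then obtain T where T: "I T" and Tmin: "\<And>Q. I Q \<Longrightarrow> degree T \<le> degree Q"
      using ex_has_least_nat[of I V degree] by blast
    obtain A B where AB: "A \<in> polys_over R" "B \<in> polys_over R" "T = A * V + B * P" "T \<noteq> 0"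
      using T by (auto simp: I_def)
    have PR: "P \<in> polys_over R" "poly P u = 0" "P \<noteq> 0" using P by (auto simp: rel_def)
    have TR: "T \<in> polys_over R"
      using AB V PR by (auto intro!: polys_over_add[OF R(1)] polys_over_mult[OF R(1)])
    define c where "c = lead_coeff T"
    have c: "c \<in> R" "c \<noteq> 0" using AB(4) polys_overD[OF TR] by (simp_all add: c_def)
    have dv: "\<exists>e S. S \<in> polys_over R \<and> smult (c ^ e) W = T * S"
      if W: "W \<in> polys_over R"
        and WI: "\<exists>A'\<in>polys_over R. \<exists>B'\<in>polys_over R. W = A' * V + B' * P" for W
    proof -
      obtain e S T' where 1: "S \<in> polys_over R" "T' \<in> polys_over R"
        "smult (c ^ e) W = T * S + T'" "T' = 0 \<or> degree T' < degree T"
        using pseudo_division_over[OF R(1) TR W] unfolding c_def by blast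
      obtain A' B' where 2: "A' \<in> polys_over R" "B' \<in> polys_over R" "W = A' * V + B' * P"
        using WI by blast
      have "T' = smult (c ^ e) W - T * S" using 1 by simp
      also have "\<dots> = (smult (c ^ e) A' - A * S) * V + (smult (c ^ e) B' - B * S) * P"
        unfolding 2 AB by (simp add: algebra_simps smult_add_right)
      finally have "T' = (smult (c ^ e) A' - A * S) * V + (smult (c ^ e) B' - B * S) * P" .
      moreover have "smult (c ^ e) A' - A * S \<in> polys_over R" "smult (c ^ e) B' - B * S \<in> polys_over R"
        using 1 2 AB c by (auto intro!: polys_over_diff[OF R(1)] polys_over_smult[OF R(1)]
            polys_over_mult[OF R(1)] subring_power[OF R(1)])
      ultimately have "T' \<noteq> 0 \<longrightarrow> I T'" unfolding I_def by blast
      then have "T' = 0" using 1(4) Tmin[of T'] by force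
      then show ?thesis using 1 by auto
    qed
    \<comment> \<open>Otherwise, up to a scalar, \<open>P = T * S\<close> with \<open>S\<close> of
      smaller degree than the minimal relation. Then \<open>u\<close> is a root of \<open>T\<close>,
      hence of \<open>V\<close>, contrary to \<open>v \<noteq> 0\<close>.\<close>
    have "degree T = 0"
    proof (rule ccontr)
      assume dT: "degree T \<noteq> 0"
      obtain e S where S: "S \<in> polys_over R" "smult (c ^ e) P = T * S"
      proof -
        have "P = 0 * V + 1 * P" by simp
        then show thesis
          using that dv[OF PR(1)] polys_over_one[OF R(1)] polys_over_zero[OF R(1)] by blast
      qed
      have "S \<noteq> 0" using S c PR by auto
      then have "degree P = degree T + degree S"
        using S(2) c AB(4) by (metis degree_mult_eq degree_smult_eq power_not_zero)
      then have "poly S u \<noteq> 0" using Pz[OF S(1)] dT \<open>S \<noteq> 0\<close> by auto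
      moreover have "poly T u * poly S u = c ^ e * poly P u"
        using arg_cong[OF S(2), of "\<lambda>p. poly p u"] by simp
      ultimately have Tu: "poly T u = 0" using PR by simp
      obtain e' S' where S': "S' \<in> polys_over R" "smult (c ^ e') V = T * S'"
      proof -
        have "V = 1 * V + 0 * P" by simp
        then show thesis
          using that dv[OF V(1)] polys_over_one[OF R(1)] polys_over_zero[OF R(1)] by blast
      qed
      have "c ^ e' * v = poly T u * poly S' u"
        using arg_cong[OF S'(2), of "\<lambda>p. poly p u"] V by simp
      then show False using Tu c v by simp
    qed
    then obtain r where r: "T = [:r:]" by (metis degree_0_id)
    have "coeff T 0 = r" by (simp only: r coeff_pCons_0)
    then have rr: "r \<in> R" "r \<noteq> 0" using r AB(4) polys_overD[OF TR, of 0] by (metis pCons_0_0)+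
    have Auv: "poly A u * v = r"
      using arg_cong[OF AB(3), of "\<lambda>p. poly p u"] r V PR by simp
    show ?thesis
    proof (intro bexI conjI allI impI)
      \<comment> \<open>The first factor lets \<open>P\<close> keep a root after specialisation; the
        second keeps the product \<open>poly A u * v = r\<close>, hence \<open>v\<close>,
        nonzero.\<close>
      show "lead_coeff P * r \<in> R"
        using rr PR by (auto intro!: subring_mult[OF R(1)] intro: polys_overD)
      show "lead_coeff P * r \<noteq> 0" using rr PR by auto
      fix \<phi> assume \<phi>: "point R \<phi>" "\<phi> (lead_coeff P * r) \<noteq> 0"
      have "\<phi> (lead_coeff P * r) = \<phi> (lead_coeff P) * \<phi> r"
        using \<phi>(1) rr PR by (auto simp: point_def polys_over_def)
      then have nz: "\<phi> (lead_coeff P) \<noteq> 0" "\<phi> r \<noteq> 0" using \<phi>(2) by auto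
      have "degree (map_poly \<phi> P) > 0"
        using le_degree[of "map_poly \<phi> P" "degree P"] nz degP by (simp add: coeff_map_point[OF \<phi>(1)])
      then obtain \<xi> where \<xi>: "poly (map_poly \<phi> P) \<xi> = 0"
        using alg_closed_imp_poly_has_root[of "map_poly \<phi> P"] by blast
      have wd: "poly (map_poly \<phi> Q) \<xi> = 0" if Q: "Q \<in> polys_over R" "poly Q u = 0" for Q
      proof -
        obtain e S T' where 1: "S \<in> polys_over R" "T' \<in> polys_over R"
          "smult (lead_coeff P ^ e) Q = P * S + T'" "T' = 0 \<or> degree T' < degree P"
          using pseudo_division_over[OF R(1) PR(1) Q(1)] by blast
        have "poly T' u = 0" using arg_cong[OF 1(3), of "\<lambda>p. poly p u"] Q PR by simp
        then have "T' = 0" using Pz[of T'] 1 by auto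
        then have eq: "[:lead_coeff P ^ e:] * Q = P * S" using 1 by simp
        have le: "lead_coeff P ^ e \<in> R"
          using PR by (intro subring_power[OF R(1)]) (auto intro: polys_overD)
        have "map_poly \<phi> [:lead_coeff P ^ e:] * map_poly \<phi> Q = map_poly \<phi> P * map_poly \<phi> S"
          using map_point_mult[OF R(1) \<phi>(1) polys_over_const[OF R(1) le] Q(1)]
            map_point_mult[OF R(1) \<phi>(1) PR(1) 1(1)] unfolding eq by simp
        moreover have "poly (map_poly \<phi> [:lead_coeff P ^ e:]) \<xi> = \<phi> (lead_coeff P ^ e)"
          by (simp add: map_poly_pCons point_zero[OF \<phi>(1)])
        ultimately have "\<phi> (lead_coeff P ^ e) * poly (map_poly \<phi> Q) \<xi> =
            poly (map_poly \<phi> P) \<xi> * poly (map_poly \<phi> S) \<xi>"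
          by (metis poly_mult)
        then have "\<phi> (lead_coeff P ^ e) * poly (map_poly \<phi> Q) \<xi> = 0"
          using \<xi> by simp
        moreover have "\<phi> (lead_coeff P ^ e) = \<phi> (lead_coeff P) ^ e"
        proof (induction e)
          case 0 show ?case by (simp add: point_one[OF \<phi>(1)])
        next
          case (Suc e)
          have "lead_coeff P \<in> R" "lead_coeff P ^ e \<in> R"
            using PR by (auto intro!: subring_power[OF R(1)] intro: polys_overD)
          then show ?case using Suc \<phi>(1) by (simp add: point_def)
        qed
        ultimately show ?thesis using nz by simp
      qed
      obtain \<phi>' where \<phi>': "point (adjoin R u) \<phi>'"
        "\<And>P. P \<in> polys_over R \<Longrightarrow> \<phi>' (poly P u) = poly (map_poly \<phi> P) \<xi>"
        using point_adjoin[OF R \<phi>(1) wd] by blast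
      have "\<phi>' (poly A u) * \<phi>' v = \<phi>' (poly A u * v)"
        using \<phi>'(1) AB(1) v by (auto simp: point_def adjoin_def)
      also have "\<dots> = \<phi> r" unfolding Auv
        using \<phi>'(2)[OF polys_over_const[OF R(1) rr(1)]] by (simp add: map_poly_pCons point_zero[OF \<phi>(1)])
      finally have "\<phi>' v \<noteq> 0" using nz by auto
      then show "\<exists>\<phi>'. point (adjoin R u) \<phi>' \<and> \<phi>' v \<noteq> 0" using \<phi>'(1) by blast
    qed
  qed
qed

text \<open>The weak Nullstellensatz, by adding the generators one at a time; the nonzero element
  carried along is what makes the induction work.\<close>

lemma ex_point:
  assumes "finite S" "v \<in> gen S" "v \<noteq> 0"
  shows "\<exists>\<phi>. point (gen S) \<phi> \<and> \<phi> v \<noteq> 0"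
  using assms
proof (induction S arbitrary: v rule: finite_induct)
  case empty
  have inj: "inj emb"
    by (rule injI) (metis emb_diff emb_eq_0_iff eq_iff_diff_eq_0)
  have inv: "inv_into UNIV emb (emb c) = c" for c using inj by (rule inv_f_f)
  have "point (gen {}) (inv_into UNIV emb)"
    unfolding point_def gen_empty by (auto simp: inv simp flip: emb_add emb_mult)
  moreover have "inv_into UNIV emb v \<noteq> 0"
    using empty by (auto simp: gen_empty inv)
  ultimately show ?case by blast
next
  case (insert u S)
  have "range emb \<subseteq> gen S" by (auto intro: gen.scalar)
  from extend_point[OF is_subring_gen this, of v u] insert
  show ?case unfolding gen_insert by blast
qed

end

section \<open>Linear independence of functions\<close>

definition lin_indep :: "'x set \<Rightarrow> nat \<Rightarrow> (nat \<Rightarrow> 'x \<Rightarrow> 'a::field) \<Rightarrow> bool" where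
  "lin_indep X r D \<longleftrightarrow> (\<forall>a. (\<forall>z\<in>X. (\<Sum>j<r. a j * D j z) = 0) \<longrightarrow> (\<forall>j<r. a j = 0))"

definition eval_mat :: "nat \<Rightarrow> (nat \<Rightarrow> 'x \<Rightarrow> 'a) \<Rightarrow> (nat \<Rightarrow> 'x) \<Rightarrow> 'a mat" where
  "eval_mat r D z = mat r r (\<lambda>(i, j). D i (z j))"

lemma eval_mat_carrier [simp]: "eval_mat r D z \<in> carrier_mat r r"
  by (simp add: eval_mat_def)

lemma lin_indep_SucD: "lin_indep X (Suc r) D \<Longrightarrow> lin_indep X r D"
  unfolding lin_indep_def
proof (intro allI impI)
  fix a j
  assume *: "\<forall>a. (\<forall>z\<in>X. (\<Sum>j<Suc r. a j * D j z) = 0) \<longrightarrow> (\<forall>j<Suc r. a j = 0)"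
    and a: "\<forall>z\<in>X. (\<Sum>j<r. a j * D j z) = 0" and j: "j < r"
  show "a j = 0" using *[rule_format, of "a(r := 0)" j] a j by simp
qed

lemma lin_indep_relation:
  assumes "lin_indep X r D" "\<not> lin_indep X (Suc r) D"
  shows "\<exists>a. \<forall>z\<in>X. D r z = (\<Sum>j<r. a j * D j z)"
proof -
  obtain a j where a: "\<And>z. z \<in> X \<Longrightarrow> (\<Sum>j<Suc r. a j * D j z) = 0" and j: "j < Suc r" "a j \<noteq> 0"
    using assms(2) unfolding lin_indep_def by blast
  have "a r \<noteq> 0"
  proof
    assume "a r = 0"
    then have "\<forall>z\<in>X. (\<Sum>j<r. a j * D j z) = 0" using a by simp
    then show False using assms(1) j \<open>a r = 0\<close> unfolding lin_indep_def by (metis less_SucE)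
  qed
  have "D r z = (\<Sum>j<r. (- a j / a r) * D j z)" if "z \<in> X" for z
  proof -
    have "a r * D r z = - (\<Sum>j<r. a j * D j z)" using a[OF that] by (simp add: add_eq_0_iff)
    then have "D r z = - (\<Sum>j<r. a j * D j z) / a r"
      using \<open>a r \<noteq> 0\<close> by (metis nonzero_mult_div_cancel_left)
    then show ?thesis by (simp add: sum_divide_distrib sum_negf)
  qed
  then show ?thesis by (intro exI[of _ "\<lambda>j. - a j / a r"]) blast
qed

lemma det_imp_lin_indep:
  assumes z: "\<And>j. j < r \<Longrightarrow> z j \<in> X" and det: "det (eval_mat r D z) \<noteq> 0"
  shows "lin_indep X r D"
  unfolding lin_indep_def
proof (intro allI impI)
  fix a j assume a: "\<forall>z\<in>X. (\<Sum>j<r. a j * D j z) = 0" and j: "j < r"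
  let ?M = "transpose_mat (eval_mat r D z)"
  have "?M *\<^sub>v vec r a = 0\<^sub>v r"
  proof (intro eq_vecI)
    fix i assume i: "i < dim_vec (0\<^sub>v r :: 'b vec)"
    then have "(?M *\<^sub>v vec r a) $ i = (\<Sum>l<r. D l (z i) * a l)"
      by (auto simp: eval_mat_def scalar_prod_def atLeast0LessThan intro!: sum.cong)
    also have "\<dots> = 0" using a z[of i] i by (simp add: mult.commute)
    finally show "(?M *\<^sub>v vec r a) $ i = 0\<^sub>v r $ i" using i by simp
  qed (simp add: eval_mat_def)
  moreover have "det ?M \<noteq> 0" using det by (simp add: det_transpose[OF eval_mat_carrier])
  ultimately have "vec r a = 0\<^sub>v r"
    using det_0_iff_vec_prod_zero_field[of ?M r] by (metis eval_mat_carrier transpose_carrier_mat vec_carrier)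
  then show "a j = 0" using j by (metis index_vec index_zero_vec(1))
qed

text \<open>Laplace expansion along the last column writes the larger determinant as a combination
  of the \<open>D i\<close>, with the minor already known to be nonzero as coefficient of
  \<open>D r\<close>. Independence supplies a \<open>w\<close> where this combination does not
  vanish.\<close>

lemma lin_indep_imp_det:
  assumes "lin_indep X r D"
  shows "\<exists>z. (\<forall>j<r. z j \<in> X) \<and> det (eval_mat r D z) \<noteq> 0"
  using assms
proof (induction r)
  case 0
  then show ?case by (simp add: eval_mat_def)
next
  case (Suc r)
  then obtain z where z: "\<And>j. j < r \<Longrightarrow> z j \<in> X" and det: "det (eval_mat r D z) \<noteq> 0"
    using lin_indep_SucD by blast
  define A where "A w = eval_mat (Suc r) D (z(r := w))" for w
  have del: "mat_delete (A w) i r = mat_delete (A undefined) i r" if "i < Suc r" for w i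
    using that by (intro eq_matI) (auto simp: A_def eval_mat_def mat_delete_def)
  have last: "mat_delete (A w) r r = eval_mat r D z" for w
    by (intro eq_matI) (auto simp: A_def eval_mat_def mat_delete_def)
  define c where "c i = cofactor (A undefined) i r" for i
  have c: "cofactor (A w) i r = c i" if "i < Suc r" for w i
    unfolding c_def cofactor_def del[OF that, of w] ..
  have exp: "det (A w) = (\<Sum>i<Suc r. c i * D i w)" for w
  proof -
    have "A w \<in> carrier_mat (Suc r) (Suc r)" by (simp add: A_def)
    then have "det (A w) = (\<Sum>i<Suc r. A w $$ (i, r) * cofactor (A w) i r)"
      by (rule laplace_expansion_column) simp
    also have "\<dots> = (\<Sum>i<Suc r. c i * D i w)"
    proof (intro sum.cong refl)
      fix i assume "i \<in> {..<Suc r}"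
      moreover from this have "A w $$ (i, r) = D i w" by (simp add: A_def eval_mat_def)
      ultimately show "A w $$ (i, r) * cofactor (A w) i r = c i * D i w" by (simp add: c)
    qed
    finally show ?thesis .
  qed
  have "c r \<noteq> 0" using det last by (simp add: c_def cofactor_def)
  then obtain w where "w \<in> X" "(\<Sum>i<Suc r. c i * D i w) \<noteq> 0"
    using Suc.prems unfolding lin_indep_def by blast
  then have "det (eval_mat (Suc r) D (z(r := w))) \<noteq> 0"
    using exp[of w] unfolding A_def by metis
  moreover have "\<forall>j<Suc r. (z(r := w)) j \<in> X"
    using z \<open>w \<in> X\<close> by (auto simp: less_Suc_eq)
  ultimately show ?case by blast
qed

section \<open>A Cauchy matrix\<close>

text \<open>The polynomial is the numerator of \<open>\<Sum>l<r. v l / (X + l + N)\<close> over the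
  common denominator; as N > 0, no natural number is a pole.\<close>

lemma cauchy_numerator:
  fixes v :: "nat \<Rightarrow> 'k::field_char_0" and N :: nat
  assumes "N > 0"
  shows "poly (\<Sum>l<r. smult (v l) (\<Prod>i\<in>{..<r} - {l}. [:of_nat (i + N), 1:])) (of_nat s) =
    (\<Prod>i<r. of_nat (i + s + N)) * (\<Sum>l<r. v l / of_nat (l + s + N))"
proof -
  have "v l * (\<Prod>i\<in>{..<r} - {l}. of_nat (i + N) + of_nat s) =
      (\<Prod>i<r. of_nat (i + s + N)) * (v l / of_nat (l + s + N))" if "l \<in> {..<r}" for l
  proof -
    have "(\<Prod>i<r. of_nat (i + s + N) :: 'k) = of_nat (l + s + N) * (\<Prod>i\<in>{..<r} - {l}. of_nat (i + s + N))"
      using that by (intro prod.remove) auto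
    moreover have "(of_nat (l + s + N) :: 'k) \<noteq> 0" using assms by (simp only: of_nat_eq_0_iff)
    ultimately show ?thesis by (simp add: ac_simps)
  qed
  then show ?thesis by (simp add: poly_sum poly_prod sum_distrib_left)
qed

text \<open>At the pole -(l + N) every summand but that of \<open>v l\<close> has a vanishing
  factor, so the residue recovers \<open>v l\<close>.\<close>

lemma cauchy_pole:
  fixes v :: "nat \<Rightarrow> 'k::field_char_0"
  assumes "l < r"
  shows "poly (\<Sum>l<r. smult (v l) (\<Prod>i\<in>{..<r} - {l}. [:of_nat (i + N), 1:])) (- of_nat (l + N)) =
    v l * (\<Prod>i\<in>{..<r} - {l}. of_nat i - of_nat l)"
proof -
  have "(\<Prod>i\<in>{..<r} - {m}. of_nat (i + N) + - of_nat (l + N)) = (0 :: 'k)" if "m < r" "m \<noteq> l" for m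
    using that assms by (intro prod_zero) auto
  then have "(\<Sum>m<r. v m * (\<Prod>i\<in>{..<r} - {m}. of_nat (i + N) + - of_nat (l + N))) =
      (\<Sum>m<r. if m = l then v l * (\<Prod>i\<in>{..<r} - {l}. of_nat i - of_nat l) else 0)"
    by (intro sum.cong refl) auto
  then show ?thesis using assms by (simp add: poly_sum poly_prod)
qed

lemma cauchy_degree:
  "degree (\<Sum>l<r. smult (v l :: 'k::field_char_0) (\<Prod>i\<in>{..<r} - {l}. [:of_nat (i + N), 1:])) \<le> r - 1"
proof (intro degree_sum_le)
  fix l assume "l \<in> {..<r}"
  then have "degree (\<Prod>i\<in>{..<r} - {l}. [:of_nat (i + N), 1 :: 'k:]) \<le> r - 1"
    by (intro order.trans[OF degree_prod_sum_le]) auto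
  then show "degree (smult (v l) (\<Prod>i\<in>{..<r} - {l}. [:of_nat (i + N), 1:])) \<le> r - 1"
    by (rule order.trans[OF degree_smult_le])
qed auto

lemma poly_eq_0_if_many_roots:
  fixes p :: "'k::field_char_0 poly"
  assumes "finite A" "degree p < card A" "\<And>x. x \<in> A \<Longrightarrow> poly p x = 0"
  shows "p = 0"
proof (rule ccontr)
  assume "p \<noteq> 0"
  then have "card A \<le> card {x. poly p x = 0}"
    using assms(3) by (intro card_mono poly_roots_finite) auto
  also have "\<dots> \<le> degree p" by (rule card_poly_roots_bound) fact
  finally show False using assms by simp
qed

text \<open>Degree against number of roots. A kernel vector would give a numerator of degree below r
  with the roots 0, ..., r - 1. If some \<open>\<alpha> l\<close> were 0, the common denominator
  minus the numerator of \<open>\<alpha>\<close>, of degree at most r, would besides these roots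
  also have -(l + N) and so be 0, although the denominator has degree r and the numerator
  less.\<close>

lemma cauchy_matrix:
  fixes N r :: nat
  assumes N: "N > 0"
  shows "\<exists>(\<alpha> :: nat \<Rightarrow> 'k::field_char_0) (B :: nat \<Rightarrow> nat \<Rightarrow> 'k).
    (\<forall>s<r. (\<Sum>l<r. \<alpha> l / of_nat (l + s + N)) = 1) \<and> (\<forall>l<r. \<alpha> l \<noteq> 0) \<and>
    (\<forall>l<r. \<forall>m<r. (\<Sum>s<r. B l s / of_nat (m + s + N)) = (if l = m then 1 else 0))"
proof -
  define C :: "'k mat" where "C = mat r r (\<lambda>(s, l). 1 / of_nat (l + s + N))"
  have C: "C \<in> carrier_mat r r" by (simp add: C_def)
  define p where "p v = (\<Sum>l<r. smult (v l) (\<Prod>i\<in>{..<r} - {l}. [:of_nat (i + N), 1 :: 'k:]))" for v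
  have diff: "(\<Prod>i\<in>{..<r} - {l}. of_nat i - of_nat l :: 'k) \<noteq> 0" for l
    by (subst prod_zero_iff) auto
  have card: "card (of_nat ` {..<r} :: 'k set) = r"
    by (simp add: card_image inj_on_def)
  have "det C \<noteq> 0"
  proof
    assume "det C = 0"
    then obtain v where v: "v \<in> carrier_vec r" "v \<noteq> 0\<^sub>v r" "C *\<^sub>v v = 0\<^sub>v r"
      using det_0_iff_vec_prod_zero_field[OF C] by blast
    have 0: "(\<Sum>l<r. v $ l / of_nat (l + s + N)) = 0" if "s < r" for s
    proof -
      have "(C *\<^sub>v v) $ s = (\<Sum>l<r. v $ l / of_nat (l + s + N))"
        using that v(1) by (auto simp: C_def scalar_prod_def atLeast0LessThan intro!: sum.cong)
      then show ?thesis using v(3) that by simp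
    qed
    have "v $ l = 0" if l: "l < r" for l
    proof -
      have "p (\<lambda>l. v $ l) = 0"
      proof (rule poly_eq_0_if_many_roots[of "of_nat ` {..<r}"])
        show "degree (p (\<lambda>l. v $ l)) < card (of_nat ` {..<r} :: 'k set)"
          unfolding card p_def using l by (intro le_less_trans[OF cauchy_degree]) auto
        fix x :: 'k assume "x \<in> of_nat ` {..<r}"
        then show "poly (p (\<lambda>l. v $ l)) x = 0"
          using 0 unfolding p_def by (auto simp only: cauchy_numerator[OF N] lessThan_iff mult_zero_right)
      qed auto
      then show "v $ l = 0" using cauchy_pole[OF l, of "\<lambda>l. v $ l" N] diff[of l] by (simp add: p_def)
    qed
    then have "v = 0\<^sub>v r" using v(1) by (intro eq_vecI) auto
    then show False using v(2) by simp
  qed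
  then obtain B where B: "B \<in> carrier_mat r r" "B * C = 1\<^sub>m r" "C * B = 1\<^sub>m r"
    using det_non_zero_imp_unit[OF C] unfolding Units_def ring_mat_def by auto
  define \<alpha> where "\<alpha> l = (\<Sum>s<r. B $$ (l, s))" for l
  define B' where "B' l s = B $$ (l, s)" for l s
  have BC: "(\<Sum>s<r. B' l s / of_nat (m + s + N)) = (if l = m then 1 else 0)" if "l < r" "m < r" for l m
  proof -
    have "(B * C) $$ (l, m) = (\<Sum>s<r. B $$ (l, s) / of_nat (m + s + N))"
      using that B(1) by (auto simp: C_def scalar_prod_def atLeast0LessThan intro!: sum.cong)
    then show ?thesis using B(2) that by (simp add: B'_def)
  qed
  have \<alpha>: "(\<Sum>l<r. \<alpha> l / of_nat (l + s + N)) = 1" if "s < r" for s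
  proof -
    have CB: "(\<Sum>l<r. B $$ (l, m) / of_nat (l + s + N)) = (if s = m then 1 else 0)" if "m < r" for m
    proof -
      have "(C * B) $$ (s, m) = (\<Sum>l<r. B $$ (l, m) / of_nat (l + s + N))"
        using that \<open>s < r\<close> B(1) by (auto simp: C_def scalar_prod_def atLeast0LessThan intro!: sum.cong)
      then show ?thesis using B(3) that \<open>s < r\<close> by simp
    qed
    have "(\<Sum>l<r. \<alpha> l / of_nat (l + s + N)) = (\<Sum>m<r. \<Sum>l<r. B $$ (l, m) / of_nat (l + s + N))"
      unfolding \<alpha>_def sum_divide_distrib by (rule sum.swap)
    also have "\<dots> = (\<Sum>m<r. if s = m then 1 else 0)" by (intro sum.cong refl CB) auto
    finally show ?thesis using that by simp
  qed
  have \<alpha>0: "\<alpha> l \<noteq> 0" if l: "l < r" for l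
  proof
    assume "\<alpha> l = 0"
    define R :: "'k poly" where "R = (\<Prod>i<r. [:of_nat (i + N), 1:])"
    have degR: "degree R = r" unfolding R_def by (subst degree_prod_eq_sum_degree) auto
    define q where "q = R - p \<alpha>"
    have "q = 0"
    proof (rule poly_eq_0_if_many_roots[of "insert (- of_nat (l + N)) (of_nat ` {..<r})"])
      have "- of_nat (l + N) \<noteq> (of_nat n :: 'k)" for n
      proof
        assume "- of_nat (l + N) = (of_nat n :: 'k)"
        then have "(of_nat (n + (l + N)) :: 'k) = 0" by (metis add.right_inverse add_uminus_conv_diff of_nat_add add.commute)
        then show False using N by (simp only: of_nat_eq_0_iff)
      qed
      then have "(- of_nat (l + N) :: 'k) \<notin> of_nat ` {..<r}" by blast
      then have "card (insert (- of_nat (l + N)) (of_nat ` {..<r}) :: 'k set) = Suc r"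
        using card by simp
      moreover have "degree q \<le> r" unfolding q_def p_def
        using degR by (intro degree_diff_le order.trans[OF cauchy_degree]) auto
      ultimately show "degree q < card (insert (- of_nat (l + N)) (of_nat ` {..<r}) :: 'k set)" by simp
      fix x :: 'k assume "x \<in> insert (- of_nat (l + N)) (of_nat ` {..<r})"
      then consider "x = - of_nat (l + N)" | s where "s < r" "x = of_nat s" by blast
      then show "poly q x = 0"
      proof cases
        case 1
        have "poly R x = 0" unfolding R_def poly_prod using l 1 by (intro prod_zero) auto
        moreover have "poly (p \<alpha>) x = 0"
          unfolding 1 p_def cauchy_pole[OF l] using \<open>\<alpha> l = 0\<close> by simp
        ultimately show ?thesis by (simp add: q_def)
      next
        case 2
        have "poly (p \<alpha>) x = (\<Prod>i<r. of_nat (i + s + N))"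
          unfolding 2 p_def cauchy_numerator[OF N] using \<alpha> 2 by simp
        moreover have "poly R x = (\<Prod>i<r. of_nat (i + s + N))"
          unfolding R_def poly_prod 2 by (intro prod.cong) (auto simp: ac_simps)
        ultimately show ?thesis by (simp add: q_def)
      qed
    qed auto
    then have "R = p \<alpha>" by (simp add: q_def)
    then have "degree R \<le> r - 1" using cauchy_degree[where r = r and v = \<alpha> and N = N] by (simp add: p_def)
    then show False using degR l by simp
  qed
  show ?thesis
    by (rule exI[of _ \<alpha>], rule exI[of _ B']) (simp add: \<alpha> \<alpha>0 BC del: of_nat_add)
qed

section \<open>Derivations of a field\<close>

context scalar_embedding
begin

definition der :: "('f \<Rightarrow> 'f) \<Rightarrow> bool" where
  "der D \<longleftrightarrow> (\<forall>a b. D (a + b) = D a + D b) \<and> (\<forall>a b. D (a * b) = a * D b + D a * b) \<and>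
     (\<forall>c. D (emb c) = 0)"

definition brk :: "('f \<Rightarrow> 'f) \<Rightarrow> ('f \<Rightarrow> 'f) \<Rightarrow> 'f \<Rightarrow> 'f" where
  "brk D E = (\<lambda>z. D (E z) - E (D z))"

primrec iter_brk :: "('f \<Rightarrow> 'f) \<Rightarrow> ('f \<Rightarrow> 'f) \<Rightarrow> nat \<Rightarrow> 'f \<Rightarrow> 'f" where
  "iter_brk d e 0 = e"
| "iter_brk d e (Suc j) = brk d (iter_brk d e j)"

lemma der_zero_fun: "der (\<lambda>z. 0)" by (simp add: der_def)

context
  fixes D assumes D: "der D"
begin

lemma der_add: "D (a + b) = D a + D b" using D by (simp add: der_def)
lemma der_mult: "D (a * b) = a * D b + D a * b" using D by (simp add: der_def)
lemma der_emb: "D (emb c) = 0" using D by (simp add: der_def)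
lemma der_0: "D 0 = 0" using der_emb[of 0] by simp
lemma der_1: "D 1 = 0" using der_emb[of 1] by simp
lemma der_of_nat: "D (of_nat n) = 0" using der_emb[of "of_nat n"] by simp
lemma der_uminus: "D (- a) = - D a" using der_add[of a "- a"] der_0 by (simp add: add_eq_0_iff)
lemma der_diff: "D (a - b) = D a - D b" using der_add[of a "- b"] der_uminus[of b] by simp
lemma der_sum: "D (\<Sum>i\<in>I. f i) = (\<Sum>i\<in>I. D (f i))"
  by (induction I rule: infinite_finite_induct) (auto simp: der_0 der_add)
lemma der_of_nat_mult: "D (of_nat n * a) = of_nat n * D a" by (simp add: der_mult der_of_nat)
lemma der_emb_mult: "D (emb c * a) = emb c * D a" by (simp add: der_mult der_emb)
lemma der_power: "D (a ^ n) = of_nat n * a ^ (n - 1) * D a"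
proof (induction n)
  case (Suc n)
  then show ?case by (cases n) (auto simp: der_mult algebra_simps)
qed (simp add: der_1)
lemma der_inverse:
  assumes "a \<noteq> 0" shows "D (inverse a) = - D a * inverse a ^ 2"
proof -
  have "D (a * inverse a) = 0" using assms by (simp add: der_1)
  then have "a * D (inverse a) = - (D a * inverse a)"
    by (simp add: der_mult add_eq_0_iff)
  then have "D (inverse a) = - (D a * inverse a) / a"
    using assms by (metis nonzero_mult_div_cancel_left)
  then show ?thesis by (simp only: power2_eq_square divide_inverse mult_minus_left mult.assoc)
qed

end

lemma der_lincomb: "der D \<Longrightarrow> der E \<Longrightarrow> der (\<lambda>z. a * D z + b * E z)"
  by (simp add: der_def algebra_simps)

lemma der_plus_scale: "der D \<Longrightarrow> der E \<Longrightarrow> der (\<lambda>z. D z + b * E z)"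
  by (simp add: der_def algebra_simps)

lemma der_scale: "der D \<Longrightarrow> der (\<lambda>z. a * D z)"
  by (simp add: der_def algebra_simps)

lemma der_sum_fun: "(\<And>i. i \<in> I \<Longrightarrow> der (D i)) \<Longrightarrow> der (\<lambda>z. \<Sum>i\<in>I. a i * D i z)"
proof (induction I rule: infinite_finite_induct)
  case (insert i I)
  then have "der (\<lambda>z. a i * D i z + 1 * (\<Sum>i\<in>I. a i * D i z))" by (intro der_lincomb) auto
  then show ?case using insert by simp
qed (auto simp: der_zero_fun)

lemma der_brk: assumes "der D" "der E" shows "der (brk D E)"
proof -
  have "brk D E (a * b) = a * brk D E b + brk D E a * b" for a b
    by (simp add: brk_def der_add[OF assms(1)] der_add[OF assms(2)] der_mult[OF assms(1)]
        der_mult[OF assms(2)] algebra_simps)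
  moreover have "brk D E (a + b) = brk D E a + brk D E b" "brk D E (emb c) = 0" for a b c
    using der_0[OF assms(1)] der_0[OF assms(2)]
    by (simp_all add: brk_def der_add[OF assms(1)] der_add[OF assms(2)] der_emb[OF assms(1)]
        der_emb[OF assms(2)])
  ultimately show ?thesis unfolding der_def by blast
qed

lemma der_iter_brk: "der d \<Longrightarrow> der e \<Longrightarrow> der (iter_brk d e j)"
  by (induction j) (auto intro: der_brk)

lemma brk_scale: "der d \<Longrightarrow> brk d (\<lambda>z. a * W z) z = a * brk d W z + d a * W z"
  by (simp add: brk_def der_mult algebra_simps)

lemma brk_sum: "der d \<Longrightarrow> brk d (\<lambda>z. \<Sum>i\<in>I. W i z) z = (\<Sum>i\<in>I. brk d (W i) z)"
  by (simp add: brk_def der_sum sum_subtractf)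

lemma iter_brk_const:
  assumes "der d" "der e" "e x = 0" "d x = 1"
  shows "iter_brk d e j x = 0"
  using assms
proof (induction j)
  case (Suc j)
  then show ?case by (simp add: brk_def der_0 der_1 der_iter_brk)
qed auto

text \<open>Evaluations can be confined to generators, so that a finite matrix detects independence;
  this bounds the rank by their number.\<close>

lemma lin_indep_on_generators:
  assumes S: "\<And>D. der D \<Longrightarrow> (\<forall>s\<in>S. D s = 0) \<Longrightarrow> (\<forall>z. D z = 0)"
    and D: "\<And>j. j < r \<Longrightarrow> der (D j)" and ind: "lin_indep UNIV r D"
  shows "lin_indep S r D"
  unfolding lin_indep_def
proof (intro allI impI)
  fix a j assume a: "\<forall>z\<in>S. (\<Sum>j<r. a j * D j z) = 0" and j: "j < r"
  have "der (\<lambda>z. \<Sum>j<r. a j * D j z)" using D by (intro der_sum_fun) auto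
  from S[OF this] a have "\<forall>z. (\<Sum>j<r. a j * D j z) = 0" by blast
  then show "a j = 0" using ind j unfolding lin_indep_def by blast
qed

lemma lin_indep_rank_bound:
  assumes "finite S" "lin_indep S r D"
  shows "r \<le> card S"
proof -
  obtain z where z: "\<And>j. j < r \<Longrightarrow> z j \<in> S" "det (eval_mat r D z) \<noteq> 0"
    using lin_indep_imp_det[OF assms(2)] by blast
  have "inj_on z {..<r}"
  proof (rule inj_onI, rule ccontr)
    fix i j assume ij: "i \<in> {..<r}" "j \<in> {..<r}" "z i = z j" "i \<noteq> j"
    have "det (eval_mat r D z) = 0"
      using ij by (intro det_identical_columns[OF eval_mat_carrier, of i j])
        (auto simp: eval_mat_def intro!: eq_vecI)
    then show False using z by simp
  qed
  then have "r = card (z ` {..<r})" by (simp add: card_image)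
  also have "\<dots> \<le> card S" using z assms by (intro card_mono) auto
  finally show ?thesis .
qed

text \<open>The derivative at \<open>c = 0\<close> of the iterated brackets of \<open>d + c s e\<close> with \<open>e\<close>.\<close>

primrec variation :: "('f \<Rightarrow> 'f) \<Rightarrow> ('f \<Rightarrow> 'f) \<Rightarrow> nat \<Rightarrow> 'f \<Rightarrow> 'f \<Rightarrow> 'f" where
  "variation d e 0 s z = 0"
| "variation d e (Suc j) s z = d (variation d e j s z) - variation d e j s (d z) +
     (s * e (iter_brk d e j z) - iter_brk d e j (s * e z))"

text \<open>The values at z of the iterated brackets of d + c s e with e, as polynomials in the
  parameter c. Evaluation is at natural numbers, which every derivation treats as constants; there
  are enough of them to detect a nonzero polynomial.\<close>

primrec variation_poly :: "('f \<Rightarrow> 'f) \<Rightarrow> ('f \<Rightarrow> 'f) \<Rightarrow> 'f \<Rightarrow> nat \<Rightarrow> 'f \<Rightarrow> 'f poly" where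
  "variation_poly d e s 0 z = [:e z:]"
| "variation_poly d e s (Suc j) z =
     map_poly d (variation_poly d e s j z) + pCons 0 (smult s (map_poly e (variation_poly d e s j z)))
     - variation_poly d e s j (d z) - pCons 0 (variation_poly d e s j (s * e z))"

lemma poly_map_der:
  assumes "der D" shows "poly (map_poly D p) (of_nat c) = D (poly p (of_nat c))"
  by (induction p) (auto simp: map_poly_pCons der_0[OF assms] der_add[OF assms] der_of_nat_mult[OF assms])

lemma poly_variation_poly:
  assumes d: "der d" and e: "der e"
  shows "poly (variation_poly d e s j z) (of_nat c) =
    iter_brk (\<lambda>z. d z + of_nat c * s * e z) e j z"
proof (induction j arbitrary: z)
  case (Suc j)
  let ?E = "iter_brk (\<lambda>z. d z + of_nat c * s * e z) e j"
  have E: "der ?E" by (intro der_iter_brk der_plus_scale d e)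
  have "?E (d z + of_nat c * s * e z) = ?E (d z) + of_nat c * ?E (s * e z)"
    using der_of_nat_mult[OF E, of c "s * e z"] unfolding der_add[OF E] by (simp only: mult.assoc)
  then show ?case
    by (simp add: Suc poly_map_der[OF d] poly_map_der[OF e] brk_def algebra_simps)
qed simp

lemma coeff_0_variation_poly:
  assumes d: "der d" and e: "der e"
  shows "coeff (variation_poly d e s j z) 0 = iter_brk d e j z"
  using poly_variation_poly[OF assms, of s j z 0] by (simp add: poly_0_coeff_0)

lemma coeff_1_variation_poly:
  assumes d: "der d" and e: "der e"
  shows "coeff (variation_poly d e s j z) 1 = variation d e j s z"
proof (induction j arbitrary: z)
  case (Suc j)
  then show ?case
    by (simp add: coeff_map_poly der_0[OF d] der_0[OF e] coeff_0_variation_poly[OF d e])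
qed simp

text \<open>If the combination escaped the span, a determinant formed with the iterated brackets and
  it would be nonzero. The combination is the value at c = 0 of the relation taken on the brackets
  of d + c s e and divided by c. The determinant, a polynomial in c, would then be nonzero at some
  positive integer c, and d + c s e would have rank r + 1.\<close>

lemma variation_in_span:
  fixes d e :: "'f \<Rightarrow> 'f"
  assumes d: "der d" and e: "der e"
    and ind: "lin_indep UNIV r (iter_brk d e)"
    and rel: "\<And>z. iter_brk d e r z = (\<Sum>j<r. a j * iter_brk d e j z)"
    and max: "\<And>t. \<not> lin_indep UNIV (Suc r) (iter_brk (\<lambda>z. d z + t * e z) e)"
  shows "\<exists>b. \<forall>z. variation d e r s z - (\<Sum>j<r. a j * variation d e j s z) =
    (\<Sum>j<r. b j * iter_brk d e j z)"
proof (rule ccontr)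
  assume no: "\<nexists>b. \<forall>z. variation d e r s z - (\<Sum>j<r. a j * variation d e j s z) =
    (\<Sum>j<r. b j * iter_brk d e j z)"
  define E where "E j = (if j < r then iter_brk d e j
    else (\<lambda>z. variation d e r s z - (\<Sum>j<r. a j * variation d e j s z)))" for j
  have "lin_indep UNIV r E" using ind by (simp add: lin_indep_def E_def)
  moreover have "\<nexists>b. \<forall>z\<in>UNIV. E r z = (\<Sum>j<r. b j * E j z)" using no by (simp add: E_def)
  ultimately have "lin_indep UNIV (Suc r) E" using lin_indep_relation by blast
  then obtain z where det: "det (eval_mat (Suc r) E z) \<noteq> 0" using lin_indep_imp_det by blast
  define p where "p j = variation_poly d e s r (z j) - (\<Sum>i<r. smult (a i) (variation_poly d e s i (z j)))" for j
  \<comment> \<open>By \<open>rel\<close> there is no constant term; dividing by the parameter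
    leaves a row that specialises at 0 to the combination of variations.\<close>
  have "coeff (p j) 0 = 0" for j
    using rel[of "z j"] by (simp add: p_def coeff_sum coeff_0_variation_poly[OF d e])
  then have "\<exists>q. p j = pCons 0 q" for j by (metis coeff_pCons_0 pCons_cases)
  then obtain q where q: "\<And>j. p j = pCons 0 (q j)" by metis
  define M where "M = mat (Suc r) (Suc r) (\<lambda>(i, j). if i < r then variation_poly d e s i (z j) else q j)"
  have evalM: "poly (det M) c = det (mat (Suc r) (Suc r) (\<lambda>(i, j). poly (M $$ (i, j)) c))" for c
  proof -
    interpret comm_ring_hom "\<lambda>p. poly p c" by unfold_locales auto
    have "map_mat (\<lambda>p. poly p c) M = mat (Suc r) (Suc r) (\<lambda>(i, j). poly (M $$ (i, j)) c)"
      by (intro eq_matI) (auto simp: M_def)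
    then show ?thesis using hom_det[of M] by simp
  qed
  have "poly (q j) 0 = E r (z j)" for j
  proof -
    have "poly (q j) 0 = coeff (p j) 1" by (simp add: q poly_0_coeff_0)
    then show ?thesis
      by (simp add: p_def E_def coeff_sum coeff_1_variation_poly[OF d e, simplified])
  qed
  then have "mat (Suc r) (Suc r) (\<lambda>(i, j). poly (M $$ (i, j)) 0) = eval_mat (Suc r) E z"
    by (intro eq_matI)
       (auto simp: eval_mat_def M_def E_def poly_0_coeff_0 coeff_0_variation_poly[OF d e] less_Suc_eq)
  then have "poly (det M) 0 \<noteq> 0" using det by (simp add: evalM)
  then have "det M \<noteq> 0" by auto
  then have "finite {c. poly (det M) c = 0}" by (rule poly_roots_finite)
  moreover have "infinite (of_nat ` {0<..} :: 'f set)"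
    using infinite_Ioi[of "0::nat"] by (subst finite_image_iff) (auto intro: inj_on_subset[OF inj_of_nat_field])
  ultimately have "\<not> of_nat ` {0<..} \<subseteq> {c. poly (det M) c = 0}"
    using finite_subset by blast
  then obtain c where c: "c > 0" "poly (det M) (of_nat c) \<noteq> 0" by auto
  define F where "F = iter_brk (\<lambda>z. d z + of_nat c * s * e z) e"
  define F' where "F' j = (if j < r then F j else (\<lambda>z. (F r z - (\<Sum>i<r. a i * F i z)) / of_nat c))" for j
  have "poly (q j) (of_nat c) = F' r (z j)" for j
  proof -
    have "of_nat c * poly (q j) (of_nat c) = poly (p j) (of_nat c)" by (simp add: q)
    also have "\<dots> = F r (z j) - (\<Sum>i<r. a i * F i (z j))"
      by (simp add: p_def F_def poly_sum poly_variation_poly[OF d e])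
    finally show ?thesis using c by (simp add: F'_def eq_divide_eq mult.commute)
  qed
  then have "mat (Suc r) (Suc r) (\<lambda>(i, j). poly (M $$ (i, j)) (of_nat c)) = eval_mat (Suc r) F' z"
    by (intro eq_matI)
       (auto simp: eval_mat_def M_def F'_def F_def poly_variation_poly[OF d e] less_Suc_eq)
  then have "det (eval_mat (Suc r) F' z) \<noteq> 0" using c by (simp add: evalM)
  then have ind': "lin_indep UNIV (Suc r) F'" by (intro det_imp_lin_indep[of _ z]) auto
  have "lin_indep UNIV (Suc r) F"
    unfolding lin_indep_def
  proof (intro allI impI)
    fix b j assume b: "\<forall>z\<in>UNIV. (\<Sum>j<Suc r. b j * F j z) = 0" and j: "j < Suc r"
    \<comment> \<open>The coefficients of the same combination with respect to \<open>F'\<close>,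
      whose last member is \<open>F r\<close> minus the relation, divided by c.\<close>
    define b' where "b' j = (if j < r then b j + b r * a j else b r * of_nat c)" for j
    have "(\<Sum>j<Suc r. b' j * F' j z) = 0" for z
    proof -
      have "(\<Sum>j<Suc r. b' j * F' j z) =
        (\<Sum>j<r. b j * F j z + b r * (a j * F j z)) + b r * (F r z - (\<Sum>i<r. a i * F i z))"
      proof -
        have "b r * of_nat c * ((F r z - (\<Sum>i<r. a i * F i z)) / of_nat c) =
            b r * (F r z - (\<Sum>i<r. a i * F i z))" using c by simp
        moreover have "(\<Sum>j<r. b' j * F' j z) = (\<Sum>j<r. b j * F j z + b r * (a j * F j z))"
          by (intro sum.cong refl) (auto simp: b'_def F'_def algebra_simps)
        ultimately show ?thesis by (simp add: b'_def F'_def)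
      qed
      also have "\<dots> = (\<Sum>j<Suc r. b j * F j z)"
        by (simp add: sum.distrib sum_distrib_left algebra_simps)
      finally show ?thesis using b by simp
    qed
    then have b'0: "b' j = 0" if "j < Suc r" for j using ind' that unfolding lin_indep_def by blast
    have "b r = 0" using b'0[of r] c by (simp add: b'_def)
    then show "b j = 0" using b'0[of j] j by (auto simp: b'_def less_Suc_eq)
  qed
  then show False using max[of "of_nat c * s"] by (simp add: F_def)
qed

section \<open>Stability of the span of the iterated brackets\<close>

definition in_span :: "('f \<Rightarrow> 'f) \<Rightarrow> ('f \<Rightarrow> 'f) \<Rightarrow> nat \<Rightarrow> ('f \<Rightarrow> 'f) \<Rightarrow> bool" where
  "in_span d e r W \<longleftrightarrow> (\<exists>b. \<forall>z. W z = (\<Sum>j<r. b j * iter_brk d e j z))"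

lemma in_span_zero: "in_span d e r (\<lambda>z. 0)"
  unfolding in_span_def by (intro exI[of _ "\<lambda>_. 0"]) simp

lemma in_span_add:
  assumes "in_span d e r W" "in_span d e r W'"
  shows "in_span d e r (\<lambda>z. W z + W' z)"
proof -
  obtain b b' where "\<And>z. W z = (\<Sum>j<r. b j * iter_brk d e j z)"
    "\<And>z. W' z = (\<Sum>j<r. b' j * iter_brk d e j z)"
    using assms unfolding in_span_def by blast
  then show ?thesis unfolding in_span_def
    by (intro exI[of _ "\<lambda>j. b j + b' j"]) (simp add: sum.distrib distrib_right)
qed

lemma in_span_scale:
  assumes "in_span d e r W" shows "in_span d e r (\<lambda>z. c * W z)"
proof -
  obtain b where "\<And>z. W z = (\<Sum>j<r. b j * iter_brk d e j z)"
    using assms unfolding in_span_def by blast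
  then show ?thesis unfolding in_span_def
    by (intro exI[of _ "\<lambda>j. c * b j"]) (simp add: sum_distrib_left mult.assoc)
qed

lemma in_span_diff:
  assumes "in_span d e r W" "in_span d e r W'"
  shows "in_span d e r (\<lambda>z. W z - W' z)"
  using in_span_add[OF assms(1) in_span_scale[OF assms(2), of "- 1"]] by simp

lemma in_span_sum:
  assumes "\<And>i. i \<in> I \<Longrightarrow> in_span d e r (W i)"
  shows "in_span d e r (\<lambda>z. \<Sum>i\<in>I. W i z)"
  using assms
  by (induction I rule: infinite_finite_induct) (auto intro: in_span_zero in_span_add)

lemma in_span_iter_brk: "j < r \<Longrightarrow> in_span d e r (iter_brk d e j)"
  unfolding in_span_def
  by (intro exI[of _ "\<lambda>i. if i = j then 1 else 0"])
     (simp add: if_distrib[of "\<lambda>u. u * _"] sum.delta cong: if_cong)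

lemma in_span_brk:
  assumes d: "der d" and rel: "in_span d e r (iter_brk d e r)" and W: "in_span d e r W"
  shows "in_span d e r (brk d W)"
proof -
  obtain b where b: "\<And>z. W z = (\<Sum>j<r. b j * iter_brk d e j z)"
    using W unfolding in_span_def by blast
  have S: "in_span d e r (iter_brk d e (Suc j))" if "j < r" for j
    using rel in_span_iter_brk[of "Suc j" r d e] that by (cases "Suc j = r") auto
  have "in_span d e r (\<lambda>z. \<Sum>j<r. b j * iter_brk d e (Suc j) z + d (b j) * iter_brk d e j z)"
    by (intro in_span_sum in_span_add in_span_scale S in_span_iter_brk) auto
  moreover have "brk d W z = (\<Sum>j<r. b j * iter_brk d e (Suc j) z + d (b j) * iter_brk d e j z)" for z
  proof -
    have "brk d W z = brk d (\<lambda>z. \<Sum>j<r. b j * iter_brk d e j z) z"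
      using b by (simp add: brk_def)
    then show ?thesis by (simp add: brk_sum[OF d] brk_scale[OF d])
  qed
  ultimately show ?thesis by (simp add: in_span_def)
qed

text \<open>Iterated commutators of \<open>s \<mapsto> variation d e j s\<close> with multiplication by \<open>x\<close>; each of them lowers
  its order as a differential operator in \<open>s\<close>.\<close>

primrec mult_comm_variation ::
  "('f \<Rightarrow> 'f) \<Rightarrow> ('f \<Rightarrow> 'f) \<Rightarrow> 'f \<Rightarrow> nat \<Rightarrow> nat \<Rightarrow> 'f \<Rightarrow> 'f \<Rightarrow> 'f" where
  "mult_comm_variation d e x 0 j s = variation d e j s"
| "mult_comm_variation d e x (Suc m) j s =
     (\<lambda>z. mult_comm_variation d e x m j (x * s) z - x * mult_comm_variation d e x m j s z)"

context
  fixes d e :: "'f \<Rightarrow> 'f" and x :: 'f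
  assumes d: "der d" and e: "der e" and dx: "d x = 1" and ex: "e x = 0"
begin

lemma mult_comm_variation_0: "mult_comm_variation d e x m 0 s z = 0"
  by (induction m arbitrary: s) auto

text \<open>The commutator of \<open>brk d\<close> with multiplication by x is the identity since d
  x = 1; this produces the summand with the factor m. The inhomogeneous term commutes with
  multiplication of s by x, because the iterated brackets kill x, and so it disappears at the first
  commutator.\<close>

lemma mult_comm_variation_Suc:
  "mult_comm_variation d e x m (Suc j) s z =
     brk d (mult_comm_variation d e x m j s) z
     + (of_nat m * mult_comm_variation d e x (m - 1) j s z
     + (if m = 0 then s * brk e (iter_brk d e j) z - iter_brk d e j s * e z else 0))"
proof (induction m arbitrary: s)
  case 0
  show ?case by (simp add: brk_def der_mult[OF der_iter_brk[OF d e]] algebra_simps)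
next
  case (Suc m)
  let ?v = "mult_comm_variation d e x"
  have b: "brk d (?v (Suc m) j s) z = brk d (?v m j (x * s)) z - x * brk d (?v m j s) z - ?v m j s z"
    by (simp add: brk_def der_diff[OF d] der_mult[OF d] dx algebra_simps)
  have x0: "iter_brk d e j (x * s) = x * iter_brk d e j s"
    by (simp add: der_mult[OF der_iter_brk[OF d e]] iter_brk_const[OF d e ex dx])
  show ?case
  proof (cases m)
    case 0
    define T where "T s = s * brk e (iter_brk d e j) z - iter_brk d e j s * e z" for s
    have v: "?v 0 (Suc j) s z = brk d (?v 0 j s) z + T s" for s
      using Suc[of s] by (simp only: 0 T_def if_True of_nat_0 mult_zero_left add_0_left refl)
    have "?v 1 (Suc j) s z = ?v 0 (Suc j) (x * s) z - x * ?v 0 (Suc j) s z" by simp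
    also have "\<dots> = brk d (?v 0 j (x * s)) z + T (x * s) - x * (brk d (?v 0 j s) z + T s)"
      unfolding v ..
    also have "T (x * s) = x * T s" unfolding T_def x0 by (simp add: algebra_simps)
    also have "brk d (?v 0 j (x * s)) z + x * T s - x * (brk d (?v 0 j s) z + T s) =
        brk d (?v 1 j s) z + ?v 0 j s z"
      using b unfolding 0 by (simp only: One_nat_def algebra_simps)
    finally show ?thesis by (simp add: 0)
  next
    case (Suc m')
    have "?v (Suc m) (Suc j) s z =
        brk d (?v m j (x * s)) z + of_nat m * ?v m' j (x * s) z
        - x * (brk d (?v m j s) z + of_nat m * ?v m' j s z)"
      using Suc.IH[of "x * s"] Suc.IH[of s] Suc by (simp del: variation.simps)
    also have "\<dots> = brk d (?v (Suc m) j s) z + (?v m j s z + of_nat m * ?v m j s z)"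
      unfolding b using Suc by (simp add: algebra_simps)
    finally show ?thesis by (simp add: algebra_simps)
  qed
qed

text \<open>In the language of control theory: the linearisation along a generic trajectory is controllable.\<close>

lemma brk_in_span:
  assumes r: "r > 0" and ind: "lin_indep UNIV r (iter_brk d e)"
    and max: "\<And>t. \<not> lin_indep UNIV (Suc r) (iter_brk (\<lambda>z. d z + t * e z) e)"
  shows "in_span d e r (iter_brk d e r)"
    and "i < r \<Longrightarrow> in_span d e r (brk e (iter_brk d e i))"
proof -
  have "\<not> lin_indep UNIV (Suc r) (iter_brk d e)" using max[of 0] by simp
  from lin_indep_relation[OF ind this] obtain a
    where a: "\<And>z. iter_brk d e r z = (\<Sum>j<r. a j * iter_brk d e j z)" by blast
  then show rel: "in_span d e r (iter_brk d e r)" unfolding in_span_def by blast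
  let ?v = "mult_comm_variation d e x"
  \<comment> \<open>The span is stable under multiplication by functions, so the conclusion on
    variations survives every commutator with x.\<close>
  have eta: "in_span d e r (\<lambda>z. ?v m r s z - (\<Sum>j<r. a j * ?v m j s z))" for m s
  proof (induction m arbitrary: s)
    case 0
    show ?case using variation_in_span[OF d e ind a max] by (simp add: in_span_def)
  next
    case (Suc m)
    have "in_span d e r (\<lambda>z. (?v m r (x * s) z - (\<Sum>j<r. a j * ?v m j (x * s) z))
        - x * (?v m r s z - (\<Sum>j<r. a j * ?v m j s z)))"
      by (intro in_span_diff in_span_scale Suc)
    then show ?case by (simp add: algebra_simps sum_subtractf sum_distrib_left)
  qed
  have span_e: "in_span d e r (\<lambda>z. c * e z)" for c
    using in_span_scale[OF in_span_iter_brk[OF r]] by simp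
  have "i < r \<longrightarrow> in_span d e r (brk e (iter_brk d e i))"
  proof (induction i rule: less_induct)
    case (less i)
    show ?case
    proof
      assume i: "i < r"
      have IH: "in_span d e r (brk e (iter_brk d e j))" if "j < i" for j
        using less that i by auto
      \<comment> \<open>Below the diagonal j = i + m + 1 the recursion only meets brackets of e with
        iterated brackets of index less than i, which are already in the span.\<close>
      have A: "in_span d e r (?v m j s)" if "j \<le> i + m" for m j s
        using that
      proof (induction m arbitrary: j s)
        case 0
        then show ?case
        proof (induction j arbitrary: s)
          case 0
          show ?case using mult_comm_variation_0[of 0 s] in_span_zero by simp
        next
          case (Suc j)
          have eq: "?v 0 (Suc j) s = (\<lambda>z. brk d (?v 0 j s) z +
              (s * brk e (iter_brk d e j) z - iter_brk d e j s * e z))"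
            using mult_comm_variation_Suc[of 0 j s] by (intro ext) simp
          show ?case unfolding eq
            by (intro in_span_add in_span_diff in_span_brk[OF d rel] in_span_scale IH span_e Suc)
               (use Suc.prems in auto)
        qed
      next
        case (Suc m)
        note IHm = Suc.IH
        show ?case using Suc.prems
        proof (induction j arbitrary: s)
          case 0
          show ?case using mult_comm_variation_0[of "Suc m" s]
            by (metis (no_types, lifting) ext in_span_zero)
        next
          case (Suc j)
          have eq: "?v (Suc m) (Suc j) s = (\<lambda>z. brk d (?v (Suc m) j s) z + of_nat (Suc m) * ?v m j s z)"
            using mult_comm_variation_Suc[of "Suc m" j s] by (intro ext) simp
          show ?case unfolding eq
            by (intro in_span_add in_span_brk[OF d rel] in_span_scale Suc.IH IHm)
               (use Suc.prems in auto)
        qed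
      qed
      \<comment> \<open>On the diagonal exactly one new bracket survives, that of e with the i-th,
        and the recursion accumulates the factor m!.\<close>
      have B: "in_span d e r (\<lambda>z. ?v m (Suc (i + m)) s z - of_nat (fact m) * (s * brk e (iter_brk d e i) z))"
        for m s
      proof (induction m)
        case 0
        have "in_span d e r (\<lambda>z. brk d (?v 0 i s) z - iter_brk d e i s * e z)"
          by (intro in_span_diff in_span_brk[OF d rel] A span_e) auto
        moreover have "?v 0 (Suc i) s z - of_nat (fact 0) * (s * brk e (iter_brk d e i) z) =
            brk d (?v 0 i s) z - iter_brk d e i s * e z" for z
          using mult_comm_variation_Suc[of 0 i s z] by simp
        ultimately show ?case by simp
      next
        case (Suc m)
        have "in_span d e r (\<lambda>z. brk d (?v (Suc m) (Suc (i + m)) s) z + of_nat (Suc m) *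
            (?v m (Suc (i + m)) s z - of_nat (fact m) * (s * brk e (iter_brk d e i) z)))"
          by (intro in_span_add in_span_brk[OF d rel] A in_span_scale Suc) auto
        moreover have "?v (Suc m) (Suc (i + Suc m)) s z - of_nat (fact (Suc m)) * (s * brk e (iter_brk d e i) z) =
            brk d (?v (Suc m) (Suc (i + m)) s) z + of_nat (Suc m) *
            (?v m (Suc (i + m)) s z - of_nat (fact m) * (s * brk e (iter_brk d e i) z))" for z
          using mult_comm_variation_Suc[of "Suc m" "Suc (i + m)" s z]
          by (simp add: algebra_simps del: mult_comm_variation.simps)
        ultimately show ?case by simp
      qed
      \<comment> \<open>With this m the diagonal reaches j = r, where \<open>eta\<close> applies.
        The other indices in its sum are at most i + m, so \<open>A\<close> covers them and only the
        new bracket is left.\<close>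
      define m where "m = r - Suc i"
      have rm: "r = Suc (i + m)" using i by (simp add: m_def)
      have "in_span d e r (\<lambda>z. \<Sum>j<r. a j * ?v m j 1 z)"
        by (intro in_span_sum in_span_scale A) (simp add: rm)
      from in_span_add[OF eta[of m 1] this] have "in_span d e r (?v m r 1)" by simp
      from in_span_diff[OF this B[of m 1, folded rm]]
      have "in_span d e r (\<lambda>z. of_nat (fact m) * brk e (iter_brk d e i) z)" by simp
      from in_span_scale[OF this, of "inverse (of_nat (fact m))"]
      have *: "in_span d e r (\<lambda>z. inverse (of_nat (fact m)) * (of_nat (fact m) * brk e (iter_brk d e i) z))" .
      have "(of_nat (fact m) :: 'f) \<noteq> 0" using of_nat_eq_0_field[of "fact m"] fact_nonzero[of m] by metis
      then have "(\<lambda>z. inverse (of_nat (fact m)) * (of_nat (fact m) * brk e (iter_brk d e i) z)) =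
          brk e (iter_brk d e i)" by (simp add: fun_eq_iff flip: mult.assoc)
      then show "in_span d e r (brk e (iter_brk d e i))" using * by simp
    qed
  qed
  then show "i < r \<Longrightarrow> in_span d e r (brk e (iter_brk d e i))" by blast
qed

end

text \<open>Ranks are bounded by the number of generators, so some \<open>t\<close> has maximal
  rank; a further shift \<open>u\<close> only changes \<open>t\<close>.\<close>

lemma ex_maximal_rank:
  assumes fin: "finite S"
    and S: "\<And>D. der D \<Longrightarrow> (\<forall>s\<in>S. D s = 0) \<Longrightarrow> (\<forall>z. D z = 0)"
    and d: "der d" and e: "der e" and nz: "e z0 \<noteq> 0"
  shows "\<exists>t r. r > 0 \<and> lin_indep UNIV r (iter_brk (\<lambda>z. d z + t * e z) e) \<and>
    (\<forall>u. \<not> lin_indep UNIV (Suc r) (iter_brk (\<lambda>z. (d z + t * e z) + u * e z) e))"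
proof -
  define P where "P r \<longleftrightarrow> (\<exists>t. lin_indep UNIV r (iter_brk (\<lambda>z. d z + t * e z) e))" for r
  have "lin_indep UNIV 1 (iter_brk (\<lambda>z. d z + 0 * e z) e)"
    using nz unfolding lin_indep_def by (auto dest: spec[of _ z0])
  then have P1: "P 1" unfolding P_def by blast
  have bound: "r \<le> card S" if Pr: "P r" for r
  proof -
    obtain t where t: "lin_indep UNIV r (iter_brk (\<lambda>z. d z + t * e z) e)" using Pr unfolding P_def by blast
    have "lin_indep S r (iter_brk (\<lambda>z. d z + t * e z) e)"
    proof (rule lin_indep_on_generators)
      show "lin_indep UNIV r (iter_brk (\<lambda>z. d z + t * e z) e)" by (rule t)
      show "der (iter_brk (\<lambda>z. d z + t * e z) e j)" for j
        by (intro der_iter_brk der_plus_scale d e)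
      show "\<forall>z. D z = 0" if "der D" "\<forall>s\<in>S. D s = 0" for D using that by (rule S)
    qed
    then show ?thesis by (rule lin_indep_rank_bound[OF fin])
  qed
  define r where "r = (GREATEST r. P r)"
  have "P r" unfolding r_def using P1 bound by (rule GreatestI_nat)
  moreover have "r \<ge> 1" unfolding r_def using P1 bound by (rule Greatest_le_nat)
  moreover have "\<not> P (Suc r)"
  proof
    assume "P (Suc r)"
    from Greatest_le_nat[of P, OF this bound] have "Suc r \<le> r" unfolding r_def by blast
    then show False by simp
  qed
  moreover obtain t where "lin_indep UNIV r (iter_brk (\<lambda>z. d z + t * e z) e)"
    using \<open>P r\<close> unfolding P_def by blast
  moreover have "(\<lambda>z. (d z + t * e z) + u * e z) = (\<lambda>z. d z + (t + u) * e z)" for u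
    by (simp add: algebra_simps)
  ultimately show ?thesis unfolding P_def by (intro exI[of _ t] exI[of _ r]) auto
qed

end

section \<open>Contracting derivations\<close>

text \<open>The geometric input: \<open>a\<close> and \<open>c\<close> are structure functions of
  the distribution spanned by the iterated brackets, \<open>N\<close> inverts the matrix of their
  values on the functions \<open>y\<close>, and \<open>p\<close> is a point on x = 0. That all these
  functions are regular on \<open>gen S\<close> is achieved by inverting a common
  denominator.\<close>

locale contraction = scalar_embedding emb
  for emb :: "'k::{alg_closed_field, field_char_0} \<Rightarrow> 'f::field" +
  fixes S :: "'f set" and \<delta> e :: "'f \<Rightarrow> 'f" and x :: 'f and r :: nat
    and a :: "nat \<Rightarrow> 'f" and c :: "nat \<Rightarrow> nat \<Rightarrow> 'f" and y :: "nat \<Rightarrow> 'f"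
    and N :: "nat \<Rightarrow> nat \<Rightarrow> 'f" and p :: "'f \<Rightarrow> 'k"
  assumes fin: "finite S" and \<delta>: "der \<delta>" and e: "der e"
    and \<delta>_in: "z \<in> gen S \<Longrightarrow> \<delta> z \<in> gen S" and e_in: "z \<in> gen S \<Longrightarrow> e z \<in> gen S"
    and \<delta>x: "\<delta> x = 1" and ex: "e x = 0" and x_in: "x \<in> gen S" and px: "p x = 0"
    and r: "r > 0"
    and rel: "iter_brk \<delta> e r z = (\<Sum>j<r. a j * iter_brk \<delta> e j z)" and a_in: "j < r \<Longrightarrow> a j \<in> gen S"
    and brk_rel: "i < r \<Longrightarrow> brk e (iter_brk \<delta> e i) z = (\<Sum>j<r. c i j * iter_brk \<delta> e j z)"
    and c_in: "i < r \<Longrightarrow> j < r \<Longrightarrow> c i j \<in> gen S"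
    and y_in: "j < r \<Longrightarrow> y j \<in> gen S" and N_in: "i < r \<Longrightarrow> j < r \<Longrightarrow> N i j \<in> gen S"
    and NG: "l < r \<Longrightarrow> i < r \<Longrightarrow>
      (\<Sum>m<r. N l m * iter_brk \<delta> e i (y m)) = (if l = i then 1 else 0)"
    and GN: "m < r \<Longrightarrow> m' < r \<Longrightarrow>
      (\<Sum>i<r. iter_brk \<delta> e i (y m) * N i m') = (if m = m' then 1 else 0)"
    and p: "point (gen S) p"
begin

abbreviation A where "A \<equiv> gen S"
abbreviation E where "E \<equiv> iter_brk \<delta> e"

lemmas A_ring = is_subring_gen[of S]
lemmas A_intros = subring_intros[OF is_subring_gen[of S]]

lemma scalar_in: "emb k \<in> A" by (rule gen.scalar)

lemma x_nz: "x \<noteq> 0" using \<delta>x der_0[OF \<delta>] by auto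

lemma E_der: "der (E j)" by (rule der_iter_brk[OF \<delta> e])
lemma Ex: "E j x = 0" by (rule iter_brk_const[OF \<delta> e ex \<delta>x])
lemma E_in: "z \<in> A \<Longrightarrow> E j z \<in> A"
  by (induction j arbitrary: z) (auto simp: brk_def intro: \<delta>_in e_in A_intros)
lemma \<delta>_pow_in: "z \<in> A \<Longrightarrow> (\<delta> ^^ i) z \<in> A"
  by (induction i) (auto intro: \<delta>_in)

section \<open>Transport along the flow of \<delta>\<close>

definition invfact :: "nat \<Rightarrow> 'f" where "invfact i = emb (inverse (fact i))"

lemma invfact_in: "invfact i \<in> A" by (simp add: invfact_def scalar_in)
lemma invfact_0 [simp]: "invfact 0 = 1" by (simp add: invfact_def)
lemma invfact_Suc: "of_nat (Suc i) * invfact (Suc i) = invfact i"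
proof -
  have "(of_nat (Suc i) * inverse (fact (Suc i)) :: 'k) = inverse (fact i)"
    by (simp add: field_simps del: of_nat_Suc)
  then show ?thesis unfolding invfact_def by (metis emb_mult emb_of_nat)
qed
lemma der_invfact: "der D \<Longrightarrow> D (invfact i * z) = invfact i * D z"
  by (simp add: invfact_def der_emb_mult)
lemma invfact_nz: "invfact i \<noteq> 0" by (simp add: invfact_def)

text \<open>The coefficients of exp(-x \<delta>); as \<delta> x = 1, each is mapped by \<delta> to
  minus its predecessor.\<close>

definition twist :: "nat \<Rightarrow> 'f" where "twist i = (- x) ^ i * invfact i"

lemma twist_in: "twist i \<in> A" by (auto simp: twist_def intro!: A_intros x_in invfact_in)

lemma \<delta>_twist: "\<delta> (twist i) = - (if i = 0 then 0 else twist (i - 1))"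
proof (cases i)
  case 0
  then show ?thesis by (simp add: twist_def der_1[OF \<delta>])
next
  case (Suc n)
  have "\<delta> (twist i) = invfact i * (of_nat i * (- x) ^ n * \<delta> (- x))"
    unfolding twist_def using der_invfact[OF \<delta>, of i "(- x) ^ i"] der_power[OF \<delta>, of "- x" i] Suc
    by (simp add: mult.commute)
  also have "\<dots> = - ((- x) ^ n * (of_nat (Suc n) * invfact (Suc n)))"
    unfolding Suc by (simp add: der_uminus[OF \<delta>] \<delta>x del: of_nat_Suc)
  finally show ?thesis unfolding invfact_Suc by (simp add: Suc twist_def)
qed

lemma E_twist: "E j (twist i) = 0"
  unfolding twist_def
  by (simp add: der_mult[OF E_der] der_power[OF E_der] der_uminus[OF E_der] Ex invfact_def der_emb[OF E_der])

lemma twist_telescope: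
  "(\<Sum>i<n. twist i * u (Suc i) - (if i = 0 then 0 else twist (i - 1)) * u i) =
    (if n = 0 then 0 else twist (n - 1) * u n)"
  by (induction n) (auto simp: algebra_simps split: if_splits)

text \<open>\<open>flat M f\<close> is the function constant along the flow of \<open>\<delta>\<close>, up to order \<open>M\<close> in \<open>x\<close>, that agrees
  with \<open>f\<close> on \<open>x = 0\<close>.\<close>

definition flat :: "nat \<Rightarrow> 'f \<Rightarrow> 'f" where "flat M f = (\<Sum>i<M. twist i * (\<delta> ^^ i) f)"

lemma \<delta>_flat: "M > 0 \<Longrightarrow> \<delta> (flat M f) = twist (M - 1) * (\<delta> ^^ M) f"
proof -
  assume "M > 0"
  have "\<delta> (flat M f) = (\<Sum>i<M. twist i * (\<delta> ^^ Suc i) f - (if i = 0 then 0 else twist (i - 1)) * (\<delta> ^^ i) f)"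
    unfolding flat_def by (simp add: der_sum[OF \<delta>] der_mult[OF \<delta>] \<delta>_twist)
  then show ?thesis using twist_telescope[of "\<lambda>i. (\<delta> ^^ i) f" M] \<open>M > 0\<close> by simp
qed

lemma flat_in: "f \<in> A \<Longrightarrow> flat M f \<in> A"
  unfolding flat_def by (intro A_intros twist_in \<delta>_pow_in)

text \<open>This is exp(-x ad \<delta>) applied to \<open>E l\<close>, cut off before
  \<open>E r\<close>: the bracket on x = 0 transported along the flow of \<delta>.\<close>

definition Eflat :: "nat \<Rightarrow> 'f \<Rightarrow> 'f" where "Eflat l z = (\<Sum>i<r - l. twist i * E (l + i) z)"

lemma Eflat_der: "der (Eflat l)"
proof -
  have "Eflat l = (\<lambda>z. \<Sum>i<r - l. twist i * E (l + i) z)" by (simp add: fun_eq_iff Eflat_def)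
  then show ?thesis by (auto intro: der_sum_fun E_der)
qed

lemma Eflat_in: "z \<in> A \<Longrightarrow> Eflat l z \<in> A"
  unfolding Eflat_def by (intro A_intros twist_in E_in)

lemma Eflat_x: "Eflat l x = 0" by (simp add: Eflat_def Ex)

text \<open>The sum telescopes, and what is left lies beyond the cut-off. So \<open>Eflat l\<close>
  commutes with \<delta> up to order r - l - 1 in x.\<close>

lemma brk_\<delta>_Eflat: "l < r \<Longrightarrow> brk \<delta> (Eflat l) z = twist (r - l - 1) * E r z"
proof -
  assume l: "l < r"
  have "brk \<delta> (Eflat l) z =
      (\<Sum>i<r - l. twist i * E (l + Suc i) z - (if i = 0 then 0 else twist (i - 1)) * E (l + i) z)"
    unfolding brk_def Eflat_def
    by (simp add: der_sum[OF \<delta>] der_mult[OF \<delta>] \<delta>_twist brk_def sum_subtractf[symmetric] algebra_simps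
        cong: sum.cong)
  then show ?thesis using twist_telescope[of "\<lambda>i. E (l + i) z" "r - l"] l by simp
qed

text \<open>The identity exp(x) exp(-x) = 1, degree by degree.\<close>

lemma twist_convolution:
  "(\<Sum>i\<le>n. x ^ i * invfact i * twist (n - i)) = (if n = 0 then 1 else 0)"
proof -
  have "x ^ i * invfact i * twist (n - i) = invfact n * (of_nat (n choose i) * x ^ i * (- x) ^ (n - i))"
    if "i \<le> n" for i
  proof -
    have "(inverse (fact i) * inverse (fact (n - i)) :: 'k) = inverse (fact n) * of_nat (n choose i)"
      using that by (simp add: binomial_fact field_simps)
    then have "invfact i * invfact (n - i) = invfact n * of_nat (n choose i)"
      unfolding invfact_def by (metis emb_mult emb_of_nat)
    then show ?thesis by (simp add: twist_def algebra_simps)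
  qed
  then have "(\<Sum>i\<le>n. x ^ i * invfact i * twist (n - i)) = invfact n * (x + - x) ^ n"
    unfolding binomial_ring sum_distrib_left by (intro sum.cong) auto
  then show ?thesis by simp
qed

text \<open>Exact despite the cut-off: raising the index is nilpotent below r, and the exponentials
  of x and -x times a nilpotent operator are inverse to each other.\<close>

lemma E_Eflat: "j < r \<Longrightarrow> E j z = (\<Sum>i<r - j. x ^ i * invfact i * Eflat (j + i) z)"
proof -
  assume j: "j < r"
  define n where "n = r - j"
  have n: "n > 0" using j by (simp add: n_def)
  have "(\<Sum>i<n. x ^ i * invfact i * Eflat (j + i) z) =
      (\<Sum>i<n. \<Sum>l<n - i. x ^ i * invfact i * twist l * E (j + (i + l)) z)"
    by (simp add: Eflat_def n_def sum_distrib_left mult.assoc add.assoc)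
  also have "\<dots> = (\<Sum>(i, l)\<in>Sigma {..<n} (\<lambda>i. {..<n - i}). x ^ i * invfact i * twist l * E (j + (i + l)) z)"
    by (simp add: sum.Sigma)
  also have "\<dots> = (\<Sum>(m, i)\<in>Sigma {..<n} (\<lambda>m. {..m}). x ^ i * invfact i * twist (m - i) * E (j + m) z)"
    by (rule sum.reindex_bij_witness[of _ "\<lambda>(m, i). (i, m - i)" "\<lambda>(i, l). (i + l, i)"]) auto
  also have "\<dots> = (\<Sum>m<n. (\<Sum>i\<le>m. x ^ i * invfact i * twist (m - i)) * E (j + m) z)"
    by (simp add: sum.Sigma[symmetric] sum_distrib_right)
  also have "\<dots> = (\<Sum>m<n. if m = 0 then E j z else 0)"
    by (intro sum.cong refl) (simp add: twist_convolution)
  also have "\<dots> = E j z" using n by simp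
  finally show ?thesis by (simp add: n_def)
qed

section \<open>Orders in x, also modulo an ideal\<close>

definition pw :: "'f set \<Rightarrow> nat \<Rightarrow> 'f set" where "pw R n = {z. \<exists>b\<in>R. z = x ^ n * b}"

lemma pwI: "b \<in> R \<Longrightarrow> z = x ^ n * b \<Longrightarrow> z \<in> pw R n" by (auto simp: pw_def)

context
  fixes R assumes R: "is_subring R" and xR: "x \<in> R"
begin

lemma pw_zero: "0 \<in> pw R n" by (rule pwI[OF subring_zero[OF R]]) simp
lemma pw_add: "z \<in> pw R n \<Longrightarrow> w \<in> pw R n \<Longrightarrow> z + w \<in> pw R n"
  unfolding pw_def using subring_add[OF R] by (auto simp flip: distrib_left)
lemma pw_diff: "z \<in> pw R n \<Longrightarrow> w \<in> pw R n \<Longrightarrow> z - w \<in> pw R n"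
  unfolding pw_def using subring_diff[OF R] by (auto simp flip: right_diff_distrib)
lemma pw_mult: "b \<in> R \<Longrightarrow> z \<in> pw R n \<Longrightarrow> b * z \<in> pw R n"
  unfolding pw_def using subring_mult[OF R, of b] by (auto simp: mult.left_commute)
lemma pw_sum: "(\<And>i. i \<in> I \<Longrightarrow> f i \<in> pw R n) \<Longrightarrow> (\<Sum>i\<in>I. f i) \<in> pw R n"
  by (induction I rule: infinite_finite_induct) (auto intro: pw_zero pw_add)
lemma pw_power: "z \<in> pw R n \<Longrightarrow> x ^ m * z \<in> pw R (m + n)"
  unfolding pw_def by (auto simp: power_add mult.assoc)
lemma pw_mono: "m \<le> n \<Longrightarrow> z \<in> pw R n \<Longrightarrow> z \<in> pw R m"
proof -
  assume mn: "m \<le> n" and "z \<in> pw R n"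
  then obtain b where b: "b \<in> R" "z = x ^ n * b" by (auto simp: pw_def)
  have "x ^ n = x ^ m * x ^ (n - m)" using mn by (simp flip: power_add)
  then show ?thesis using b xR by (intro pwI[of "x ^ (n - m) * b"]) (auto intro!: subring_intros[OF R])
qed

end

lemma pw_subset: "R \<subseteq> R' \<Longrightarrow> z \<in> pw R n \<Longrightarrow> z \<in> pw R' n" by (auto simp: pw_def)

lemma twist_pw: "twist n \<in> pw A n"
  by (rule pwI[of "(- 1) ^ n * invfact n"])
     (auto simp: twist_def power_minus[of x] mult_ac intro!: A_intros invfact_in)

definition ord :: "'f set \<Rightarrow> nat \<Rightarrow> 'f set" where
  "ord Y n = {z. \<exists>u\<in>pw A n. \<exists>w\<in>Y. z = u + w}"

lemma ordI: "u \<in> pw A n \<Longrightarrow> w \<in> Y \<Longrightarrow> z = u + w \<Longrightarrow> z \<in> ord Y n" by (auto simp: ord_def)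

definition is_ideal :: "'f set \<Rightarrow> bool" where
  "is_ideal Y \<longleftrightarrow> 0 \<in> Y \<and> (\<forall>w\<in>Y. \<forall>w'\<in>Y. w + w' \<in> Y) \<and> (\<forall>b\<in>A. \<forall>w\<in>Y. b * w \<in> Y)"

context
  fixes Y assumes Y: "is_ideal Y"
begin

lemma ord_pw: "z \<in> pw A n \<Longrightarrow> z \<in> ord Y n"
  using Y by (intro ordI[of z n 0]) (auto simp: is_ideal_def)
lemma ord_base: "z \<in> Y \<Longrightarrow> z \<in> ord Y n"
  by (rule ordI[OF pw_zero[OF A_ring x_in]]) auto
lemma ord_add: "z \<in> ord Y n \<Longrightarrow> w \<in> ord Y n \<Longrightarrow> z + w \<in> ord Y n"
proof -
  assume "z \<in> ord Y n" "w \<in> ord Y n"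
  then obtain u u' v v' where *: "u \<in> pw A n" "v \<in> Y" "z = u + v" "u' \<in> pw A n" "v' \<in> Y" "w = u' + v'"
    by (auto simp: ord_def)
  then show ?thesis using Y pw_add[OF A_ring x_in *(1,4)]
    by (intro ordI[of "u + u'" n "v + v'"]) (auto simp: is_ideal_def)
qed
lemma ord_mult: "b \<in> A \<Longrightarrow> z \<in> ord Y n \<Longrightarrow> b * z \<in> ord Y n"
proof -
  assume b: "b \<in> A" and "z \<in> ord Y n"
  then obtain u v where *: "u \<in> pw A n" "v \<in> Y" "z = u + v" by (auto simp: ord_def)
  then show ?thesis using Y pw_mult[OF A_ring x_in b *(1)] b
    by (intro ordI[of "b * u" n "b * v"]) (auto simp: is_ideal_def distrib_left)
qed
lemma ord_diff: "z \<in> ord Y n \<Longrightarrow> w \<in> ord Y n \<Longrightarrow> z - w \<in> ord Y n"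
  using ord_add[of z n "- 1 * w"] ord_mult[of "- 1" w n] A_intros by simp
lemma ord_x: "z \<in> ord Y n \<Longrightarrow> x * z \<in> ord Y (Suc n)"
proof -
  assume "z \<in> ord Y n"
  then obtain u v where *: "u \<in> pw A n" "v \<in> Y" "z = u + v" by (auto simp: ord_def)
  then show ?thesis using Y pw_power[OF A_ring x_in *(1), of 1] x_in
    by (intro ordI[of "x * u" "Suc n" "x * v"]) (auto simp: is_ideal_def distrib_left)
qed
lemma ord_mono: "m \<le> n \<Longrightarrow> z \<in> ord Y n \<Longrightarrow> z \<in> ord Y m"
  using pw_mono[OF A_ring x_in] by (auto simp: ord_def)

text \<open>Integration in x. If g - k = x^i b modulo \<open>Y\<close>, then \<delta> g contains i
  x^(i - 1) b, so smallness of \<delta> g raises the order of x^i b by one; characteristic zero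
  allows the division by i.\<close>

lemma ord_lift:
  assumes Y\<delta>: "\<And>w. w \<in> Y \<Longrightarrow> \<delta> w \<in> ord Y (M - 1)"
    and g1: "g - emb k \<in> ord Y 1" and \<delta>g: "\<delta> g \<in> ord Y (L - 1)" and L: "1 \<le> L" "L \<le> M"
  shows "g - emb k \<in> ord Y L"
proof -
  have "g - emb k \<in> ord Y i" if "1 \<le> i" "i \<le> L" for i
    using that
  proof (induction i rule: nat_induct_at_least)
    case base
    then show ?case using g1 by simp
  next
    case (Suc i)
    then obtain b w where b: "b \<in> A" "w \<in> Y" "g - emb k = x ^ i * b + w"
      by (auto simp: ord_def pw_def)
    have "\<delta> g = \<delta> (x ^ i * b + w)"
      using b(3) der_diff[OF \<delta>, of g "emb k"] der_emb[OF \<delta>, of k] by simp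
    then have "of_nat i * x ^ (i - 1) * b = \<delta> g - x ^ i * \<delta> b - \<delta> w"
      by (simp add: der_add[OF \<delta>] der_mult[OF \<delta>] der_power[OF \<delta>] \<delta>x)
    moreover have "\<delta> g \<in> ord Y i" "\<delta> w \<in> ord Y i"
      using ord_mono[OF _ \<delta>g, of i] ord_mono[OF _ Y\<delta>[OF b(2)], of i] Suc L by auto
    moreover have "x ^ i * \<delta> b \<in> ord Y i" using \<delta>_in[OF b(1)] by (intro ord_pw) (auto simp: pw_def)
    ultimately have "of_nat i * x ^ (i - 1) * b \<in> ord Y i" by (simp add: ord_diff)
    then have "emb (inverse (of_nat i)) * (x * (of_nat i * x ^ (i - 1) * b)) \<in> ord Y (Suc i)"
      by (rule ord_mult[OF scalar_in ord_x])
    moreover have "emb (inverse (of_nat i)) * (x * (of_nat i * x ^ (i - 1) * b)) =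
        (emb (inverse (of_nat i)) * of_nat i) * (x * x ^ (i - 1)) * b" by (simp only: mult_ac)
    moreover have "emb (inverse (of_nat i)) * of_nat i = 1" "x * x ^ (i - 1) = x ^ i"
      using Suc by (simp_all add: emb_inverse flip: power_Suc)
    ultimately have "x ^ i * b \<in> ord Y (Suc i)" by (simp only: mult_1_left)
    then show ?case using ord_add[OF _ ord_base[OF b(2)]] b(3) by simp
  qed
  then show ?thesis using L by simp
qed

end

text \<open>The most demanding estimate is \<open>d_zeta\<close>, which needs order r + l + 1 for
  every l < r.\<close>

definition M :: nat where "M = 2 * r"

definition \<eta> :: "nat \<Rightarrow> 'f" where "\<eta> j = flat M (y j) - emb (p (y j))"

definition Y :: "'f set" where "Y = {w. \<exists>b. (\<forall>j<r. b j \<in> A) \<and> w = (\<Sum>j<r. b j * \<eta> j)}"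

text \<open>Inverting the matrix of the \<open>E i (y j)\<close> turns the defining functions
  \<open>\<eta> j\<close> of the trajectory through \<open>p\<close> into coordinates dual to the
  \<open>Eflat l\<close>. The coefficients are flattened too, to keep \<open>ybar l\<close> constant
  along the flow to high order.\<close>

definition ybar :: "nat \<Rightarrow> 'f" where "ybar l = (\<Sum>j<r. flat M (N l j) * \<eta> j)"

lemmas pwA = pw_zero[OF A_ring x_in] pw_add[OF A_ring x_in] pw_diff[OF A_ring x_in]
  pw_mult[OF A_ring x_in] pw_sum[OF A_ring x_in]

lemma M_pos: "M > 0" using r by (simp add: M_def)

lemma sum_twist_pw:
  assumes "n > 0" "\<And>i. i < n \<Longrightarrow> u i \<in> A"
  shows "(\<Sum>i<n. twist i * u i) - u 0 \<in> pw A 1"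
proof -
  obtain n' where n: "n = Suc n'" using assms(1) by (cases n) auto
  have "u (Suc i) * twist (Suc i) \<in> pw A 1" if "i < n'" for i
    using pw_mono[OF A_ring x_in _ twist_pw[of "Suc i"], of 1] assms(2)[of "Suc i"] that n
    by (intro pwA(4)) auto
  then have "(\<Sum>i<n'. twist (Suc i) * u (Suc i)) \<in> pw A 1"
    by (intro pwA(5)) (simp add: mult.commute)
  moreover have "(\<Sum>i<n. twist i * u i) - u 0 = (\<Sum>i<n'. twist (Suc i) * u (Suc i))"
    unfolding n sum.lessThan_Suc_shift by (simp add: twist_def)
  ultimately show ?thesis by simp
qed

lemma flat_minus: "f \<in> A \<Longrightarrow> flat M f - f \<in> pw A 1"
  using sum_twist_pw[OF M_pos, of "\<lambda>i. (\<delta> ^^ i) f"] \<delta>_pow_in by (simp add: flat_def)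

lemma Eflat_minus: "l < r \<Longrightarrow> z \<in> A \<Longrightarrow> Eflat l z - E l z \<in> pw A 1"
  using sum_twist_pw[of "r - l" "\<lambda>i. E (l + i) z"] E_in by (simp add: Eflat_def)

lemma E_pw: "z \<in> pw A n \<Longrightarrow> E l z \<in> pw A n"
  unfolding pw_def by (auto simp: der_mult[OF E_der] der_power[OF E_der] Ex intro: E_in)

lemma Eflat_pw: "z \<in> pw A n \<Longrightarrow> Eflat l z \<in> pw A n"
  unfolding pw_def
  by (auto simp: der_mult[OF Eflat_der] der_power[OF Eflat_der] Eflat_x intro: Eflat_in)

lemma \<delta>_flat_pw: "f \<in> A \<Longrightarrow> \<delta> (flat M f) \<in> pw A (M - 1)"
  unfolding \<delta>_flat[OF M_pos] using pwA(4)[OF \<delta>_pow_in twist_pw] by (simp add: mult.commute)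

lemma \<eta>_in: "j < r \<Longrightarrow> \<eta> j \<in> A"
  unfolding \<eta>_def by (intro A_intros flat_in y_in scalar_in)

lemma \<delta>_\<eta>: "j < r \<Longrightarrow> \<delta> (\<eta> j) \<in> pw A (M - 1)"
  unfolding \<eta>_def using \<delta>_flat_pw[OF y_in, of j]
  by (simp add: der_diff[OF \<delta>] der_emb[OF \<delta>])

lemma ybar_in: "l < r \<Longrightarrow> ybar l \<in> A"
  unfolding ybar_def by (intro A_intros flat_in N_in \<eta>_in) auto

lemma Y_sum:
  assumes "\<And>j. j < r \<Longrightarrow> b j \<in> A"
  shows "(\<Sum>j<r. b j * \<eta> j) \<in> Y"
  unfolding Y_def using assms by (intro CollectI exI[of _ b]) simp

lemma Y_ideal: "is_ideal Y"
  unfolding is_ideal_def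
proof (intro conjI ballI)
  show "0 \<in> Y" unfolding Y_def by (auto intro!: exI[of _ "\<lambda>_. 0"] A_intros)
next
  fix w w' assume "w \<in> Y" "w' \<in> Y"
  then obtain b b' where *: "\<forall>j<r. b j \<in> A" "\<forall>j<r. b' j \<in> A"
    "w = (\<Sum>j<r. b j * \<eta> j)" "w' = (\<Sum>j<r. b' j * \<eta> j)" by (auto simp: Y_def)
  have "w + w' = (\<Sum>j<r. (b j + b' j) * \<eta> j)" using * by (simp add: sum.distrib distrib_right)
  then show "w + w' \<in> Y" using * by (simp add: Y_sum A_intros)
next
  fix k w assume k: "k \<in> A" and "w \<in> Y"
  then obtain b where *: "\<forall>j<r. b j \<in> A" "w = (\<Sum>j<r. b j * \<eta> j)" by (auto simp: Y_def)
  have "k * w = (\<Sum>j<r. (k * b j) * \<eta> j)" using * by (simp add: sum_distrib_left mult.assoc)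
  then show "k * w \<in> Y" using * k by (simp add: Y_sum A_intros)
qed

lemma Y_\<delta>: "w \<in> Y \<Longrightarrow> \<delta> w \<in> ord Y (M - 1)"
proof -
  assume "w \<in> Y"
  then obtain b where b: "\<forall>j<r. b j \<in> A" "w = (\<Sum>j<r. b j * \<eta> j)" by (auto simp: Y_def)
  have "\<delta> w = (\<Sum>j<r. b j * \<delta> (\<eta> j)) + (\<Sum>j<r. \<delta> (b j) * \<eta> j)"
    unfolding b by (simp add: der_sum[OF \<delta>] der_mult[OF \<delta>] sum.distrib)
  moreover have "(\<Sum>j<r. b j * \<delta> (\<eta> j)) \<in> pw A (M - 1)"
    using b \<delta>_\<eta> by (intro pwA(5) pwA(4)) auto
  moreover have "(\<Sum>j<r. \<delta> (b j) * \<eta> j) \<in> Y" using b by (intro Y_sum \<delta>_in) auto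
  ultimately show ?thesis by (auto intro: ordI)
qed

lemma \<delta>_ybar: "l < r \<Longrightarrow> \<delta> (ybar l) \<in> pw A (M - 1)"
proof -
  assume l: "l < r"
  have "\<delta> (ybar l) = (\<Sum>j<r. flat M (N l j) * \<delta> (\<eta> j) + \<eta> j * \<delta> (flat M (N l j)))"
    unfolding ybar_def by (simp add: der_sum[OF \<delta>] der_mult[OF \<delta>] ac_simps)
  also have "\<dots> \<in> pw A (M - 1)"
    using l by (intro pwA(5) pwA(2) pwA(4) \<delta>_\<eta> \<delta>_flat_pw flat_in N_in \<eta>_in) auto
  finally show ?thesis .
qed

text \<open>At x = 0 and modulo \<open>Y\<close> this is the matrix identity \<open>NG\<close>,
  since a derivative falling on a coefficient leaves a factor \<open>\<eta> m\<close>. The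
  commutator of \<open>Eflat l\<close> with \<delta> has only order r - l - 1, which limits the
  precision; \<open>ord_lift\<close> adds one.\<close>

lemma Eflat_ybar:
  assumes l: "l < r" and j: "j < r"
  shows "Eflat l (ybar j) - emb (if l = j then 1 else 0) \<in> ord Y (r - l)"
proof (rule ord_lift[OF Y_ideal Y_\<delta>])
  have f1: "flat M (N j m) * E l (\<eta> m) - N j m * E l (y m) \<in> pw A 1" if m: "m < r" for m
  proof -
    have "E l (flat M (y m) - y m) \<in> pw A 1" by (intro E_pw flat_minus y_in m)
    then have 1: "E l (\<eta> m) - E l (y m) \<in> pw A 1"
      by (simp add: \<eta>_def der_diff[OF E_der] der_emb[OF E_der])
    have 2: "flat M (N j m) - N j m \<in> pw A 1" by (intro flat_minus N_in j m)
    have "flat M (N j m) * (E l (\<eta> m) - E l (y m)) + E l (y m) * (flat M (N j m) - N j m) \<in> pw A 1"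
      using 1 2 by (intro pwA(2) pwA(4) flat_in N_in E_in y_in j m)
    then show ?thesis by (simp add: algebra_simps)
  qed
  have "E l (ybar j) = (\<Sum>m<r. flat M (N j m) * E l (\<eta> m)) + (\<Sum>m<r. E l (flat M (N j m)) * \<eta> m)"
    unfolding ybar_def by (simp add: der_sum[OF E_der] der_mult[OF E_der] sum.distrib)
  moreover have "(\<Sum>m<r. flat M (N j m) * E l (\<eta> m) - N j m * E l (y m)) \<in> pw A 1"
    using f1 by (intro pwA(5)) auto
  moreover have "(\<Sum>m<r. E l (flat M (N j m)) * \<eta> m) \<in> Y"
    using j by (intro Y_sum E_in flat_in N_in) auto
  moreover have "(\<Sum>m<r. N j m * E l (y m)) = emb (if l = j then 1 else 0)"
    using NG[OF j l] by auto
  ultimately have "E l (ybar j) - emb (if l = j then 1 else 0) \<in> ord Y 1"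
    by (intro ordI[of "\<Sum>m<r. flat M (N j m) * E l (\<eta> m) - N j m * E l (y m)" 1
          "\<Sum>m<r. E l (flat M (N j m)) * \<eta> m"]) (simp_all add: sum_subtractf)
  from ord_add[OF Y_ideal this ord_pw[OF Y_ideal Eflat_minus[OF l ybar_in[OF j]]]]
  show "Eflat l (ybar j) - emb (if l = j then 1 else 0) \<in> ord Y 1" by simp
  have "\<delta> (Eflat l (ybar j)) = brk \<delta> (Eflat l) (ybar j) + Eflat l (\<delta> (ybar j))"
    by (simp add: brk_def)
  moreover have "brk \<delta> (Eflat l) (ybar j) \<in> pw A (r - l - 1)"
    unfolding brk_\<delta>_Eflat[OF l] using pwA(4)[OF E_in[OF ybar_in[OF j]] twist_pw]
    by (simp add: mult.commute)
  moreover have "Eflat l (\<delta> (ybar j)) \<in> pw A (r - l - 1)"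
    using pw_mono[OF A_ring x_in _ Eflat_pw[OF \<delta>_ybar[OF j]], of "r - l - 1"]
    by (simp add: M_def)
  ultimately show "\<delta> (Eflat l (ybar j)) \<in> ord Y (r - l - 1)"
    by (simp add: ord_pw[OF Y_ideal] pwA(2))
  show "1 \<le> r - l" using l by simp
  show "r - l \<le> M" by (simp add: M_def)
qed

text \<open>The flattened matrices of \<open>E l (y j)\<close> and \<open>N\<close> are inverse at x
  = 0 by \<open>GN\<close> and constant along the flow to high order, hence inverse modulo x^M: this
  is \<open>ord_lift\<close> for the zero ideal.\<close>

lemma \<eta>_via_ybar:
  assumes j: "j < r"
  shows "\<eta> j - (\<Sum>l<r. flat M (E l (y j)) * ybar l) \<in> pw A M"
proof -
  define H where "H j' = (\<Sum>l<r. flat M (E l (y j)) * flat M (N l j'))" for j'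
  have H: "H j' - emb (if j = j' then 1 else 0) \<in> pw A M" if j': "j' < r" for j'
  proof -
    have Z: "is_ideal {0}" by (simp add: is_ideal_def)
    have Zo: "z \<in> ord {0} n \<longleftrightarrow> z \<in> pw A n" for z n by (auto simp: ord_def)
    have "H j' - emb (if j = j' then 1 else 0) \<in> ord {0} M"
    proof (rule ord_lift[OF Z])
      show "\<delta> w \<in> ord {0} (M - 1)" if "w \<in> {0}" for w
        using that by (simp add: Zo der_0[OF \<delta>] pwA(1))
      have "flat M (E l (y j)) * flat M (N l j') - E l (y j) * N l j' \<in> pw A 1" if l: "l < r" for l
      proof -
        have "flat M (E l (y j)) * (flat M (N l j') - N l j') + N l j' * (flat M (E l (y j)) - E l (y j)) \<in> pw A 1"
          by (intro pwA(2) pwA(4) flat_minus flat_in N_in E_in y_in j j' l)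
        then show ?thesis by (simp add: algebra_simps)
      qed
      then have "(\<Sum>l<r. flat M (E l (y j)) * flat M (N l j') - E l (y j) * N l j') \<in> pw A 1"
        by (intro pwA(5)) auto
      moreover have "(\<Sum>l<r. E l (y j) * N l j') = emb (if j = j' then 1 else 0)"
        using GN[OF j j'] by auto
      ultimately show "H j' - emb (if j = j' then 1 else 0) \<in> ord {0} 1"
        by (simp add: Zo H_def sum_subtractf)
      have "\<delta> (H j') = (\<Sum>l<r. flat M (E l (y j)) * \<delta> (flat M (N l j')) + flat M (N l j') * \<delta> (flat M (E l (y j))))"
        unfolding H_def by (simp add: der_sum[OF \<delta>] der_mult[OF \<delta>] ac_simps)
      also have "\<dots> \<in> pw A (M - 1)"
        using j j' by (intro pwA(5) pwA(2) pwA(4) \<delta>_flat_pw flat_in N_in E_in y_in) auto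
      finally show "\<delta> (H j') \<in> ord {0} (M - 1)" by (simp add: Zo)
    qed (use M_pos in auto)
    then show ?thesis by (simp add: Zo)
  qed
  have "(\<Sum>l<r. flat M (E l (y j)) * ybar l) = (\<Sum>j'<r. H j' * \<eta> j')"
    unfolding ybar_def H_def sum_distrib_left sum_distrib_right
    by (subst sum.swap) (simp add: mult.assoc)
  moreover have "\<eta> j = (\<Sum>j'<r. emb (if j = j' then 1 else 0) * \<eta> j')"
    using j by (simp add: if_distrib[of emb] if_distrib[of "\<lambda>u. u * _"] cong: if_cong)
  ultimately have "\<eta> j - (\<Sum>l<r. flat M (E l (y j)) * ybar l) =
      - (\<Sum>j'<r. \<eta> j' * (H j' - emb (if j = j' then 1 else 0)))"
    by (simp add: sum_subtractf sum_negf[symmetric] algebra_simps)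
  moreover have "(\<Sum>j'<r. \<eta> j' * (H j' - emb (if j = j' then 1 else 0))) \<in> pw A M"
    by (intro pwA(5) pwA(4) H \<eta>_in) auto
  ultimately show ?thesis using pwA(3)[OF pwA(1)] by simp
qed

text \<open>Vanishing order at the point \<open>p\<close> along its \<open>\<delta>\<close>-trajectory, which is parametrised by \<open>x\<close>.\<close>

definition vanish :: "nat \<Rightarrow> 'f set" where
  "vanish n = {z \<in> A. \<forall>i<n. p ((\<delta> ^^ i) z) = 0}"

lemma vanish_Suc: "z \<in> vanish (Suc n) \<longleftrightarrow> z \<in> A \<and> p z = 0 \<and> \<delta> z \<in> vanish n"
proof -
  have "(\<delta> ^^ i) (\<delta> z) = (\<delta> ^^ Suc i) z" for i by (simp add: funpow_swap1)
  then show ?thesis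
    by (auto simp: vanish_def \<delta>_in less_Suc_eq_0_disj simp del: funpow.simps)
qed

lemma vanish_0: "vanish 0 = A" by (simp add: vanish_def)
lemma vanish_mono: "m \<le> n \<Longrightarrow> z \<in> vanish n \<Longrightarrow> z \<in> vanish m" by (auto simp: vanish_def)
lemma vanish_A: "z \<in> vanish n \<Longrightarrow> z \<in> A" by (simp add: vanish_def)

lemma p_add: "z \<in> A \<Longrightarrow> w \<in> A \<Longrightarrow> p (z + w) = p z + p w" using p by (simp add: point_def)
lemma p_mult: "z \<in> A \<Longrightarrow> w \<in> A \<Longrightarrow> p (z * w) = p z * p w" using p by (simp add: point_def)
lemma p_emb: "p (emb k) = k" using p by (simp add: point_def)

lemma vanish_add: "z \<in> vanish n \<Longrightarrow> w \<in> vanish n \<Longrightarrow> z + w \<in> vanish n"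
proof (induction n arbitrary: z w)
  case 0
  then show ?case by (simp add: vanish_0 A_intros)
next
  case (Suc n)
  then show ?case by (auto simp: vanish_Suc A_intros p_add der_add[OF \<delta>])
qed

lemma vanish_zero: "0 \<in> vanish n"
  by (induction n) (auto simp: vanish_0 vanish_Suc der_0[OF \<delta>] point_zero[OF p] intro: A_intros)

lemma vanish_sum: "(\<And>i. i \<in> I \<Longrightarrow> f i \<in> vanish n) \<Longrightarrow> (\<Sum>i\<in>I. f i) \<in> vanish n"
  by (induction I rule: infinite_finite_induct) (auto intro: vanish_add vanish_zero)

lemma vanish_mult: "z \<in> vanish n \<Longrightarrow> w \<in> vanish m \<Longrightarrow> z * w \<in> vanish (n + m)"
proof (induction "n + m" arbitrary: n m z w)
  case 0
  then show ?case by (simp add: vanish_0 A_intros)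
next
  case (Suc k)
  have zw: "z \<in> A" "w \<in> A" using Suc by (auto intro: vanish_A)
  have "p z = 0 \<or> p w = 0"
    using Suc.hyps(2) Suc.prems by (cases n; cases m) (auto simp: vanish_Suc)
  moreover have "z * \<delta> w \<in> vanish k"
  proof (cases m)
    case 0
    then show ?thesis using Suc.hyps(1)[of k 0 z "\<delta> w"] Suc.hyps(2) Suc.prems zw
        vanish_mono[of k n z] by (simp add: vanish_0 \<delta>_in)
  next
    case (Suc m')
    then show ?thesis using Suc.hyps(1)[of n m' z "\<delta> w"] Suc.hyps(2) Suc.prems
      by (simp add: vanish_Suc)
  qed
  moreover have "\<delta> z * w \<in> vanish k"
  proof (cases n)
    case 0
    then show ?thesis using Suc.hyps(1)[of 0 k "\<delta> z" w] Suc.hyps(2) Suc.prems zw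
        vanish_mono[of k m w] by (simp add: vanish_0 \<delta>_in)
  next
    case (Suc n')
    then show ?thesis using Suc.hyps(1)[of n' m "\<delta> z" w] Suc.hyps(2) Suc.prems
      by (simp add: vanish_Suc)
  qed
  ultimately have "z * w \<in> vanish (Suc k)"
    using zw by (auto simp: vanish_Suc A_intros p_mult der_mult[OF \<delta>] vanish_add)
  then show ?case using Suc.hyps(2) by simp
qed

lemma vanish_x: "x ^ n \<in> vanish n"
proof (induction n)
  case 0
  show ?case using A_intros(1) by (simp add: vanish_0)
next
  case (Suc n)
  have "x \<in> vanish 1" using x_in px by (simp add: vanish_def)
  from vanish_mult[OF this Suc] show ?case by simp
qed

lemma not_vanish_x: "x ^ n \<notin> vanish (Suc n)"
proof (induction n)
  case 0
  show ?case using point_one[OF p] by (simp add: vanish_def)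
next
  case (Suc n)
  show ?case
  proof
    assume "x ^ Suc n \<in> vanish (Suc (Suc n))"
    then have "\<delta> (x ^ Suc n) \<in> vanish (Suc n)" by (simp only: vanish_Suc)
    then have "of_nat (Suc n) * x ^ n \<in> vanish (Suc n)"
      unfolding der_power[OF \<delta>] by (simp add: \<delta>x del: of_nat_Suc)
    then have "emb (inverse (of_nat (Suc n))) * (of_nat (Suc n) * x ^ n) \<in> vanish (0 + Suc n)"
      by (intro vanish_mult) (auto simp: vanish_0 scalar_in)
    moreover have "emb (inverse (of_nat (Suc n))) * (of_nat (Suc n) * x ^ n) = x ^ n"
    proof -
      have "emb (inverse (of_nat (Suc n))) * of_nat (Suc n) = 1"
        using of_nat_eq_0_field[of "Suc n"] by (simp add: emb_inverse del: of_nat_Suc of_nat_eq_0_field)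
      then show ?thesis by (simp add: mult.assoc[symmetric] del: of_nat_Suc)
    qed
    ultimately show False using Suc by (simp only: add_0)
  qed
qed

lemma pw_vanish: "z \<in> pw A n \<Longrightarrow> z \<in> vanish n"
  using vanish_mult[OF vanish_x, of _ 0 n] by (auto simp: pw_def vanish_0)

lemma p_cong: "z - w \<in> pw A 1 \<Longrightarrow> w \<in> A \<Longrightarrow> p z = p w"
proof -
  assume zw: "z - w \<in> pw A 1" and w: "w \<in> A"
  then have "z - w \<in> A" "p (z - w) = 0" using pw_vanish[OF zw] by (auto simp: vanish_def)
  then have "p ((z - w) + w) = 0 + p w" using w by (simp only: p_add)
  then show ?thesis by simp
qed

lemma vanish_ybar: "l < r \<Longrightarrow> ybar l \<in> vanish M"
proof -
  assume l: "l < r"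
  have "\<eta> j \<in> vanish M" if j: "j < r" for j
  proof -
    have 1: "p (flat M (y j)) = p (y j)" by (intro p_cong flat_minus y_in j)
    have "p (flat M (y j) + emb (- p (y j))) = p (flat M (y j)) + - p (y j)"
      using p_emb by (simp add: p_add flat_in y_in j scalar_in)
    then have "p (\<eta> j) = 0" using 1 by (simp add: \<eta>_def emb_uminus)
    moreover have "M = Suc (M - 1)" using M_pos by simp
    ultimately show ?thesis
      using vanish_Suc[of "\<eta> j" "M - 1"] \<eta>_in[OF j] pw_vanish[OF \<delta>_\<eta>[OF j]] by simp
  qed
  then have "flat M (N l j) * \<eta> j \<in> vanish M" if "j < r" for j
    using vanish_mult[of "flat M (N l j)" 0 "\<eta> j" M] that l flat_in[OF N_in] by (simp add: vanish_0)
  then show ?thesis unfolding ybar_def by (intro vanish_sum) simp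
qed

end

locale weighted_contraction = contraction emb S \<delta> e x r a c y N p
  for emb :: "'k::{alg_closed_field, field_char_0} \<Rightarrow> 'f::field" and S \<delta> e x r a c y N p +
  fixes \<alpha> :: "nat \<Rightarrow> 'k" and B :: "nat \<Rightarrow> nat \<Rightarrow> 'k"
  assumes \<alpha>_sum: "s < r \<Longrightarrow> (\<Sum>l<r. \<alpha> l / of_nat (l + s + Suc r)) = 1"
    and \<alpha>_nz: "l < r \<Longrightarrow> \<alpha> l \<noteq> 0"
    and B_inv: "l < r \<Longrightarrow> m < r \<Longrightarrow> (\<Sum>s<r. B l s / of_nat (m + s + Suc r)) = (if l = m then 1 else 0)"
begin

text \<open>The weights below place the poles: modulo \<open>x\<close>, the functions \<open>zs s\<close> become eigenvectors of \<open>d\<close> with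
  eigenvalue \<open>s + 1\<close>, and the functions \<open>Gs s\<close> attached to a first integral become eigenvectors with
  eigenvalue \<open>- (s + r + 1)\<close>.\<close>

definition \<beta> :: "nat \<Rightarrow> 'k" where "\<beta> l = fact l * \<alpha> l"
definition \<kappa> :: "nat \<Rightarrow> nat \<Rightarrow> 'k" where "\<kappa> s l = 1 / of_nat (l + s + Suc r)"
text \<open>The weight matches two factors: \<open>q\<close> contains x^r and
  \<open>e (ybar l)\<close> starts with x^l / l!. After division by x^(r + l) the feedback therefore
  acts on \<open>zeta l\<close> as \<open>\<tau>\<close> / l! modulo x, without a pole.\<close>

definition zeta :: "nat \<Rightarrow> 'f" where "zeta l = ybar l / x ^ (r + l)"
definition zs :: "nat \<Rightarrow> 'f" where "zs s = (\<Sum>l<r. emb (\<beta> l * \<kappa> s l) * zeta l)"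
definition A2 :: "'f set" where "A2 = gen (S \<union> zs ` {..<r})"
definition \<tau> :: 'f where "\<tau> = (\<Sum>l<r. emb (\<beta> l) * zeta l)"
text \<open>In the original coordinates this is
  \<open>\<Sum>l<r. emb (\<beta> l) * ybar l / x ^ l\<close>, a feedback with poles that become
  regular in \<open>A2\<close>.\<close>

definition q :: 'f where "q = x ^ r * \<tau>"
definition d :: "'f \<Rightarrow> 'f" where "d z = x * \<delta> z + q * e z"

lemma A2_ring: "is_subring A2" by (simp add: A2_def is_subring_gen)
lemmas A2_intros = subring_intros[OF A2_ring]

lemma A_sub: "z \<in> A \<Longrightarrow> z \<in> A2"
  unfolding A2_def using gen_mono[of S "S \<union> zs ` {..<r}"] by auto

lemma x_in2: "x \<in> A2" by (rule A_sub[OF x_in])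
lemma scalar_in2: "emb k \<in> A2" by (rule A_sub[OF scalar_in])

lemmas pw2 = pw_zero[OF A2_ring x_in2] pw_add[OF A2_ring x_in2] pw_diff[OF A2_ring x_in2]
  pw_mult[OF A2_ring x_in2] pw_sum[OF A2_ring x_in2]
lemmas pw2_mono = pw_mono[OF A2_ring x_in2]
lemmas pw2_power = pw_power[OF A2_ring x_in2]

lemma pw_A_A2: "z \<in> pw A n \<Longrightarrow> z \<in> pw A2 n"
  by (rule pw_subset[rotated]) (auto intro: A_sub)

lemma pw2_cancel: "x ^ n * z \<in> pw A2 (n + m) \<Longrightarrow> z \<in> pw A2 m"
  unfolding pw_def using x_nz by (auto simp: power_add)

lemma pw2_in: "z \<in> pw A2 n \<Longrightarrow> z \<in> A2"
  unfolding pw_def using x_in2 by (auto intro!: A2_intros)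

lemma \<beta>_nz: "l < r \<Longrightarrow> \<beta> l \<noteq> 0" by (simp add: \<beta>_def \<alpha>_nz)

lemma \<beta>_invfact: "emb (\<beta> l) * invfact l = emb (\<alpha> l)"
proof -
  have "\<beta> l * inverse (fact l) = \<alpha> l" by (simp add: \<beta>_def field_simps)
  then show ?thesis unfolding invfact_def by (metis emb_mult)
qed

lemma \<kappa>_mult: "\<kappa> s l * of_nat (l + s + Suc r) = 1"
  unfolding \<kappa>_def by (simp del: of_nat_add of_nat_Suc)

lemma cauchy_inverse:
  assumes l: "l < r"
  shows "(\<Sum>s<r. emb (B l s) * (\<Sum>m<r. emb (\<kappa> s m) * g m)) = g l"
proof -
  have "(\<Sum>s<r. emb (B l s) * (\<Sum>m<r. emb (\<kappa> s m) * g m)) =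
      (\<Sum>m<r. (\<Sum>s<r. emb (B l s / of_nat (m + s + Suc r))) * g m)"
    unfolding sum_distrib_left sum_distrib_right
    by (subst sum.swap) (simp add: \<kappa>_def emb_divide mult.assoc[symmetric])
  also have "\<dots> = (\<Sum>m<r. (if l = m then 1 else 0) * g m)"
    using B_inv[OF l] by (intro sum.cong refl) (simp flip: emb_sum)
  also have "\<dots> = g l" using l by (simp add: if_distrib[of "\<lambda>u. u * _"] cong: if_cong)
  finally show ?thesis .
qed

lemma zeta_eq: "l < r \<Longrightarrow> zeta l = emb (inverse (\<beta> l)) * (\<Sum>s<r. emb (B l s) * zs s)"
proof -
  assume l: "l < r"
  have "zs s = (\<Sum>m<r. emb (\<kappa> s m) * (emb (\<beta> m) * zeta m))" for s
    by (simp add: zs_def emb_mult mult_ac)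
  then have "(\<Sum>s<r. emb (B l s) * zs s) = emb (\<beta> l) * zeta l"
    using cauchy_inverse[OF l, of "\<lambda>m. emb (\<beta> m) * zeta m"] by simp
  then show ?thesis using \<beta>_nz[OF l] by (simp add: emb_inverse mult.assoc[symmetric])
qed

lemma zs_in: "s < r \<Longrightarrow> zs s \<in> A2" unfolding A2_def by (rule gen.base) auto
lemma zeta_in: "l < r \<Longrightarrow> zeta l \<in> A2"
  unfolding zeta_eq by (intro A2_intros scalar_in2 zs_in) auto
lemma \<tau>_in: "\<tau> \<in> A2" unfolding \<tau>_def by (intro A2_intros scalar_in2 zeta_in) auto

lemma ybar_eq: "ybar l = x ^ (r + l) * zeta l" using x_nz by (simp add: zeta_def)

text \<open>In \<open>A2\<close> the \<open>ybar l\<close>, and with them the ideal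
  \<open>Y\<close>, are multiples of x^r. Congruences modulo \<open>Y\<close> thus become
  congruences modulo x^r.\<close>

lemma \<eta>_pw: "j < r \<Longrightarrow> \<eta> j \<in> pw A2 r"
proof -
  assume j: "j < r"
  have "\<eta> j - (\<Sum>l<r. flat M (E l (y j)) * ybar l) \<in> pw A2 r"
    using pw2_mono[OF _ pw_A_A2[OF \<eta>_via_ybar[OF j]], of r] by (simp add: M_def)
  moreover have "ybar l \<in> pw A2 r" if "l < r" for l
    by (rule pw2_mono[of r "r + l"]) (auto intro!: pwI[OF zeta_in[OF that]] ybar_eq)
  then have "(\<Sum>l<r. flat M (E l (y j)) * ybar l) \<in> pw A2 r"
    using j by (intro pw2(5) pw2(4) A_sub flat_in E_in y_in) auto
  ultimately show ?thesis using pw2(2) by fastforce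
qed

lemma Y_pw: "w \<in> Y \<Longrightarrow> w \<in> pw A2 r"
  unfolding Y_def using \<eta>_pw A_sub by (auto intro!: pw2(5) pw2(4))

lemma ord_pw2: "l \<le> r \<Longrightarrow> w \<in> ord Y (r - l) \<Longrightarrow> x ^ l * w \<in> pw A2 r"
proof -
  assume l: "l \<le> r" and "w \<in> ord Y (r - l)"
  then obtain u v where uv: "u \<in> pw A (r - l)" "v \<in> Y" "w = u + v" by (auto simp: ord_def)
  have "x ^ l * u \<in> pw A2 r" using pw2_power[OF pw_A_A2[OF uv(1)], of l] l by simp
  moreover have "x ^ l * v \<in> pw A2 r"
    using pw2_mono[OF _ pw2_power[OF Y_pw[OF uv(2)], of l], of r] by simp
  ultimately show ?thesis using uv(3) pw2(2) by (simp add: distrib_left)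
qed

lemma Eflat_ybar_pw:
  "l < r \<Longrightarrow> j < r \<Longrightarrow> x ^ l * Eflat l (ybar j) - (if l = j then x ^ l else 0) \<in> pw A2 r"
  using ord_pw2[OF _ Eflat_ybar[of l j]] by (auto simp: algebra_simps split: if_splits)

lemma d_der: "der d"
proof -
  have "d = (\<lambda>z. x * \<delta> z + q * e z)" by (simp add: fun_eq_iff d_def)
  then show ?thesis by (simp add: der_lincomb \<delta> e)
qed

lemma d_x: "d x = x" by (simp add: d_def \<delta>x ex)

lemma d_x_power: "d (x ^ n) = of_nat n * x ^ n"
proof (cases n)
  case (Suc m)
  then show ?thesis using der_power[OF d_der, of x n] by (simp add: d_x mult_ac)
qed (simp add: der_1[OF d_der])

lemma d_power_mult: "d (x ^ n * z) = x ^ n * (d z + of_nat n * z)"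
  by (simp add: der_mult[OF d_der] d_x_power algebra_simps)

lemma d_A: "z \<in> A \<Longrightarrow> d z \<in> pw A2 1"
proof -
  assume z: "z \<in> A"
  have "x * \<delta> z \<in> pw A2 1" by (rule pwI[OF A_sub[OF \<delta>_in[OF z]]]) simp
  moreover have "\<tau> * e z \<in> A2" by (intro A2_intros \<tau>_in A_sub e_in z)
  then have "x ^ r * (\<tau> * e z) \<in> pw A2 r" by (rule pwI) simp
  then have "q * e z \<in> pw A2 1" using pw2_mono[of 1 r] r by (simp add: q_def mult.assoc)
  ultimately show ?thesis unfolding d_def by (rule pw2(2))
qed

lemma e_expand: "e z = (\<Sum>i<r. x ^ i * invfact i * Eflat i z)"
  using E_Eflat[of 0 z] r by simp

lemma e_ybar: "l < r \<Longrightarrow> e (ybar l) - invfact l * x ^ l \<in> pw A2 r"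
proof -
  assume l: "l < r"
  have "(\<Sum>i<r. invfact i * (x ^ i * Eflat i (ybar l) - (if i = l then x ^ i else 0))) \<in> pw A2 r"
    using l by (intro pw2(5) pw2(4) Eflat_ybar_pw A_sub invfact_in) auto
  moreover have "(\<Sum>i<r. invfact i * (if i = l then x ^ i else 0)) = invfact l * x ^ l"
    using l by (simp add: if_distrib[of "\<lambda>u. _ * u"] cong: if_cong)
  moreover have "e (ybar l) = (\<Sum>i<r. invfact i * (x ^ i * Eflat i (ybar l)))"
    using e_expand[of "ybar l"] by (simp only: mult_ac)
  ultimately show ?thesis by (simp only: right_diff_distrib sum_subtractf)
qed

text \<open>Clear the denominator x^(r + l). The term x \<delta> (ybar l) has order M = 2 r, at
  least r + l + 1; the feedback term is read off from \<open>e_ybar\<close>.\<close>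

lemma d_zeta: "l < r \<Longrightarrow> d (zeta l) + of_nat (r + l) * zeta l - invfact l * \<tau> \<in> pw A2 1"
proof -
  assume l: "l < r"
  have "x ^ (r + l) * (d (zeta l) + of_nat (r + l) * zeta l) = d (ybar l)"
    unfolding ybar_eq d_power_mult ..
  also have "\<dots> = x * \<delta> (ybar l) + x ^ r * \<tau> * e (ybar l)" by (simp add: d_def q_def)
  finally have eq: "x ^ (r + l) * (d (zeta l) + of_nat (r + l) * zeta l - invfact l * \<tau>) =
      x * \<delta> (ybar l) + x ^ r * (\<tau> * (e (ybar l) - invfact l * x ^ l))"
    by (simp add: algebra_simps power_add)
  have "x ^ 1 * \<delta> (ybar l) \<in> pw A2 (1 + (M - 1))"
    by (intro pw2_power pw_A_A2 \<delta>_ybar l)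
  then have "x * \<delta> (ybar l) \<in> pw A2 (r + l + 1)"
    using pw2_mono[of "r + l + 1" M] l M_pos by (simp add: M_def)
  moreover have "x ^ r * (\<tau> * (e (ybar l) - invfact l * x ^ l)) \<in> pw A2 (r + r)"
    by (intro pw2_power pw2(4) \<tau>_in e_ybar l)
  then have "x ^ r * (\<tau> * (e (ybar l) - invfact l * x ^ l)) \<in> pw A2 (r + l + 1)"
    using pw2_mono[of "r + l + 1" "r + r"] l by simp
  ultimately have "x ^ (r + l) * (d (zeta l) + of_nat (r + l) * zeta l - invfact l * \<tau>) \<in> pw A2 (r + l + 1)"
    unfolding eq by (rule pw2(2))
  then show ?thesis by (rule pw2_cancel)
qed

lemma sum_\<alpha>\<kappa>: "s < r \<Longrightarrow> (\<Sum>l<r. emb (\<alpha> l) * emb (\<kappa> s l)) = 1"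
  using arg_cong[OF \<alpha>_sum, of s emb] by (simp add: \<kappa>_def emb_sum emb_divide)

lemma emb_\<kappa>: "emb (\<kappa> s l) * of_nat (l + s + Suc r) = 1"
  using arg_cong[OF \<kappa>_mult, of emb s l] by (simp only: emb_mult emb_of_nat emb_one)

text \<open>Write r + l = (l + s + r + 1) - (s + 1). The first part cancels against
  \<open>\<kappa> s l\<close> and contributes -\<tau>, the feedback contributes \<tau> by
  \<open>sum_\<alpha>\<kappa>\<close>, and the eigenvalue s + 1 remains.\<close>

lemma d_zs: "s < r \<Longrightarrow> d (zs s) - of_nat (Suc s) * zs s \<in> pw A2 1"
proof -
  assume s: "s < r"
  let ?k = "\<lambda>l. emb (\<beta> l * \<kappa> s l)"
  have "(\<Sum>l<r. ?k l * (d (zeta l) + of_nat (r + l) * zeta l - invfact l * \<tau>)) \<in> pw A2 1"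
    by (intro pw2(5) pw2(4) scalar_in2 d_zeta) auto
  moreover have "(\<Sum>l<r. ?k l * (d (zeta l) + of_nat (r + l) * zeta l - invfact l * \<tau>)) =
      d (zs s) - of_nat (Suc s) * zs s"
  proof -
    have "(\<Sum>l<r. ?k l * d (zeta l)) = d (zs s)"
      unfolding zs_def by (simp add: der_sum[OF d_der] der_emb_mult[OF d_der])
    moreover have "(\<Sum>l<r. ?k l * (of_nat (r + l) * zeta l)) = \<tau> - of_nat (Suc s) * zs s"
    proof -
      have "?k l * (of_nat (r + l) * zeta l) = emb (\<beta> l) * zeta l - of_nat (Suc s) * (?k l * zeta l)" for l
      proof -
        have "emb (\<beta> l) * zeta l * (emb (\<kappa> s l) * of_nat (l + s + Suc r)) = emb (\<beta> l) * zeta l"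
          unfolding emb_\<kappa> by simp
        moreover have "(of_nat (l + s + Suc r) :: 'f) = of_nat (r + l) + of_nat (Suc s)" by simp
        ultimately have "emb (\<beta> l) * zeta l * (emb (\<kappa> s l) * (of_nat (r + l) + of_nat (Suc s))) = emb (\<beta> l) * zeta l"
          by (simp only:)
        then show ?thesis by (simp add: emb_mult algebra_simps del: of_nat_Suc of_nat_add)
      qed
      then show ?thesis by (simp add: sum_subtractf \<tau>_def zs_def sum_distrib_left)
    qed
    moreover have "(\<Sum>l<r. ?k l * (invfact l * \<tau>)) = \<tau>"
    proof -
      have "?k l * (invfact l * \<tau>) = emb (\<alpha> l) * emb (\<kappa> s l) * \<tau>" for l
        using \<beta>_invfact[of l] by (simp add: emb_mult mult_ac)
      then have "(\<Sum>l<r. ?k l * (invfact l * \<tau>)) = (\<Sum>l<r. emb (\<alpha> l) * emb (\<kappa> s l)) * \<tau>"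
        by (simp only: sum_distrib_right)
      then show ?thesis by (simp only: sum_\<alpha>\<kappa>[OF s] mult_1_left)
    qed
    ultimately show ?thesis
      by (simp only: distrib_left right_diff_distrib sum.distrib sum_subtractf) simp
  qed
  ultimately show ?thesis by simp
qed

lemma d_A2: "z \<in> A2 \<Longrightarrow> d z \<in> A2"
  unfolding A2_def
proof (induction rule: gen.induct)
  case (scalar k)
  show ?case using A2_intros(2) by (simp add: der_emb[OF d_der] A2_def)
next
  case (base s)
  then consider "s \<in> S" | i where "i < r" "s = zs i" by auto
  then have "d s \<in> A2"
  proof cases
    case 1
    then show ?thesis using pw2_in[OF d_A[OF gen.base]] by simp
  next
    case 2
    have "of_nat (Suc i) * zs i \<in> A2"
      using scalar_in2[of "of_nat (Suc i)"] zs_in[OF 2(1)] by (simp add: A2_intros del: of_nat_Suc)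
    from subring_add[OF A2_ring pw2_in[OF d_zs[OF 2(1)]] this] show ?thesis using 2 by simp
  qed
  then show ?case by (simp add: A2_def)
qed (use A2_intros in \<open>auto simp: der_add[OF d_der] der_mult[OF d_der] A2_def\<close>)

lemma d_pw: "z \<in> pw A2 n \<Longrightarrow> d z \<in> pw A2 n"
proof -
  assume "z \<in> pw A2 n"
  then obtain b where b: "b \<in> A2" "z = x ^ n * b" by (auto simp: pw_def)
  have "of_nat n * b \<in> A2" using scalar_in2[of "of_nat n"] b(1) by (simp add: A2_intros)
  then show ?thesis using b d_A2[OF b(1)]
    by (intro pwI[of "d b + of_nat n * b"]) (auto simp: d_power_mult intro: A2_intros)
qed

text \<open>Modulo \<open>x\<close> the derivation \<open>d\<close> acts on \<open>A2\<close> locally finitely, with eigenvalues in the natural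
  numbers.\<close>

definition d_eigen :: "nat \<Rightarrow> 'f set" where
  "d_eigen n = {g \<in> A2. d g - of_nat n * g \<in> pw A2 1}"

inductive_set eigen_sums :: "'f set" where
  base: "g \<in> d_eigen n \<Longrightarrow> g \<in> eigen_sums"
| add: "g \<in> eigen_sums \<Longrightarrow> h \<in> eigen_sums \<Longrightarrow> g + h \<in> eigen_sums"

lemma d_eigen_mult: "g \<in> d_eigen m \<Longrightarrow> h \<in> d_eigen n \<Longrightarrow> g * h \<in> d_eigen (m + n)"
proof -
  assume "g \<in> d_eigen m" "h \<in> d_eigen n"
  then have g: "g \<in> A2" "d g - of_nat m * g \<in> pw A2 1" and h: "h \<in> A2" "d h - of_nat n * h \<in> pw A2 1"
    by (auto simp: d_eigen_def)
  have "g * (d h - of_nat n * h) + h * (d g - of_nat m * g) \<in> pw A2 1"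
    using g h by (intro pw2(2) pw2(4))
  moreover have "g * (d h - of_nat n * h) + h * (d g - of_nat m * g) =
      d (g * h) - of_nat (m + n) * (g * h)"
    by (simp add: der_mult[OF d_der] algebra_simps)
  ultimately show ?thesis using g h by (simp add: d_eigen_def A2_intros)
qed

lemma eigen_sums_mult_base: "h \<in> eigen_sums \<Longrightarrow> g \<in> d_eigen n \<Longrightarrow> g * h \<in> eigen_sums"
  by (induction rule: eigen_sums.induct)
     (auto simp: distrib_left intro: eigen_sums.intros d_eigen_mult)

lemma eigen_sums_mult: "g \<in> eigen_sums \<Longrightarrow> h \<in> eigen_sums \<Longrightarrow> g * h \<in> eigen_sums"
  by (induction rule: eigen_sums.induct)
     (auto simp: distrib_right intro: eigen_sums.intros eigen_sums_mult_base)

lemma A2_eigen_sums: "z \<in> A2 \<Longrightarrow> z \<in> eigen_sums"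
  unfolding A2_def
proof (induction rule: gen.induct)
  case (scalar k)
  have "emb k \<in> d_eigen 0" using scalar_in2 pw2(1) by (simp add: d_eigen_def der_emb[OF d_der])
  then show ?case by (rule eigen_sums.base)
next
  case (base s)
  then consider "s \<in> S" | i where "i < r" "s = zs i" by auto
  then show ?case
  proof cases
    case 1
    then have "s \<in> d_eigen 0" using d_A[of s] A_sub[of s] gen.base[of s S] by (simp add: d_eigen_def)
    then show ?thesis by (rule eigen_sums.base)
  next
    case 2
    then have "s \<in> d_eigen (Suc i)" using d_zs[of i] zs_in[of i] by (simp add: d_eigen_def)
    then show ?thesis by (rule eigen_sums.base)
  qed
qed (auto intro: eigen_sums.add eigen_sums_mult)

definition kill :: "nat list \<Rightarrow> 'f \<Rightarrow> 'f" where
  "kill ns g = foldr (\<lambda>n w. d w - of_nat n * w) ns g"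

lemma kill_simps [simp]: "kill [] g = g" "kill (n # ns) g = d (kill ns g) - of_nat n * kill ns g"
  by (simp_all add: kill_def)

lemma kill_append: "kill (ns @ ms) g = kill ns (kill ms g)" by (simp add: kill_def)

lemma kill_add: "kill ns (g + h) = kill ns g + kill ns h"
  by (induction ns) (auto simp: der_add[OF d_der] algebra_simps)

lemma kill_d: "kill ns (d g - of_nat n * g) = d (kill ns g) - of_nat n * kill ns g"
proof (induction ns)
  case (Cons m ns)
  show ?case
    unfolding kill_simps Cons.IH der_diff[OF d_der] der_of_nat_mult[OF d_der]
    by (simp add: algebra_simps)
qed simp

lemma kill_swap: "kill ns (kill ms g) = kill ms (kill ns g)"
  by (induction ms) (auto simp: kill_d)

lemma kill_pw: "g \<in> pw A2 n \<Longrightarrow> kill ns g \<in> pw A2 n"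
proof (induction ns)
  case (Cons m ns)
  have "of_nat m \<in> A2" using scalar_in2[of "of_nat m"] by simp
  then show ?case using Cons by (auto intro!: pw2(3) pw2(4) d_pw)
qed auto

lemma eigen_sums_killed: "g \<in> eigen_sums \<Longrightarrow> \<exists>ns. kill ns g \<in> pw A2 1"
proof (induction rule: eigen_sums.induct)
  case (base g n)
  then show ?case by (intro exI[of _ "[n]"]) (simp add: d_eigen_def)
next
  case (add g h)
  then obtain ns ms where *: "kill ns g \<in> pw A2 1" "kill ms h \<in> pw A2 1" by blast
  have "kill (ns @ ms) (g + h) = kill ms (kill ns g) + kill ns (kill ms h)"
    by (simp add: kill_append kill_add kill_swap)
  then show ?case using * by (intro exI[of _ "ns @ ms"]) (auto intro: pw2(2) kill_pw)
qed

text \<open>Some product of operators d - n maps g into x A2. Modulo x it multiplies g by the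
  product of the scalars -(m + 1 + n), which is nonzero and can be divided off.\<close>

lemma negative_eigenvector:
  assumes g: "g \<in> A2" "d g + of_nat (Suc m) * g \<in> pw A2 1"
  shows "g \<in> pw A2 1"
proof -
  obtain ns where ns: "kill ns g \<in> pw A2 1" using eigen_sums_killed A2_eigen_sums g by blast
  define k :: "nat list \<Rightarrow> 'k" where "k ns = prod_list (map (\<lambda>n. - of_nat (Suc m + n)) ns)" for ns
  have "kill ns g - emb (k ns) * g \<in> pw A2 1"
  proof (induction ns)
    case Nil
    show ?case using pw2(1) by (simp add: k_def)
  next
    case (Cons n ns)
    let ?w = "kill ns g - emb (k ns) * g"
    have n: "of_nat n \<in> A2" using scalar_in2[of "of_nat n"] by simp
    have "(d ?w - of_nat n * ?w) + emb (k ns) * (d g + of_nat (Suc m) * g) \<in> pw A2 1"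
      by (intro pw2(2) pw2(3) pw2(4) d_pw Cons n scalar_in2 g)
    moreover have K: "emb (k (n # ns)) = - (of_nat (Suc m) + of_nat n) * emb (k ns)"
      unfolding k_def by (simp add: emb_mult emb_uminus emb_add emb_diff algebra_simps)
    moreover have "(d ?w - of_nat n * ?w) + emb (k ns) * (d g + of_nat (Suc m) * g) =
        kill (n # ns) g - emb (k (n # ns)) * g"
      unfolding K kill_simps der_diff[OF d_der] der_emb_mult[OF d_der]
      by (simp add: algebra_simps)
    ultimately show ?case by simp
  qed
  from pw2(3)[OF ns this] have "emb (k ns) * g \<in> pw A2 1" by simp
  then have "emb (inverse (k ns)) * (emb (k ns) * g) \<in> pw A2 1" by (rule pw2(4)[OF scalar_in2])
  moreover have "k ns \<noteq> 0"
  proof -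
    have "- of_nat (Suc m + n) \<noteq> (0 :: 'k)" for n by (simp del: of_nat_add of_nat_Suc)
    then show ?thesis unfolding k_def by (induction ns) auto
  qed
  ultimately show ?thesis by (simp add: mult.assoc[symmetric] emb_inverse)
qed

text \<open>Along the trajectory through \<open>p\<close> the functions in \<open>A2\<close> have no
  pole, because \<open>ybar l\<close> vanishes there to order M \<ge> r + l. An inverse of x would
  have a pole.\<close>

lemma x_nonunit: "z \<in> A2 \<Longrightarrow> x * z \<noteq> 1"
proof
  assume z: "z \<in> A2" and xz: "x * z = 1"
  \<comment> \<open>The elements that restrict to a power series in x on the trajectory, expressed
    without a completion.\<close>
  define V where "V = {z. \<exists>n. x ^ n * z \<in> vanish n}"
  have V_up: "x ^ (n + m) * w \<in> vanish (n + m)" if "x ^ n * w \<in> vanish n" for n m w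
    using vanish_mult[OF vanish_x[of m] that] by (simp add: power_add mult_ac add.commute)
  have V_A: "w \<in> V" if "w \<in> A" for w
    using that unfolding V_def by (intro CollectI exI[of _ 0]) (simp add: vanish_0)
  have VR: "is_subring V"
    unfolding is_subring_def
  proof (intro conjI ballI)
    show "1 \<in> V" by (intro V_A A_intros)
    fix w w' assume "w \<in> V" "w' \<in> V"
    then obtain n n' where n: "x ^ n * w \<in> vanish n" "x ^ n' * w' \<in> vanish n'" by (auto simp: V_def)
    have U: "x ^ (n + n') * w \<in> vanish (n + n')" "x ^ (n' + n) * w' \<in> vanish (n' + n)"
      using V_up n by blast+
    have "emb (- 1) * (x ^ (n' + n) * w') \<in> vanish (0 + (n' + n))"
      by (rule vanish_mult[OF _ U(2)]) (simp add: vanish_0 scalar_in)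
    with U(1) have "x ^ (n + n') * w + emb (- 1) * (x ^ (n' + n) * w') \<in> vanish (n + n')"
      by (intro vanish_add) (simp_all add: add.commute)
    then have "x ^ (n + n') * (w - w') \<in> vanish (n + n')"
      by (simp add: emb_uminus algebra_simps)
    then show "w - w' \<in> V" unfolding V_def by blast
    have "(x ^ n * w) * (x ^ n' * w') \<in> vanish (n + n')" using n by (rule vanish_mult)
    then have "x ^ (n + n') * (w * w') \<in> vanish (n + n')" by (simp add: power_add mult_ac)
    then show "w * w' \<in> V" unfolding V_def by blast
  qed
  have Z: "zeta l \<in> V" if l: "l < r" for l
  proof -
    have "x ^ (r + l) * zeta l \<in> vanish (r + l)"
      using vanish_mono[OF _ vanish_ybar[OF l], of "r + l"] l by (simp add: M_def ybar_eq)
    then show ?thesis unfolding V_def by blast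
  qed
  have K: "emb k \<in> V" for k by (intro V_A scalar_in)
  have "zs s \<in> V" for s
    unfolding zs_def by (intro subring_sum[OF VR] subring_mult[OF VR] K Z) auto
  then have "A2 \<subseteq> V" unfolding A2_def
    by (intro gen_minimal VR) (auto intro!: K intro: V_A gen.base)
  then obtain n where "x ^ n * z \<in> vanish n" using z by (auto simp: V_def)
  from V_up[OF this, of 1] have "x ^ n * (x * z) \<in> vanish (Suc n)" by (simp add: mult_ac)
  then show False using xz not_vanish_x by simp
qed

text \<open>The functions \<open>G l\<close> measure the failure of a first integral \<open>f\<close> of \<open>d\<close> to be constant on the
  leaves; they form a linear system with negative eigenvalues modulo \<open>x\<close>.\<close>

context
  fixes f assumes f: "f \<in> A" and df: "d f = 0"
begin

definition G :: "nat \<Rightarrow> 'f" where "G l = x ^ l * Eflat l f"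

text \<open>The error terms: combinations of the \<open>G j\<close> with a spare factor x, which is
  what lets \<open>Gs_pw\<close> gain one power of x per round.\<close>

definition JG :: "'f set" where
  "JG = {w. \<exists>b. (\<forall>j<r. b j \<in> A2) \<and> w = (\<Sum>j<r. b j * (x * G j))}"

lemma JG_I:
  assumes "\<And>j. j < r \<Longrightarrow> b j \<in> A2"
  shows "(\<Sum>j<r. b j * (x * G j)) \<in> JG"
  unfolding JG_def using assms by (intro CollectI exI[of _ b]) simp

lemma JG_zero: "0 \<in> JG"
  using JG_I[of "\<lambda>_. 0"] A2_intros(2) by simp

lemma JG_add: "w \<in> JG \<Longrightarrow> w' \<in> JG \<Longrightarrow> w + w' \<in> JG"
proof -
  assume "w \<in> JG" "w' \<in> JG"
  then obtain b b' where *: "\<forall>j<r. b j \<in> A2" "\<forall>j<r. b' j \<in> A2"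
    "w = (\<Sum>j<r. b j * (x * G j))" "w' = (\<Sum>j<r. b' j * (x * G j))" unfolding JG_def by blast
  have "w + w' = (\<Sum>j<r. (b j + b' j) * (x * G j))"
    unfolding *(3,4) distrib_right sum.distrib ..
  then show ?thesis using * by (simp only: JG_I A2_intros)
qed

lemma JG_mult: "k \<in> A2 \<Longrightarrow> w \<in> JG \<Longrightarrow> k * w \<in> JG"
proof -
  assume k: "k \<in> A2" and "w \<in> JG"
  then obtain b where *: "\<forall>j<r. b j \<in> A2" "w = (\<Sum>j<r. b j * (x * G j))" unfolding JG_def by blast
  have "k * w = (\<Sum>j<r. (k * b j) * (x * G j))" unfolding * sum_distrib_left mult.assoc ..
  then show ?thesis using * k by (simp only: JG_I A2_intros)
qed

lemma JG_sum: "(\<And>i. i \<in> I \<Longrightarrow> w i \<in> JG) \<Longrightarrow> (\<Sum>i\<in>I. w i) \<in> JG"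
  by (induction I rule: infinite_finite_induct) (auto intro: JG_zero JG_add)

lemma JG_diff: "w \<in> JG \<Longrightarrow> w' \<in> JG \<Longrightarrow> w - w' \<in> JG"
  using JG_add[of w "emb (- 1) * w'"] JG_mult[OF scalar_in2, of w' "- 1"] by (simp add: emb_uminus)

lemma JG_G: "j < r \<Longrightarrow> x * G j \<in> JG"
proof -
  assume j: "j < r"
  have "(\<Sum>i<r. (if i = j then 1 else 0) * (x * G i)) \<in> JG"
    by (intro JG_I) (auto intro: A2_intros)
  moreover have "(\<Sum>i<r. (if i = j then 1 else 0) * (x * G i)) = x * G j"
    using j by (simp add: if_distrib[of "\<lambda>u. u * _"] cong: if_cong)
  ultimately show ?thesis by simp
qed

text \<open>In the expansion by \<open>E_Eflat\<close>, x^r x^i contains x^(j + i + 1), one power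
  more than \<open>G (j + i)\<close> uses, because j < r.\<close>

lemma E_JG: "j < r \<Longrightarrow> x ^ r * E j f \<in> JG"
proof -
  assume j: "j < r"
  have "x ^ r * (x ^ i * invfact i * Eflat (j + i) f) = (invfact i * x ^ (r - j - 1)) * (x * G (j + i))"
    if "i < r - j" for i
  proof -
    have "x ^ r * x ^ i = x ^ (r - j - 1) * x * x ^ (j + i)"
      using j by (simp flip: power_add power_Suc power_Suc2)
    then have "(x ^ r * x ^ i) * (invfact i * Eflat (j + i) f) =
        (x ^ (r - j - 1) * x * x ^ (j + i)) * (invfact i * Eflat (j + i) f)" by simp
    then show ?thesis by (simp only: G_def mult_ac)
  qed
  then have "x ^ r * E j f = (\<Sum>i<r - j. (invfact i * x ^ (r - j - 1)) * (x * G (j + i)))"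
    unfolding E_Eflat[OF j] sum_distrib_left by (intro sum.cong) auto
  also have "\<dots> \<in> JG"
    by (intro JG_sum JG_mult JG_G A2_intros A_sub[OF invfact_in] x_in2) auto
  finally show ?thesis .
qed

lemma ef: "e f = (\<Sum>j<r. invfact j * G j)"
  using e_expand[of f] by (simp only: G_def mult_ac)

lemma x_ef: "x * e f \<in> JG"
proof -
  have "x * e f = (\<Sum>j<r. invfact j * (x * G j))" 
    using arg_cong[OF ef, of "\<lambda>w. x * w"] by (simp only: sum_distrib_left mult_ac)
  then show ?thesis by (simp only: JG_I A_sub[OF invfact_in])
qed

text \<open>\<open>Eflat l\<close> kills x, so it can be applied to q x^r = \<Sum> \<beta> j x^(r -
  j) ybar j. The error x^r of the duality gains a further x^(r - j) with j < r, and so a factor x is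
  left after cancelling x^r.\<close>

lemma Eflat_q: "l < r \<Longrightarrow> x ^ l * Eflat l q - emb (\<beta> l) \<in> pw A2 1"
proof -
  assume l: "l < r"
  have "q * x ^ r = (\<Sum>j<r. emb (\<beta> j) * (x ^ (r - j) * ybar j))"
  proof -
    have "x ^ (r - j) * ybar j = x ^ r * x ^ r * zeta j" if "j < r" for j
      using that by (simp add: ybar_eq mult.assoc[symmetric] flip: power_add)
    then show ?thesis unfolding q_def \<tau>_def by (simp add: sum_distrib_left sum_distrib_right mult_ac)
  qed
  then have "Eflat l (q * x ^ r) = (\<Sum>j<r. emb (\<beta> j) * (x ^ (r - j) * Eflat l (ybar j)))"
    by (simp add: der_sum[OF Eflat_der] der_emb_mult[OF Eflat_der] der_mult[OF Eflat_der]
        der_power[OF Eflat_der] Eflat_x der_emb[OF Eflat_der])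
  moreover have "Eflat l (q * x ^ r) = x ^ r * Eflat l q"
    by (simp add: der_mult[OF Eflat_der] der_power[OF Eflat_der] Eflat_x mult.commute)
  ultimately have "x ^ r * Eflat l q = (\<Sum>j<r. emb (\<beta> j) * (x ^ (r - j) * Eflat l (ybar j)))"
    by (simp only:)
  from arg_cong[OF this, of "\<lambda>w. x ^ l * w"] have "x ^ r * (x ^ l * Eflat l q) =
      (\<Sum>j<r. emb (\<beta> j) * (x ^ (r - j) * (x ^ l * Eflat l (ybar j))))"
    by (simp only: sum_distrib_left mult_ac)
  moreover have "(\<Sum>j<r. emb (\<beta> j) * (x ^ (r - j) * (if l = j then x ^ l else 0))) = x ^ r * emb (\<beta> l)"
  proof -
    have "(\<Sum>j<r. emb (\<beta> j) * (x ^ (r - j) * (if l = j then x ^ l else 0))) =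
        (\<Sum>j<r. if l = j then x ^ r * emb (\<beta> l) else 0)"
      by (intro sum.cong refl) (auto simp: mult_ac simp flip: power_add)
    then show ?thesis using l by simp
  qed
  ultimately have "x ^ r * (x ^ l * Eflat l q - emb (\<beta> l)) =
      (\<Sum>j<r. emb (\<beta> j) * (x ^ (r - j) * (x ^ l * Eflat l (ybar j) - (if l = j then x ^ l else 0))))"
    by (simp only: right_diff_distrib sum_subtractf)
  also have "\<dots> \<in> pw A2 (r + 1)"
  proof (rule pw2(5))
    fix j assume j: "j \<in> {..<r}"
    have "x ^ (r - j) * (x ^ l * Eflat l (ybar j) - (if l = j then x ^ l else 0)) \<in> pw A2 (r - j + r)"
      using j by (intro pw2_power Eflat_ybar_pw l) auto
    then have "x ^ (r - j) * (x ^ l * Eflat l (ybar j) - (if l = j then x ^ l else 0)) \<in> pw A2 (r + 1)"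
      by (rule pw2_mono[rotated]) (use j in auto)
    then show "emb (\<beta> j) * (x ^ (r - j) * (x ^ l * Eflat l (ybar j) - (if l = j then x ^ l else 0)))
        \<in> pw A2 (r + 1)"
      by (rule pw2(4)[OF scalar_in2])
  qed
  finally show ?thesis by (rule pw2_cancel)
qed

text \<open>Apply \<open>Eflat l\<close> to d f = 0 and move it past d. The commutators with
  \<delta> and e bring a factor x^r in front of the \<open>E j f\<close> and so lie in
  \<open>JG\<close>; what else remains is the derivative of the feedback, \<open>\<beta> l\<close>
  modulo x, times e f.\<close>

lemma d_G: "l < r \<Longrightarrow> d (G l) - (of_nat l * G l - emb (\<beta> l) * e f) \<in> JG"
proof -
  assume l: "l < r"
  have "Eflat l (d f) = 0" using df der_0[OF Eflat_der] by simp
  then have 0: "x * Eflat l (\<delta> f) + (q * Eflat l (e f) + Eflat l q * e f) = 0"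
    by (simp add: d_def der_add[OF Eflat_der] der_mult[OF Eflat_der] Eflat_x)
  have "d (G l) - of_nat l * G l = x ^ l * d (Eflat l f)"
    unfolding G_def d_power_mult by (simp add: algebra_simps)
  also have "d (Eflat l f) = x * brk \<delta> (Eflat l) f + q * brk e (Eflat l) f - Eflat l q * e f"
    using 0 unfolding d_def brk_def by (simp add: algebra_simps)
  finally have "d (G l) - (of_nat l * G l - emb (\<beta> l) * e f) =
      x ^ l * (x * brk \<delta> (Eflat l) f) + x ^ l * (q * brk e (Eflat l) f)
      - (x ^ l * Eflat l q - emb (\<beta> l)) * e f"
    by (simp add: algebra_simps)
  moreover have "x ^ l * (x * brk \<delta> (Eflat l) f) \<in> JG"
  proof -
    obtain b where b: "b \<in> A" "twist (r - l - 1) = x ^ (r - l - 1) * b"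
      using twist_pw[of "r - l - 1"] by (auto simp: pw_def)
    have "x ^ l * (x * (x ^ (r - l - 1))) = x ^ r"
      using l by (simp flip: power_add power_Suc)
    then have "x ^ l * (x * brk \<delta> (Eflat l) f) = x ^ r * (b * E r f)"
      unfolding brk_\<delta>_Eflat[OF l] b by (metis mult.assoc)
    also have "\<dots> = (\<Sum>j<r. (b * a j) * (x ^ r * E j f))"
      unfolding rel sum_distrib_left by (simp only: mult_ac)
    also have "\<dots> \<in> JG" by (intro JG_sum JG_mult E_JG A_sub A_intros b a_in) auto
    finally show ?thesis .
  qed
  moreover have "x ^ l * (q * brk e (Eflat l) f) \<in> JG"
  proof -
    have "brk e (Eflat l) f = (\<Sum>i<r - l. twist i * brk e (E (l + i)) f)"
    proof -
      have "e (twist i) = 0" for i using E_twist[of 0] by simp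
      then show ?thesis unfolding brk_def Eflat_def
        by (simp add: der_sum[OF e] der_mult[OF e] sum_subtractf right_diff_distrib)
    qed
    also have "\<dots> = (\<Sum>i<r - l. \<Sum>j<r. (twist i * c (l + i) j) * E j f)"
    proof (intro sum.cong refl)
      fix i assume "i \<in> {..<r - l}"
      then have "brk e (E (l + i)) f = (\<Sum>j<r. c (l + i) j * E j f)" by (intro brk_rel) auto
      then show "twist i * brk e (E (l + i)) f = (\<Sum>j<r. (twist i * c (l + i) j) * E j f)"
        by (simp only: sum_distrib_left mult.assoc)
    qed
    finally have "x ^ l * (q * brk e (Eflat l) f) =
        (\<Sum>i<r - l. \<Sum>j<r. (x ^ l * \<tau> * (twist i * c (l + i) j)) * (x ^ r * E j f))"
      unfolding q_def by (simp only: sum_distrib_left mult_ac)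
    also have "\<dots> \<in> JG"
      by (intro JG_sum JG_mult E_JG A2_intros \<tau>_in x_in2 A_sub[OF twist_in] A_sub[OF c_in]) auto
    finally show ?thesis .
  qed
  moreover have "(x ^ l * Eflat l q - emb (\<beta> l)) * e f \<in> JG"
  proof -
    obtain b where "b \<in> A2" "x ^ l * Eflat l q - emb (\<beta> l) = x ^ 1 * b"
      using Eflat_q[OF l] by (auto simp: pw_def)
    then show ?thesis using JG_mult[OF _ x_ef, of b] by (simp add: mult_ac)
  qed
  ultimately show ?thesis by (simp only: JG_add JG_diff)
qed

definition Gs :: "nat \<Rightarrow> 'f" where "Gs s = (\<Sum>l<r. emb (\<kappa> s l) * (invfact l * G l))"

text \<open>The transpose of \<open>d_zs\<close>: now l = (l + s + r + 1) - (s + r + 1), and the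
  first part contributes e f, which the feedback term cancels.\<close>

lemma d_Gs: "s < r \<Longrightarrow> d (Gs s) + of_nat (s + Suc r) * Gs s \<in> JG"
proof -
  assume s: "s < r"
  have "(\<Sum>l<r. (emb (\<kappa> s l) * invfact l) * (d (G l) - (of_nat l * G l - emb (\<beta> l) * e f))) \<in> JG"
    by (intro JG_sum JG_mult A2_intros scalar_in2 A_sub[OF invfact_in] d_G) auto
  also have "(\<Sum>l<r. (emb (\<kappa> s l) * invfact l) * (d (G l) - (of_nat l * G l - emb (\<beta> l) * e f))) =
      (\<Sum>l<r. emb (\<kappa> s l) * (invfact l * d (G l))) -
      ((\<Sum>l<r. emb (\<kappa> s l) * of_nat l * (invfact l * G l)) - (\<Sum>l<r. emb (\<alpha> l) * emb (\<kappa> s l)) * e f)"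
  proof -
    have "(emb (\<kappa> s l) * invfact l) * (d (G l) - (of_nat l * G l - emb (\<beta> l) * e f)) =
        emb (\<kappa> s l) * (invfact l * d (G l)) - (emb (\<kappa> s l) * of_nat l * (invfact l * G l)
        - emb (\<alpha> l) * emb (\<kappa> s l) * e f)" for l
      using \<beta>_invfact[of l, symmetric] by (simp add: algebra_simps)
    then show ?thesis by (simp only: sum_subtractf sum_distrib_right)
  qed
  also have "(\<Sum>l<r. emb (\<kappa> s l) * (invfact l * d (G l))) = d (Gs s)"
    unfolding Gs_def by (simp add: der_sum[OF d_der] der_emb_mult[OF d_der] der_invfact[OF d_der])
  also have "(\<Sum>l<r. emb (\<kappa> s l) * of_nat l * (invfact l * G l)) = e f - of_nat (s + Suc r) * Gs s"
  proof -
    have "emb (\<kappa> s l) * of_nat l * (invfact l * G l) =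
        invfact l * G l - of_nat (s + Suc r) * (emb (\<kappa> s l) * (invfact l * G l))" for l
    proof -
      have "(of_nat (l + s + Suc r) :: 'f) = of_nat l + of_nat (s + Suc r)"
        by (simp only: of_nat_add add.assoc)
      then have "emb (\<kappa> s l) * (of_nat l + of_nat (s + Suc r)) * (invfact l * G l) = invfact l * G l"
        using emb_\<kappa>[of s l] by (simp only: mult_1_left)
      then show ?thesis by (simp add: algebra_simps del: of_nat_Suc of_nat_add)
    qed
    then show ?thesis by (simp only: sum_subtractf ef Gs_def sum_distrib_left)
  qed
  finally show ?thesis by (simp only: sum_\<alpha>\<kappa>[OF s] mult_1_left) (simp add: algebra_simps)
qed

lemma G_via_Gs: "l < r \<Longrightarrow> invfact l * G l = (\<Sum>s<r. emb (B l s) * Gs s)"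
  unfolding Gs_def using cauchy_inverse[of l "\<lambda>l. invfact l * G l"] by simp

text \<open>Each round gains one power of x: \<open>JG\<close> has one more than the
  \<open>G l\<close>, and cancelling x^m moves the eigenvalue from -(s + r + 1) to -(s + r + 1 + m),
  which is still negative.\<close>

lemma Gs_pw: "s < r \<Longrightarrow> Gs s \<in> pw A2 m"
proof (induction m arbitrary: s)
  case 0
  have "Gs s \<in> A2" unfolding Gs_def G_def
    by (intro A2_intros scalar_in2 A_sub[OF invfact_in] x_in2 A_sub[OF Eflat_in] f)
  then show ?case by (auto simp: pw_def)
next
  case (Suc m)
  have G: "G l \<in> pw A2 m" if l: "l < r" for l
  proof -
    have "invfact l * G l \<in> pw A2 m"
      unfolding G_via_Gs[OF l] by (intro pw2(5) pw2(4) scalar_in2 Suc.IH) auto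
    then have "emb (fact l) * (invfact l * G l) \<in> pw A2 m" by (rule pw2(4)[OF scalar_in2])
    moreover have "emb (fact l) * invfact l = 1"
      unfolding invfact_def by (simp flip: emb_mult)
    ultimately show ?thesis by (simp add: mult.assoc[symmetric])
  qed
  have JG_pw: "w \<in> pw A2 (m + 1)" if w: "w \<in> JG" for w
  proof -
    obtain b where b: "\<forall>j<r. b j \<in> A2" "w = (\<Sum>j<r. b j * (x * G j))" using w unfolding JG_def by blast
    have "b j * (x * G j) \<in> pw A2 (m + 1)" if j: "j < r" for j
      using pw2_power[OF G[OF j], of 1] b(1) j by (intro pw2(4)[of "b j"]) auto
    then show ?thesis unfolding b by (intro pw2(5)) auto
  qed
  obtain g where g: "g \<in> A2" "Gs s = x ^ m * g" using Suc.IH[OF Suc.prems] by (auto simp: pw_def)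
  have "x ^ m * (d g + of_nat (Suc (s + r + m)) * g) \<in> pw A2 (m + 1)"
    using JG_pw[OF d_Gs[OF Suc.prems]] unfolding g d_power_mult by (simp add: algebra_simps)
  then have "d g + of_nat (Suc (s + r + m)) * g \<in> pw A2 1" by (rule pw2_cancel)
  from negative_eigenvector[OF g(1) this] have "g \<in> pw A2 1" .
  then show ?case unfolding g using pw2_power[of g 1 m] by simp
qed

lemma first_integral: "e f = 0 \<and> \<delta> f = 0"
proof -
  have "noetherian A2" unfolding A2_def by (rule noetherian_gen) (simp add: fin)
  then have Gs0: "Gs s = 0" if "s < r" for s
    using Gs_pw[OF that] x_nonunit x_in2 x_nz
    by (intro noetherian_powers_inter[OF A2_ring]) (auto simp: pw_def)
  have "G l = 0" if "l < r" for l
    using G_via_Gs[OF that] Gs0 invfact_nz[of l] by simp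
  then have "e f = 0" by (simp add: ef)
  moreover from this have "\<delta> f = 0" using df x_nz by (simp add: d_def)
  ultimately show ?thesis by simp
qed

end

end

section \<open>Combining two derivations\<close>

context scalar_embedding
begin

lemma der_gen_in:
  assumes D: "der D" and "\<And>s. s \<in> S \<Longrightarrow> D s \<in> gen S'" and "S \<subseteq> gen S'" and "z \<in> gen S"
  shows "D z \<in> gen S'"
  using assms(4)
proof (induction rule: gen.induct)
  case (scalar k)
  show ?case using gen.scalar[of 0 S'] by (simp add: der_emb[OF D])
next
  case (mult a b)
  moreover have "gen S \<subseteq> gen S'"
    using assms(3) by (intro gen_minimal is_subring_gen) (auto intro: gen.scalar)
  ultimately show ?case by (simp add: der_mult[OF D] gen.add gen.mult subset_iff)
qed (use assms(2) in \<open>auto simp: der_add[OF D] intro: gen.add\<close>)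

lemma common_denominator:
  assumes frac: "\<And>z. \<exists>u\<in>gen S. \<exists>v\<in>gen S. v \<noteq> 0 \<and> z = u / v" and "finite T"
  shows "\<exists>g\<in>gen S. g \<noteq> 0 \<and> (\<forall>z\<in>T. z * g \<in> gen S)"
  using assms(2)
proof (induction T rule: finite_induct)
  case empty
  show ?case using subring_one[OF is_subring_gen] by (intro bexI[of _ 1]) auto
next
  case (insert w T)
  then obtain g where g: "g \<in> gen S" "g \<noteq> 0" "\<forall>z\<in>T. z * g \<in> gen S" by blast
  obtain u v where uv: "u \<in> gen S" "v \<in> gen S" "v \<noteq> 0" "w = u / v" using frac by blast
  have "w * (g * v) = u * g" using uv by simp
  moreover have "z * (g * v) \<in> gen S" if "z \<in> T" for z
    using gen.mult[of "z * g" S v] g(3) uv(2) that by (simp add: mult.assoc)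
  ultimately show ?case using g uv by (intro bexI[of _ "g * v"]) (auto intro: gen.mult)
qed

lemma der_determined:
  assumes frac: "\<And>z. \<exists>u\<in>gen S. \<exists>v\<in>gen S. v \<noteq> 0 \<and> z = u / v"
    and D: "der D" and 0: "\<forall>s\<in>S. D s = 0"
  shows "\<forall>z. D z = 0"
proof
  fix z
  have g0: "D w = 0" if "w \<in> gen S" for w
    using that
    by (induction rule: gen.induct) (auto simp: 0 der_emb[OF D] der_add[OF D] der_mult[OF D])
  obtain u v where uv: "u \<in> gen S" "v \<in> gen S" "v \<noteq> 0" "z = u / v" using frac by blast
  have "D (z * v) = 0" using uv g0 by simp
  then have "D z * v = 0" using der_mult[OF D, of z v] g0[OF uv(2)] by simp
  then show "D z = 0" using uv(3) by simp
qed

lemma ex_combination: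
  assumes fin: "finite S"
    and frac: "\<And>z. \<exists>u\<in>gen S. \<exists>v\<in>gen S. v \<noteq> 0 \<and> z = u / v"
    and \<delta>: "der \<delta>" and e: "der e"
  shows "\<exists>u v. \<forall>f\<in>gen S. u * \<delta> f + v * e f = 0 \<longrightarrow> \<delta> f = 0 \<and> e f = 0"
proof -
  note determined = der_determined[OF frac]
  \<comment> \<open>In the first two cases one of the derivations suffices alone. In the third,
    \<open>x0\<close> supplies the time coordinate.\<close>
  consider "\<forall>f\<in>gen S. e f = 0 \<longrightarrow> \<delta> f = 0" | "\<forall>z. e z = 0"
    | x0 z0 where "x0 \<in> gen S" "e x0 = 0" "\<delta> x0 \<noteq> 0" "e z0 \<noteq> 0" by blast
  then show ?thesis
  proof cases
    case 1
    then show ?thesis by (intro exI[of _ 0] exI[of _ 1]) auto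
  next
    case 2
    then show ?thesis by (intro exI[of _ 1] exI[of _ 0]) auto
  next
    case 3
    define \<delta>1 where "\<delta>1 z = inverse (\<delta> x0) * \<delta> z" for z
    have \<delta>1: "der \<delta>1" unfolding \<delta>1_def by (rule der_scale[OF \<delta>])
    obtain t r where r: "r > 0" "lin_indep UNIV r (iter_brk (\<lambda>z. \<delta>1 z + t * e z) e)"
      and max: "\<And>u. \<not> lin_indep UNIV (Suc r) (iter_brk (\<lambda>z. (\<delta>1 z + t * e z) + u * e z) e)"
      using ex_maximal_rank[OF fin determined \<delta>1 e 3(4)] by blast
    define \<delta>2 where "\<delta>2 z = \<delta>1 z + t * e z" for z
    have \<delta>2: "der \<delta>2" unfolding \<delta>2_def by (rule der_plus_scale[OF \<delta>1 e])
    have \<delta>2x0: "\<delta>2 x0 = 1" using 3 by (simp add: \<delta>2_def \<delta>1_def)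
    let ?E = "iter_brk \<delta>2 e"
    have \<delta>2_eq: "\<delta>2 = (\<lambda>z. \<delta>1 z + t * e z)" by (simp add: fun_eq_iff \<delta>2_def)
    have ind: "lin_indep UNIV r ?E" using r(2) unfolding \<delta>2_eq .
    have max2: "\<not> lin_indep UNIV (Suc r) (iter_brk (\<lambda>z. \<delta>2 z + u * e z) e)" for u
      using max[of u] unfolding \<delta>2_eq .
    note span = brk_in_span[OF \<delta>2 e \<delta>2x0 3(2) r(1) ind max2]
    obtain a where a: "\<And>z. ?E r z = (\<Sum>j<r. a j * ?E j z)"
      using span(1) unfolding in_span_def by blast
    have "\<forall>i. \<exists>b. i < r \<longrightarrow> (\<forall>z. brk e (?E i) z = (\<Sum>j<r. b j * ?E j z))"
      using span(2) unfolding in_span_def by blast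
    then obtain c where c: "\<And>i z. i < r \<Longrightarrow> brk e (?E i) z = (\<Sum>j<r. c i j * ?E j z)" by metis
    have "lin_indep S r ?E"
      by (rule lin_indep_on_generators[OF determined der_iter_brk[OF \<delta>2 e] ind])
    then obtain y where y: "\<And>j. j < r \<Longrightarrow> y j \<in> S" and det: "det (eval_mat r ?E y) \<noteq> 0"
      using lin_indep_imp_det by blast
    let ?M = "eval_mat r ?E y"
    obtain W where W: "W \<in> carrier_mat r r" "W * ?M = 1\<^sub>m r" "?M * W = 1\<^sub>m r"
      using det_non_zero_imp_unit[OF eval_mat_carrier det] unfolding Units_def ring_mat_def by auto
    define N where "N i j = W $$ (j, i)" for i j
    have NG: "(\<Sum>m<r. N l m * ?E i (y m)) = (if l = i then 1 else 0)" if "l < r" "i < r" for l i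
    proof -
      have "(?M * W) $$ (i, l) = (\<Sum>m<r. N l m * ?E i (y m))"
        using that W(1) by (auto simp: eval_mat_def N_def scalar_prod_def atLeast0LessThan mult.commute
            intro!: sum.cong)
      then show ?thesis using W(3) that by auto
    qed
    have GN: "(\<Sum>i<r. ?E i (y m) * N i m') = (if m = m' then 1 else 0)" if "m < r" "m' < r" for m m'
    proof -
      have "(W * ?M) $$ (m', m) = (\<Sum>i<r. ?E i (y m) * N i m')"
        using that W(1) by (auto simp: eval_mat_def N_def scalar_prod_def atLeast0LessThan mult.commute
            intro!: sum.cong)
      then show ?thesis using W(2) that by auto
    qed
    define T where "T = a ` {..<r} \<union> (\<lambda>(i, j). c i j) ` ({..<r} \<times> {..<r}) \<union>
      (\<lambda>(i, j). N i j) ` ({..<r} \<times> {..<r}) \<union> \<delta>2 ` S \<union> e ` S"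
    have "finite T" unfolding T_def using fin by auto
    then obtain g where g: "g \<in> gen S" "g \<noteq> 0" "\<And>z. z \<in> T \<Longrightarrow> z * g \<in> gen S"
      using common_denominator[OF frac] by blast
    \<comment> \<open>Inverting \<open>g\<close> makes the structure functions and the images of the
      generators regular; by the quotient rule the localisation stays closed under \<delta>2 and
      e.\<close>
    define S1 where "S1 = insert (inverse g) S"
    have SS1: "gen S \<subseteq> gen S1" unfolding S1_def by (rule gen_mono) auto
    have inv_in: "inverse g \<in> gen S1" unfolding S1_def by (rule gen.base) simp
    have T_in: "z \<in> gen S1" if "z \<in> T" for z
    proof -
      have "(z * g) * inverse g \<in> gen S1" by (rule gen.mult[OF subsetD[OF SS1 g(3)[OF that]] inv_in])
      then show ?thesis using g(2) by (simp add: mult.assoc)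
    qed
    have closed: "D z \<in> gen S1" if D: "der D" and DS: "\<And>s. s \<in> S \<Longrightarrow> D s \<in> gen S1" and z: "z \<in> gen S1" for D z
    proof (rule der_gen_in[OF D _ _ z])
      fix s assume "s \<in> S1"
      moreover have "D g \<in> gen S1"
        using SS1 by (intro der_gen_in[OF D DS _ g(1)]) (auto intro: gen.base)
      then have "- D g * inverse g ^ 2 \<in> gen S1"
        using inv_in by (intro subring_intros[OF is_subring_gen])
      ultimately show "D s \<in> gen S1" using DS by (auto simp: S1_def der_inverse[OF D g(2)])
    qed (auto intro: gen.base)
    obtain p where p: "point (gen S1) p"
      using ex_point[of S1 1] fin subring_one[OF is_subring_gen] by (auto simp: S1_def)
    \<comment> \<open>The constant moves the point \<open>p\<close> onto x = 0 and does not affect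
      any derivative.\<close>
    define x where "x = x0 - emb (p x0)"
    have x0: "x0 \<in> gen S1" using 3(1) SS1 by auto
    have x_in: "x \<in> gen S1" unfolding x_def
      by (intro subring_diff[OF is_subring_gen] x0 gen.scalar)
    have px: "p x = 0"
    proof -
      have "p (x + emb (p x0)) = p x + p (emb (p x0))"
        using p x_in gen.scalar[of "p x0" S1] unfolding point_def by blast
      then show ?thesis using p by (simp add: x_def point_def)
    qed
    obtain \<alpha> B where \<alpha>B: "\<forall>s<r. (\<Sum>l<r. \<alpha> l / of_nat (l + s + Suc r)) = (1 :: 'k)"
      "\<forall>l<r. \<alpha> l \<noteq> 0"
      "\<forall>l<r. \<forall>m<r. (\<Sum>s<r. B l s / of_nat (m + s + Suc r)) = (if l = m then 1 else 0 :: 'k)"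
      using cauchy_matrix[of "Suc r" r] by blast
    interpret W: weighted_contraction emb S1 \<delta>2 e x r a c y N p \<alpha> B
    proof
      show "finite S1" using fin by (simp add: S1_def)
      show "\<delta>2 z \<in> gen S1" if "z \<in> gen S1" for z
        by (rule closed[OF \<delta>2 T_in that]) (simp add: T_def)
      show "e z \<in> gen S1" if "z \<in> gen S1" for z
        by (rule closed[OF e T_in that]) (simp add: T_def)
      show "\<delta>2 x = 1" using \<delta>2x0 by (simp add: x_def der_diff[OF \<delta>2] der_emb[OF \<delta>2])
      show "e x = 0" using 3(2) by (simp add: x_def der_diff[OF e] der_emb[OF e])
      show "a j \<in> gen S1" if "j < r" for j using that by (intro T_in) (auto simp: T_def)
      show "c i j \<in> gen S1" if "i < r" "j < r" for i j
      proof (rule T_in)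
        have "(\<lambda>(i, j). c i j) (i, j) \<in> (\<lambda>(i, j). c i j) ` ({..<r} \<times> {..<r})"
          using that by (intro imageI) auto
        then show "c i j \<in> T" by (simp add: T_def)
      qed
      show "N i j \<in> gen S1" if "i < r" "j < r" for i j
      proof (rule T_in)
        have "(\<lambda>(i, j). N i j) (i, j) \<in> (\<lambda>(i, j). N i j) ` ({..<r} \<times> {..<r})"
          using that by (intro imageI) auto
        then show "N i j \<in> T" by (simp add: T_def)
      qed
      show "y j \<in> gen S1" if "j < r" for j using y[OF that] by (intro gen.base) (simp add: S1_def)
    qed (use \<delta>2 e x_in px r a c NG GN p \<alpha>B in auto)
    show ?thesis
    proof (intro exI ballI impI)
      \<comment> \<open>The coefficients are those of \<open>W.d\<close>, rewritten from \<delta>2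
        and e to \<delta> and e.\<close>
      fix f assume f: "f \<in> gen S" "(x * inverse (\<delta> x0)) * \<delta> f + (x * t + W.q) * e f = 0"
      have "W.d f = 0" using f(2) by (simp add: W.d_def \<delta>2_def \<delta>1_def algebra_simps)
      with W.first_integral[of f] have *: "e f = 0" "\<delta>2 f = 0" using f(1) SS1 by auto
      then show "\<delta> f = 0 \<and> e f = 0" using 3(3) by (simp add: \<delta>2_def \<delta>1_def)
    qed
  qed
qed

end

section \<open>Extension to the field of fractions\<close>

definition into_fract :: "'a::idom \<Rightarrow> 'a fract" where "into_fract a = Fract a 1"

lemma into_fract_add: "into_fract (a + b) = into_fract a + into_fract b" by (simp add: into_fract_def)
lemma into_fract_mult: "into_fract (a * b) = into_fract a * into_fract b" by (simp add: into_fract_def)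
lemma into_fract_1 [simp]: "into_fract 1 = 1" by (simp add: into_fract_def One_fract_def)
lemma into_fract_0 [simp]: "into_fract 0 = 0" by (simp add: into_fract_def Zero_fract_def)
lemma into_fract_eq_0 [simp]: "into_fract a = 0 \<longleftrightarrow> a = 0"
  by (simp add: into_fract_def Zero_fract_def eq_fract)
lemma into_fract_eq [simp]: "into_fract a = into_fract b \<longleftrightarrow> a = b"
  by (simp add: into_fract_def eq_fract)

lemma into_fract_repr: "\<exists>a b. b \<noteq> 0 \<and> z * into_fract b = into_fract a"
proof -
  obtain a b where "z = Fract a b" "b \<noteq> 0" by (cases z) auto
  then show ?thesis by (intro exI[of _ a] exI[of _ b]) (simp add: into_fract_def eq_fract)
qed

context k_algebra
begin

lemma scale_one_mult: "scale c x = scale c 1 * x" using scale_mult_left[of c 1 x] by simp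

lemma linear_iff:
  "Vector_Spaces.linear scale scale f \<longleftrightarrow>
    (\<forall>x y. f (x + y) = f x + f y) \<and> (\<forall>c x. f (scale c x) = scale c (f x))"
  using linear_iff_module_hom vector_space_axioms module_axioms
  by (auto simp: module_hom_iff_linear[symmetric] module_hom_iff)

context
  fixes D assumes D: "derivation scale D"
begin

lemma derivation_add: "D (a + b) = D a + D b" using D by (simp add: derivation_def linear_iff)
lemma derivation_scale: "D (scale c a) = scale c (D a)" using D by (simp add: derivation_def linear_iff)
lemma derivation_mult: "D (a * b) = a * D b + D a * b" using D by (simp add: derivation_def)
lemma derivation_0: "D 0 = 0" using derivation_add[of 0 0] by (metis add_cancel_right_right add_0_right)
lemma derivation_1: "D 1 = 0" using derivation_mult[of 1 1] by simp
lemma derivation_sum: "D (\<Sum>i\<in>I. f i) = (\<Sum>i\<in>I. D (f i))"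
  by (induction I rule: infinite_finite_induct) (auto simp: derivation_0 derivation_add)

end

end

text \<open>The quotient rule cleared of denominators, demanded for all fractions representing z at
  once; independence of the representative becomes the existence proof in
  \<open>extend_derivation_eq\<close>.\<close>

definition extend_derivation :: "('a::idom \<Rightarrow> 'a) \<Rightarrow> 'a fract \<Rightarrow> 'a fract" where
  "extend_derivation D z = (SOME w. \<forall>a b. b \<noteq> 0 \<longrightarrow> z * into_fract b = into_fract a \<longrightarrow>
     w * into_fract b + z * into_fract (D b) = into_fract (D a))"

locale finite_type_domain = k_algebra scale
  for scale :: "'k::{alg_closed_field, field_char_0} \<Rightarrow> 'a::idom \<Rightarrow> 'a" +
  fixes S :: "'a set"
  assumes finite_S: "finite S" and S_generates: "subalgebra scale hull S = UNIV"
begin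

definition emb :: "'k \<Rightarrow> 'a fract" where "emb c = into_fract (scale c 1)"

sublocale scalar_embedding emb
proof
  show "emb 1 = 1" by (simp add: emb_def)
  show "emb (a + b) = emb a + emb b" for a b
    by (simp add: emb_def scale_left_distrib into_fract_add)
  show "emb (a * b) = emb a * emb b" for a b
    using scale_one_mult[of a "scale b 1"] by (simp add: emb_def into_fract_mult[symmetric])
qed

lemma subalgebra_UNIV:
  assumes "S \<subseteq> B" "0 \<in> B" "1 \<in> B" "\<And>x y. x \<in> B \<Longrightarrow> y \<in> B \<Longrightarrow> x + y \<in> B"
    "\<And>c x. x \<in> B \<Longrightarrow> scale c x \<in> B" "\<And>x y. x \<in> B \<Longrightarrow> y \<in> B \<Longrightarrow> x * y \<in> B"
  shows "x \<in> B"
proof -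
  have "subalgebra scale B" using assms by (simp add: subalgebra_def subspace_def)
  then have "subalgebra scale hull S \<subseteq> B" using assms(1) by (intro hull_minimal)
  then show ?thesis using S_generates by blast
qed

abbreviation K_gens :: "'a fract set" where "K_gens \<equiv> into_fract ` S"

lemma into_fract_in: "into_fract a \<in> gen K_gens"
proof -
  have "a \<in> {a. into_fract a \<in> gen K_gens}"
  proof (rule subalgebra_UNIV)
    show "S \<subseteq> {a. into_fract a \<in> gen K_gens}" by (auto intro: gen.base)
    show "scale c x \<in> {a. into_fract a \<in> gen K_gens}" if "x \<in> {a. into_fract a \<in> gen K_gens}" for c x
      using that gen.mult[OF gen.scalar[of c]] scale_one_mult[of c x]
      by (simp add: emb_def into_fract_mult)
  qed (use subring_intros[OF is_subring_gen] in \<open>auto simp: into_fract_add into_fract_mult\<close>)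
  then show ?thesis by simp
qed

lemma gen_fractions: "\<exists>u\<in>gen K_gens. \<exists>v\<in>gen K_gens. v \<noteq> 0 \<and> z = u / v"
proof -
  obtain a b where "b \<noteq> 0" "z * into_fract b = into_fract a" using into_fract_repr by blast
  then show ?thesis using into_fract_in
    by (intro bexI[of _ "into_fract a"] bexI[of _ "into_fract b"]) (auto simp: eq_divide_eq)
qed

context
  fixes D assumes D: "derivation scale D"
begin

lemma extend_derivation_eq:
  assumes "b \<noteq> 0" "z * into_fract b = into_fract a"
  shows "extend_derivation D z * into_fract b + z * into_fract (D b) = into_fract (D a)"
proof -
  define w where "w = (into_fract (D a) - z * into_fract (D b)) / into_fract b"
  have "w * into_fract b' + z * into_fract (D b') = into_fract (D a')"
    if b': "b' \<noteq> 0" "z * into_fract b' = into_fract a'" for a' b'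
  proof -
    have "into_fract (a * b') = into_fract (a' * b)"
      unfolding into_fract_mult assms(2)[symmetric] b'(2)[symmetric] by simp
    then have "D (a * b') = D (a' * b)" by simp
    then have "into_fract (a * D b' + D a * b') = into_fract (a' * D b + D a' * b)"
      by (simp add: derivation_mult[OF D])
    then have *: "into_fract a * into_fract (D b') + into_fract (D a) * into_fract b' =
        into_fract a' * into_fract (D b) + into_fract (D a') * into_fract b"
      by (simp only: into_fract_add into_fract_mult)
    have "(w * into_fract b' + z * into_fract (D b')) * into_fract b =
        (into_fract (D a) - z * into_fract (D b)) * into_fract b' + (z * into_fract b) * into_fract (D b')"
      using assms(1) by (simp add: w_def field_simps)
    also have "\<dots> = into_fract a * into_fract (D b') + into_fract (D a) * into_fract b'
        - (z * into_fract b') * into_fract (D b)"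
      unfolding assms(2) by (simp add: algebra_simps)
    also have "\<dots> = into_fract (D a') * into_fract b" unfolding * b'(2) by simp
    finally show ?thesis using assms(1) by simp
  qed
  then have "\<forall>a b. b \<noteq> 0 \<longrightarrow> z * into_fract b = into_fract a \<longrightarrow>
      w * into_fract b + z * into_fract (D b) = into_fract (D a)" by blast
  from someI[of "\<lambda>w. \<forall>a b. b \<noteq> 0 \<longrightarrow> z * into_fract b = into_fract a \<longrightarrow>
      w * into_fract b + z * into_fract (D b) = into_fract (D a)", OF this]
  show ?thesis using assms unfolding extend_derivation_def by blast
qed

lemma extend_derivation_into_fract: "extend_derivation D (into_fract a) = into_fract (D a)"
  using extend_derivation_eq[of 1 "into_fract a" a] by (simp add: derivation_1[OF D])

lemma der_extend_derivation: "der (extend_derivation D)"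
  unfolding der_def
proof (intro conjI allI)
  let ?D = "extend_derivation D"
  fix z w :: "'a fract"
  obtain a b where b: "b \<noteq> 0" "z * into_fract b = into_fract a" using into_fract_repr by blast
  obtain a' b' where b': "b' \<noteq> 0" "w * into_fract b' = into_fract a'" using into_fract_repr by blast
  note z = extend_derivation_eq[OF b] and w = extend_derivation_eq[OF b']
  have bb: "b * b' \<noteq> 0" using b b' by simp
  have "z * into_fract (b * b') = into_fract (a * b')" "w * into_fract (b * b') = into_fract (a' * b)"
    unfolding into_fract_mult b(2)[symmetric] b'(2)[symmetric] by (simp_all only: mult_ac)
  then have zw: "z * into_fract (b * b') = into_fract (a * b')" "w * into_fract (b * b') = into_fract (a' * b)"
    "(z + w) * into_fract (b * b') = into_fract (a * b' + a' * b)"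
    by (simp_all add: distrib_right into_fract_add)
  have "(P + Q - U) * b = (P * b + z * x) + (Q * b + w * x) - (U * b + (z + w) * x)"
    for P Q U b x :: "'a fract" by (simp add: algebra_simps)
  from this[of "?D z" "?D w" "?D (z + w)" "into_fract (b * b')" "into_fract (D (b * b'))"]
  have "(?D z + ?D w - ?D (z + w)) * into_fract (b * b') = 0"
    unfolding extend_derivation_eq[OF bb zw(1)] extend_derivation_eq[OF bb zw(2)]
      extend_derivation_eq[OF bb zw(3)] by (simp add: derivation_add[OF D] into_fract_add)
  then have "?D z + ?D w - ?D (z + w) = 0" using bb by simp
  then show "?D (z + w) = ?D z + ?D w" by simp
  have prod: "(z * w) * into_fract (b * b') = into_fract (a * a')"
    unfolding into_fract_mult b(2)[symmetric] b'(2)[symmetric] by (simp only: mult_ac)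
  have "?D (z * w) * into_fract (b * b') = into_fract (D (a * a')) - (z * w) * into_fract (D (b * b'))"
    using extend_derivation_eq[OF bb prod] by (simp add: algebra_simps)
  also have "\<dots> = into_fract a * into_fract (D a') + into_fract (D a) * into_fract a'
      - z * w * (into_fract b * into_fract (D b') + into_fract (D b) * into_fract b')"
    by (simp add: derivation_mult[OF D] into_fract_add into_fract_mult)
  also have "\<dots> = (z * ?D w + ?D z * w) * into_fract (b * b')"
    unfolding z[symmetric] w[symmetric] b(2)[symmetric] b'(2)[symmetric] into_fract_mult
    by (simp add: algebra_simps)
  finally show "?D (z * w) = z * ?D w + ?D z * w" using bb by simp
next
  fix c
  show "extend_derivation D (emb c) = 0"
    unfolding emb_def extend_derivation_into_fract
    using derivation_scale[OF D, of c 1] by (simp add: derivation_1[OF D])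
qed

end

text \<open>Multiplying by both denominators moves the coefficients from the fraction field into
  \<open>'a\<close>, as membership in the module requires.\<close>

lemma ex_combination_domain:
  assumes "derivation scale \<delta>" "derivation scale e"
  shows "\<exists>a b. \<forall>f. a * \<delta> f + b * e f = 0 \<longrightarrow> \<delta> f = 0 \<and> e f = 0"
proof -
  obtain u v where uv: "\<forall>f\<in>gen K_gens. u * extend_derivation \<delta> f + v * extend_derivation e f = 0
      \<longrightarrow> extend_derivation \<delta> f = 0 \<and> extend_derivation e f = 0"
    using ex_combination[OF _ gen_fractions der_extend_derivation[OF assms(1)]
        der_extend_derivation[OF assms(2)]] finite_S by blast
  obtain a c where c: "c \<noteq> 0" "u * into_fract c = into_fract a" using into_fract_repr by blast
  obtain b c' where c': "c' \<noteq> 0" "v * into_fract c' = into_fract b" using into_fract_repr by blast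
  show ?thesis
  proof (intro exI allI impI)
    fix f assume f: "(a * c') * \<delta> f + (b * c) * e f = 0"
    have "(u * into_fract (\<delta> f) + v * into_fract (e f)) * (into_fract c * into_fract c') =
        (u * into_fract c) * into_fract c' * into_fract (\<delta> f) + (v * into_fract c') * into_fract c * into_fract (e f)"
      by (simp add: algebra_simps)
    also have "\<dots> = into_fract ((a * c') * \<delta> f + (b * c) * e f)"
      unfolding c(2) c'(2) by (simp add: into_fract_add into_fract_mult)
    finally have "u * into_fract (\<delta> f) + v * into_fract (e f) = 0" using f c c' by simp
    then show "\<delta> f = 0 \<and> e f = 0"
      using uv[rule_format, OF into_fract_in[of f]] assms
      by (simp add: extend_derivation_into_fract)
  qed
qed

section \<open>Finite subfamilies and existence of a minimal derivation\<close>

lemma der_module_span_closed: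
  fixes \<F> :: "('a \<Rightarrow> 'a) set"
  assumes "d \<in> der_module \<F>" "d' \<in> der_module \<F>"
  shows "(\<lambda>z. a * d z + b * d' z) \<in> der_module \<F>"
proof -
  interpret M: Modules.module "fun_scale ((*) :: 'a \<Rightarrow> _)" by (rule module_fun_scale_mult)
  have "fun_scale (*) a d + fun_scale (*) b d' \<in> M.span \<F>"
    using assms unfolding der_module_def by (intro M.span_add M.span_scale)
  moreover have "fun_scale (*) a d + fun_scale (*) b d' = (\<lambda>z. a * d z + b * d' z)"
    by (simp add: fun_scale_def fun_eq_iff)
  ultimately show ?thesis by (simp add: der_module_def)
qed

lemma der_module_mono: "\<F> \<subseteq> \<G> \<Longrightarrow> der_module \<F> \<subseteq> der_module (\<G> :: ('a \<Rightarrow> 'a) set)"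
proof -
  interpret M: Modules.module "fun_scale ((*) :: 'a \<Rightarrow> _)" by (rule module_fun_scale_mult)
  show "\<F> \<subseteq> \<G> \<Longrightarrow> ?thesis" unfolding der_module_def by (rule M.span_mono)
qed

lemma der_module_base: "d \<in> \<F> \<Longrightarrow> d \<in> der_module (\<F> :: ('a \<Rightarrow> 'a) set)"
proof -
  interpret M: Modules.module "fun_scale ((*) :: 'a \<Rightarrow> _)" by (rule module_fun_scale_mult)
  show "d \<in> \<F> \<Longrightarrow> ?thesis" unfolding der_module_def by (rule M.span_base)
qed

lemma der_module_kills:
  fixes \<F> :: "('a \<Rightarrow> 'a) set"
  assumes "d \<in> der_module \<F>" "f \<in> family_ker \<F>"
  shows "d f = 0"
proof -
  interpret M: Modules.module "fun_scale ((*) :: 'a \<Rightarrow> _)" by (rule module_fun_scale_mult)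
  have "d \<in> M.span \<F>" using assms(1) by (simp add: der_module_def)
  then show ?thesis
    by (induction rule: M.span_induct_alt)
       (use assms(2) in \<open>auto simp: fun_scale_def family_ker_def der_ker_def\<close>)
qed

lemma ex_minimal_finite:
  fixes \<F> :: "('a \<Rightarrow> 'a) set"
  assumes "finite \<F>" "\<And>\<delta>. \<delta> \<in> \<F> \<Longrightarrow> derivation scale \<delta>"
  shows "\<exists>d\<in>der_module \<F>. \<forall>f. d f = 0 \<longrightarrow> (\<forall>\<delta>\<in>\<F>. \<delta> f = 0)"
  using assms
proof (induction \<F> rule: finite_induct)
  case empty
  interpret M: Modules.module "fun_scale ((*) :: 'a \<Rightarrow> _)" by (rule module_fun_scale_mult)
  show ?case using M.span_zero[of "{}"] unfolding der_module_def by blast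
next
  case (insert \<delta> \<F>)
  then obtain d where d: "d \<in> der_module \<F>" "\<forall>f. d f = 0 \<longrightarrow> (\<forall>\<delta>\<in>\<F>. \<delta> f = 0)" by auto
  have d_der: "derivation scale d"
    by (rule der_module_derivation[OF k_algebra_axioms _ d(1)]) (use insert in auto)
  obtain a b where ab: "\<forall>f. a * d f + b * \<delta> f = 0 \<longrightarrow> d f = 0 \<and> \<delta> f = 0"
    using ex_combination_domain[OF d_der, of \<delta>] insert by auto
  have "d \<in> der_module (insert \<delta> \<F>)" using der_module_mono[of \<F> "insert \<delta> \<F>"] d(1) by auto
  moreover have "\<delta> \<in> der_module (insert \<delta> \<F>)" by (rule der_module_base) simp
  ultimately have mem: "(\<lambda>z. a * d z + b * \<delta> z) \<in> der_module (insert \<delta> \<F>)"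
    by (rule der_module_span_closed)
  have "\<forall>f. a * d f + b * \<delta> f = 0 \<longrightarrow> (\<forall>\<delta>\<in>insert \<delta> \<F>. \<delta> f = 0)"
  proof (intro allI impI)
    fix f assume "a * d f + b * \<delta> f = 0"
    then have "d f = 0" "\<delta> f = 0" using ab by blast+
    then show "\<forall>\<delta>\<in>insert \<delta> \<F>. \<delta> f = 0" using d(2) by blast
  qed
  then show ?case by (rule bexI[OF _ mem])
qed

text \<open>A subfamily of maximal rank over the fraction field is finite, as ranks are bounded by
  the number of generators, and every member of the family is a combination of it.\<close>

lemma ex_finite_subfamily:
  fixes \<F> :: "('a \<Rightarrow> 'a) set"
  assumes "\<And>\<delta>. \<delta> \<in> \<F> \<Longrightarrow> derivation scale \<delta>"
  shows "\<exists>\<F>0. finite \<F>0 \<and> \<F>0 \<subseteq> \<F> \<and> (\<forall>f. (\<forall>\<delta>\<in>\<F>0. \<delta> f = 0) \<longrightarrow> (\<forall>\<delta>\<in>\<F>. \<delta> f = 0))"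
proof -
  define P where "P r \<longleftrightarrow> (\<exists>D. (\<forall>j<r. D j \<in> \<F>) \<and> lin_indep UNIV r (\<lambda>j. extend_derivation (D j)))" for r
  have P0: "P 0" by (simp add: P_def lin_indep_def)
  have bound: "r \<le> card K_gens" if Pr: "P r" for r
  proof -
    obtain D where D: "\<And>j. j < r \<Longrightarrow> D j \<in> \<F>" "lin_indep UNIV r (\<lambda>j. extend_derivation (D j))"
      using Pr unfolding P_def by blast
    have "lin_indep K_gens r (\<lambda>j. extend_derivation (D j))"
    proof (rule lin_indep_on_generators)
      show "der (extend_derivation (D j))" if "j < r" for j
        by (intro der_extend_derivation assms D that)
      show "lin_indep UNIV r (\<lambda>j. extend_derivation (D j))" by (rule D(2))
      show "\<forall>z. D' z = 0" if "der D'" "\<forall>s\<in>K_gens. D' s = 0" for D'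
        using gen_fractions that by (rule der_determined)
    qed
    then show ?thesis by (rule lin_indep_rank_bound[rotated]) (simp add: finite_S)
  qed
  define r where "r = (GREATEST r. P r)"
  have "P r" unfolding r_def using P0 bound by (rule GreatestI_nat)
  then obtain D where D: "\<And>j. j < r \<Longrightarrow> D j \<in> \<F>" "lin_indep UNIV r (\<lambda>j. extend_derivation (D j))"
    unfolding P_def by blast
  have "\<delta> f = 0" if \<delta>: "\<delta> \<in> \<F>" and f: "\<forall>j<r. D j f = 0" for \<delta> f
  proof -
    let ?D = "\<lambda>j. extend_derivation (if j < r then D j else \<delta>)"
    have "\<not> lin_indep UNIV (Suc r) ?D"
    proof
      assume "lin_indep UNIV (Suc r) ?D"
      then have "P (Suc r)" unfolding P_def using D(1) \<delta>
        by (intro exI[of _ "\<lambda>j. if j < r then D j else \<delta>"]) auto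
      from Greatest_le_nat[of P, OF this bound] have "Suc r \<le> r" unfolding r_def by blast
      then show False by simp
    qed
    moreover have "lin_indep UNIV r ?D" using D(2) by (simp add: lin_indep_def)
    ultimately obtain a where a: "\<And>z. ?D r z = (\<Sum>j<r. a j * ?D j z)"
      using lin_indep_relation[of UNIV r ?D] by blast
    have "into_fract (\<delta> f) = (\<Sum>j<r. a j * ?D j (into_fract f))"
      using a[of "into_fract f"] extend_derivation_into_fract[OF assms[OF \<delta>]] by simp
    also have "\<dots> = 0"
      using f extend_derivation_into_fract[OF assms[OF D(1)]] by (intro sum.neutral) auto
    finally show ?thesis by simp
  qed
  then show ?thesis using D(1) by (intro exI[of _ "D ` {..<r}"]) auto
qed

lemma minimal_derivations_nonempty:
  fixes \<F> :: "('a \<Rightarrow> 'a) set"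
  assumes "\<And>\<delta>. \<delta> \<in> \<F> \<Longrightarrow> derivation scale \<delta>"
  shows "minimal_derivations \<F> \<noteq> {}"
proof -
  have "\<exists>\<F>0. finite \<F>0 \<and> \<F>0 \<subseteq> \<F> \<and> (\<forall>f. (\<forall>\<delta>\<in>\<F>0. \<delta> f = 0) \<longrightarrow> (\<forall>\<delta>\<in>\<F>. \<delta> f = 0))"
    using assms by (rule ex_finite_subfamily)
  then obtain \<F>0 where F0: "finite \<F>0" "\<F>0 \<subseteq> \<F>"
    and F0_ker: "\<forall>f. (\<forall>\<delta>\<in>\<F>0. \<delta> f = 0) \<longrightarrow> (\<forall>\<delta>\<in>\<F>. \<delta> f = 0)"
    by (elim exE conjE)
  have "derivation scale \<delta>" if "\<delta> \<in> \<F>0" for \<delta> using that F0(2) assms by blast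
  with F0(1) have "\<exists>d\<in>der_module \<F>0. \<forall>f. d f = 0 \<longrightarrow> (\<forall>\<delta>\<in>\<F>0. \<delta> f = 0)"
    by (rule ex_minimal_finite)
  then obtain d where d: "d \<in> der_module \<F>0"
    and d_ker: "\<forall>f. d f = 0 \<longrightarrow> (\<forall>\<delta>\<in>\<F>0. \<delta> f = 0)"
    by (elim bexE)
  have dF: "d \<in> der_module \<F>" using d der_module_mono[OF F0(2)] by blast
  have "der_ker d = family_ker \<F>"
  proof
    show "der_ker d \<subseteq> family_ker \<F>"
    proof
      fix f assume "f \<in> der_ker d"
      then have "d f = 0" by (simp add: der_ker_def)
      then have "\<forall>\<delta>\<in>\<F>0. \<delta> f = 0" using d_ker by blast
      then have "\<forall>\<delta>\<in>\<F>. \<delta> f = 0" using F0_ker by blast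
      then show "f \<in> family_ker \<F>" by (simp add: family_ker_def der_ker_def)
    qed
    show "family_ker \<F> \<subseteq> der_ker d"
      using der_module_kills[OF dF] by (simp add: der_ker_def subset_iff)
  qed
  then show ?thesis using dF by (auto simp: minimal_derivations_def)
qed

end

section \<open>Residuality\<close>

lemma polynomial_function_on_sum:
  assumes "\<And>i. i \<in> I \<Longrightarrow> polynomial_function_on s F (f i)"
  shows "polynomial_function_on s F (\<lambda>x. \<Sum>i\<in>I. f i x)"
  using assms
  by (induction I rule: infinite_finite_induct)
     (auto intro: polynomial_function_on.const polynomial_function_on.add)

lemma polynomial_function_on_prod:
  assumes "\<And>i. i \<in> I \<Longrightarrow> polynomial_function_on s F (f i)"
  shows "polynomial_function_on s F (\<lambda>x. \<Prod>i\<in>I. f i x)"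
  using assms
  by (induction I rule: infinite_finite_induct)
     (auto intro: polynomial_function_on.const polynomial_function_on.mult)

lemma polynomial_function_on_det:
  assumes "\<And>i j. i < m \<Longrightarrow> j < m \<Longrightarrow> polynomial_function_on s F (\<lambda>x. f x i (z j))"
  shows "polynomial_function_on s F (\<lambda>x. det (eval_mat m (f x) z))"
proof -
  have less: "p i < m" if "p permutes {0..<m}" "i < m" for p i
    using permutes_in_image[OF that(1), of i] that(2) by simp
  have "det (eval_mat m (f x) z) =
      (\<Sum>p | p permutes {0..<m}. signof p * (\<Prod>i = 0..<m. f x i (z (p i))))" for x
    unfolding det_def'[OF eval_mat_carrier]
  proof (intro sum.cong refl)
    fix p assume "p \<in> {p. p permutes {0..<m}}"
    then have "(\<Prod>i = 0..<m. eval_mat m (f x) z $$ (i, p i)) = (\<Prod>i = 0..<m. f x i (z (p i)))"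
      by (intro prod.cong) (auto simp: eval_mat_def less)
    then show "signof p * (\<Prod>i = 0..<m. eval_mat m (f x) z $$ (i, p i)) =
        signof p * (\<Prod>i = 0..<m. f x i (z (p i)))" by simp
  qed
  moreover have "polynomial_function_on s F
      (\<lambda>x. \<Sum>p | p permutes {0..<m}. signof p * (\<Prod>i = 0..<m. f x i (z (p i))))"
    by (intro polynomial_function_on_sum polynomial_function_on.mult polynomial_function_on.const
        polynomial_function_on_prod assms) (auto simp: less)
  ultimately show ?thesis by simp
qed

context k_algebra
begin

lemma functionals_separate:
  assumes "v \<noteq> 0" shows "\<exists>\<phi>. Vector_Spaces.linear scale (*) \<phi> \<and> \<phi> v \<noteq> 0"
proof -
  interpret K: vector_space "(*) :: 'k \<Rightarrow> 'k \<Rightarrow> 'k"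
    by unfold_locales (auto simp: algebra_simps)
  interpret P: vector_space_pair scale "(*) :: 'k \<Rightarrow> 'k \<Rightarrow> 'k" ..
  have "independent {v}" using assms by simp
  then obtain \<phi> where "Vector_Spaces.linear scale (*) \<phi>" "\<forall>x\<in>{v}. \<phi> x = 1"
    using P.linear_independent_extend[of "{v}" "\<lambda>_. 1"] by blast
  then show ?thesis by (intro exI[of _ \<phi>]) auto
qed

definition functionals :: "('a \<Rightarrow> 'k) set" where
  "functionals = {\<phi>. Vector_Spaces.linear scale (*) \<phi>}"

lemma functional_add: "\<phi> \<in> functionals \<Longrightarrow> \<phi> (x + y) = \<phi> x + \<phi> y"
  and functional_scale: "\<phi> \<in> functionals \<Longrightarrow> \<phi> (scale c x) = c * \<phi> x"
  unfolding functionals_def Vector_Spaces.linear_iff by auto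

lemma functional_sum_scale:
  assumes "\<phi> \<in> functionals"
  shows "\<phi> (\<Sum>i\<in>I. scale (c i) (v i)) = (\<Sum>i\<in>I. c i * \<phi> (v i))"
proof -
  have "\<phi> 0 = 0" using functional_scale[OF assms, of 0 0] by simp
  then show ?thesis
    by (induction I rule: infinite_finite_induct)
       (auto simp: functional_add[OF assms] functional_scale[OF assms])
qed

text \<open>Vectors are viewed as functions on the dual space, so that the determinant criterion for
  functions applies even in infinite dimension.\<close>

lemma lin_indep_functionals:
  "lin_indep functionals m (\<lambda>j \<phi>. \<phi> (v j)) \<longleftrightarrow>
    (\<forall>c. (\<Sum>j<m. scale (c j) (v j)) = 0 \<longrightarrow> (\<forall>j<m. c j = 0))"
proof -
  have "(\<forall>\<phi>\<in>functionals. (\<Sum>j<m. c j * \<phi> (v j)) = 0) \<longleftrightarrow> (\<Sum>j<m. scale (c j) (v j)) = 0" for c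
  proof
    assume *: "\<forall>\<phi>\<in>functionals. (\<Sum>j<m. c j * \<phi> (v j)) = 0"
    show "(\<Sum>j<m. scale (c j) (v j)) = 0"
    proof (rule ccontr)
      assume "(\<Sum>j<m. scale (c j) (v j)) \<noteq> 0"
      then obtain \<phi> where "\<phi> \<in> functionals" "\<phi> (\<Sum>j<m. scale (c j) (v j)) \<noteq> 0"
        using functionals_separate unfolding functionals_def by blast
      then show False using * by (simp add: functional_sum_scale)
    qed
  next
    assume *: "(\<Sum>j<m. scale (c j) (v j)) = 0"
    show "\<forall>\<phi>\<in>functionals. (\<Sum>j<m. c j * \<phi> (v j)) = 0"
    proof
      fix \<phi> :: "'a \<Rightarrow> 'k" assume \<phi>: "\<phi> \<in> functionals"
      have "\<phi> 0 = 0" using functional_scale[OF \<phi>, of 0 0] by simp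
      then show "(\<Sum>j<m. c j * \<phi> (v j)) = 0"
        using functional_sum_scale[OF \<phi>, of c v "{..<m}"] * by simp
    qed
  qed
  then show ?thesis by (simp add: lin_indep_def)
qed

text \<open>Independence of the family \<open>d t\<close> indexed by \<open>T\<close>, not of its
  image: equal values at different t count as dependence.\<close>

definition independent_on :: "'a set \<Rightarrow> ('a \<Rightarrow> 'a) \<Rightarrow> bool" where
  "independent_on T d \<longleftrightarrow> (\<forall>c. (\<Sum>t\<in>T. scale (c t) (d t)) = 0 \<longrightarrow> (\<forall>t\<in>T. c t = 0))"

text \<open>Independence means that for some functionals \<open>z j\<close> the matrix of the
  \<open>z j (d (h i))\<close> has nonzero determinant; with the functionals fixed, this determinant
  is a polynomial in d.\<close>

lemma zariski_open_independent_on: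
  assumes "finite T"
  shows "zariski_open_in (fun_scale scale) F {d \<in> F. independent_on T d}"
proof -
  define m where "m = card T"
  obtain h where h: "bij_betw h {..<m} T"
    using ex_bij_betw_nat_finite[OF assms] unfolding m_def atLeast0LessThan by blast
  have ind: "independent_on T d \<longleftrightarrow> lin_indep functionals m (\<lambda>j \<phi>. \<phi> (d (h j)))" for d
  proof -
    have sum: "(\<Sum>t\<in>T. scale (c t) (d t)) = (\<Sum>j<m. scale (c (h j)) (d (h j)))" for c
      using sum.reindex_bij_betw[OF h, of "\<lambda>t. scale (c t) (d t)"] by simp
    show ?thesis
      unfolding lin_indep_functionals
    proof
      assume I: "independent_on T d"
      show "\<forall>c. (\<Sum>j<m. scale (c j) (d (h j))) = 0 \<longrightarrow> (\<forall>j<m. c j = 0)"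
      proof (intro allI impI)
        fix c j assume c: "(\<Sum>j<m. scale (c j) (d (h j))) = 0" and j: "j < m"
        define c' where "c' t = c (the_inv_into {..<m} h t)" for t
        have c': "c' (h j) = c j" if "j < m" for j
          using the_inv_into_f_f[of h "{..<m}" j] h that by (simp add: c'_def bij_betw_def)
        have "(\<Sum>t\<in>T. scale (c' t) (d t)) = 0" unfolding sum using c by (simp add: c')
        then have "c' (h j) = 0"
          using I j h unfolding independent_on_def by (meson bij_betwE lessThan_iff)
        then show "c j = 0" using c' j by simp
      qed
    next
      assume *: "\<forall>c. (\<Sum>j<m. scale (c j) (d (h j))) = 0 \<longrightarrow> (\<forall>j<m. c j = 0)"
      show "independent_on T d"
        unfolding independent_on_def sum
      proof (intro allI impI ballI)
        fix c t assume c: "(\<Sum>j<m. scale (c (h j)) (d (h j))) = 0" and "t \<in> T"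
        then obtain j where "j < m" "t = h j" using h by (auto simp: bij_betw_def)
        then show "c t = 0" using *[rule_format, of "\<lambda>j. c (h j)"] c by simp
      qed
    qed
  qed
  define P where "P = (\<lambda>z d. det (eval_mat m (\<lambda>j \<phi>. \<phi> (d (h j))) z)) ` {z. \<forall>j<m. z j \<in> functionals}"
  have "polynomial_function_on (fun_scale scale) F p" if pP: "p \<in> P" for p
  proof -
    from pP[unfolded P_def] obtain z where z: "z \<in> {z. \<forall>j<m. z j \<in> functionals}"
      "p = (\<lambda>d. det (eval_mat m (\<lambda>j \<phi>. \<phi> (d (h j))) z))" by (rule imageE)
    show ?thesis unfolding z(2)
    proof (rule polynomial_function_on_det)
      fix i j assume "i < m" "j < m"
      then have "linear_form_on (fun_scale scale) F (\<lambda>d. z j (d (h i)))"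
        using z(1)
        by (simp add: linear_form_on_def fun_scale_def functional_add functional_scale)
      then show "polynomial_function_on (fun_scale scale) F (\<lambda>d. z j (d (h i)))"
        by (rule polynomial_function_on.linear)
    qed
  qed
  moreover have "F - {d \<in> F. independent_on T d} = {d \<in> F. \<forall>p\<in>P. p d = 0}"
  proof -
    have P_iff: "(\<exists>p\<in>P. p d \<noteq> 0) \<longleftrightarrow> (\<exists>z. (\<forall>j<m. z j \<in> functionals) \<and>
        det (eval_mat m (\<lambda>j \<phi>. \<phi> (d (h j))) z) \<noteq> 0)" for d
      unfolding P_def by simp
    have "independent_on T d \<longleftrightarrow> (\<exists>p\<in>P. p d \<noteq> 0)" for d
      unfolding ind P_iff
    proof
      assume "lin_indep functionals m (\<lambda>j \<phi>. \<phi> (d (h j)))"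
      then show "\<exists>z. (\<forall>j<m. z j \<in> functionals) \<and>
          det (eval_mat m (\<lambda>j \<phi>. \<phi> (d (h j))) z) \<noteq> 0" by (rule lin_indep_imp_det)
    next
      assume "\<exists>z. (\<forall>j<m. z j \<in> functionals) \<and> det (eval_mat m (\<lambda>j \<phi>. \<phi> (d (h j))) z) \<noteq> 0"
      then obtain z where "\<forall>j<m. z j \<in> functionals"
        "det (eval_mat m (\<lambda>j \<phi>. \<phi> (d (h j))) z) \<noteq> 0" by (elim exE conjE)
      then show "lin_indep functionals m (\<lambda>j \<phi>. \<phi> (d (h j)))"
        by (intro det_imp_lin_indep[of m z]) auto
    qed
    then show ?thesis by auto
  qed
  ultimately show ?thesis unfolding zariski_open_in_def zariski_closed_in_def by blast
qed

text \<open>The monomials in the generators are countably many and closed under products.\<close>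

lemma countable_spanning_set:
  assumes "finite_type scale"
  shows "\<exists>C. countable C \<and> span C = UNIV"
proof -
  obtain S where S: "finite S" "subalgebra scale hull S = UNIV"
    using assms unfolding finite_type_def by blast
  define C where "C = prod_list ` lists S"
  have mult: "x * y \<in> span C" if "x \<in> span C" "y \<in> span C" for x y
    using that(1)
  proof (induction rule: span_induct_alt)
    case base
    show ?case using span_zero by simp
  next
    case (step c u w)
    have "u * y \<in> span C" using that(2)
    proof (induction rule: span_induct_alt)
      case base
      show ?case using span_zero by simp
    next
      case (step c' u' w')
      obtain xs xs' where "xs \<in> lists S" "u = prod_list xs" "xs' \<in> lists S" "u' = prod_list xs'"
        using step(1) \<open>u \<in> C\<close> unfolding C_def by blast
      then have "u * u' = prod_list (xs @ xs')" "xs @ xs' \<in> lists S" by auto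
      then have "u * u' \<in> C" unfolding C_def by blast
      moreover have "u * (scale c' u' + w') = scale c' (u * u') + u * w'"
        by (metis distrib_left mult.commute scale_mult_left)
      ultimately show ?case using step by (auto intro: span_add span_scale span_base)
    qed
    moreover have "(scale c u + w) * y = scale c (u * y) + w * y"
      by (simp add: distrib_right scale_mult_left)
    ultimately show ?case using step by (auto intro: span_add span_scale)
  qed
  have "1 \<in> C" unfolding C_def by (rule image_eqI[of _ _ "[]"]) auto
  then have "subalgebra scale (span C)"
    unfolding subalgebra_def using mult by (auto intro: span_base subspace_span)
  moreover have "S \<subseteq> span C"
  proof
    fix s assume "s \<in> S"
    then have "s \<in> C" unfolding C_def by (intro image_eqI[of _ _ "[s]"]) auto
    then show "s \<in> span C" by (rule span_base)
  qed
  ultimately have "span C = UNIV" using S(2) hull_minimal[of S "span C" "subalgebra scale"] by blast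
  moreover have "countable C" unfolding C_def using S(1) by (intro countable_image countable_lists countable_finite)
  ultimately show ?thesis by blast
qed

end

context finite_type_domain
begin

lemma subspace_family_ker:
  assumes "\<And>\<delta>. \<delta> \<in> \<F> \<Longrightarrow> derivation scale \<delta>"
  shows "subspace (family_ker \<F>)"
proof (rule subspaceI)
  have mem: "z \<in> family_ker \<F> \<longleftrightarrow> (\<forall>\<delta>\<in>\<F>. \<delta> z = 0)" for z
    by (simp add: family_ker_def der_ker_def)
  show "0 \<in> family_ker \<F>" unfolding mem using derivation_0[OF assms] by blast
  fix x y assume x: "x \<in> family_ker \<F>"
  show "x + y \<in> family_ker \<F>" if y: "y \<in> family_ker \<F>"
    unfolding mem
  proof
    fix \<delta> assume \<delta>: "\<delta> \<in> \<F>"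
    then have "\<delta> x = 0" "\<delta> y = 0" using x y unfolding mem by blast+
    then show "\<delta> (x + y) = 0" using derivation_add[OF assms[OF \<delta>], of x y] by simp
  qed
  show "scale c x \<in> family_ker \<F>" for c
    unfolding mem
  proof
    fix \<delta> assume \<delta>: "\<delta> \<in> \<F>"
    then have "\<delta> x = 0" using x unfolding mem by blast
    then show "\<delta> (scale c x) = 0" using derivation_scale[OF assms[OF \<delta>], of c x] by simp
  qed
qed

text \<open>Minimality is injectivity of the map induced by d on \<open>'a\<close> modulo
  \<open>family_ker \<F>\<close>, and a linear map is injective iff it keeps finite independent sets
  independent. Testing inside the spanning set \<open>C\<close> is enough; a countable
  \<open>C\<close> gives countably many tests.\<close>

lemma minimal_iff_independent:
  assumes \<F>: "\<And>\<delta>. \<delta> \<in> \<F> \<Longrightarrow> derivation scale \<delta>" and C: "span C = UNIV"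
    and d: "d \<in> der_module \<F>"
  shows "d \<in> minimal_derivations \<F> \<longleftrightarrow>
    (\<forall>T. finite T \<and> T \<subseteq> C \<and>
      (\<forall>c. (\<Sum>t\<in>T. scale (c t) t) \<in> family_ker \<F> \<longrightarrow> (\<forall>t\<in>T. c t = 0)) \<longrightarrow> independent_on T d)"
proof -
  let ?Z = "family_ker \<F>"
  define free where "free T \<longleftrightarrow> finite T \<and> T \<subseteq> C \<and>
    (\<forall>c. (\<Sum>t\<in>T. scale (c t) t) \<in> ?Z \<longrightarrow> (\<forall>t\<in>T. c t = 0))" for T
  have d_der: "derivation scale d"
    by (rule der_module_derivation[OF k_algebra_axioms _ d]) (use \<F> in auto)
  have Z: "subspace ?Z" by (rule subspace_family_ker[OF \<F>])
  have d_sum: "d (\<Sum>t\<in>T. scale (c t) t) = (\<Sum>t\<in>T. scale (c t) (d t))" for c T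
    by (simp add: derivation_sum[OF d_der] derivation_scale[OF d_der])
  have "d \<in> minimal_derivations \<F> \<longleftrightarrow> (\<forall>T. free T \<longrightarrow> independent_on T d)"
  proof
    assume "d \<in> minimal_derivations \<F>"
    then have "der_ker d = ?Z" by (simp add: minimal_derivations_def)
    then show "\<forall>T. free T \<longrightarrow> independent_on T d"
      unfolding free_def independent_on_def d_sum[symmetric] by (auto simp: der_ker_def)
  next
    assume ind: "\<forall>T. free T \<longrightarrow> independent_on T d"
    have "a \<in> ?Z" if da: "d a = 0" for a
    proof -
      have "a \<in> span C" using C by simp
      then obtain S0 u where S0': "finite S0" "S0 \<subseteq> C" and a: "a = (\<Sum>t\<in>S0. scale (u t) t)"
        unfolding span_explicit by blast
      have "a \<in> span S0" unfolding a by (intro span_sum span_scale span_base)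
      with S0' have S0: "finite S0" "S0 \<subseteq> C" "a \<in> span S0" by auto
      have "free {}" by (simp add: free_def)
      \<comment> \<open>A maximal free subset of the finite support of \<open>a\<close> spans that
        support modulo the kernel, so \<open>a\<close> is a combination of it up to an element of
        the kernel.\<close>
      define Q where "Q T \<longleftrightarrow> free T \<and> T \<subseteq> S0" for T
      have "Q {}" using \<open>free {}\<close> by (simp add: Q_def)
      moreover have "\<forall>T. Q T \<longrightarrow> card T \<le> card S0"
        using S0(1) by (auto simp: Q_def intro: card_mono)
      ultimately obtain T where T: "Q T" "\<And>T'. Q T' \<Longrightarrow> card T' \<le> card T"
        using ex_has_greatest_nat[of Q "{}" card "Suc (card S0)"] unfolding less_Suc_eq_le by blast
      have Tf: "free T" "finite T" "T \<subseteq> C" "T \<subseteq> S0" using T(1) by (auto simp: Q_def free_def)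
      define W where "W = {w. \<exists>c. w - (\<Sum>t\<in>T. scale (c t) t) \<in> ?Z}"
      have "subspace W"
        unfolding subspace_def
      proof (intro conjI ballI allI)
        show "0 \<in> W" unfolding W_def using subspace_0[OF Z]
          by (intro CollectI exI[of _ "\<lambda>_. 0"]) simp
        fix w w' assume "w \<in> W" "w' \<in> W"
        then obtain c c' where *: "w - (\<Sum>t\<in>T. scale (c t) t) \<in> ?Z" "w' - (\<Sum>t\<in>T. scale (c' t) t) \<in> ?Z"
          unfolding W_def by blast
        have "(w + w') - (\<Sum>t\<in>T. scale (c t + c' t) t) =
            (w - (\<Sum>t\<in>T. scale (c t) t)) + (w' - (\<Sum>t\<in>T. scale (c' t) t))"
          by (simp add: scale_left_distrib sum.distrib)
        then have "(w + w') - (\<Sum>t\<in>T. scale (c t + c' t) t) \<in> ?Z" using subspace_add[OF Z *] by (simp only:)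
        then show "w + w' \<in> W" unfolding W_def by (intro CollectI exI)
      next
        fix k w assume "w \<in> W"
        then obtain c where *: "w - (\<Sum>t\<in>T. scale (c t) t) \<in> ?Z" unfolding W_def by blast
        have "scale k w - (\<Sum>t\<in>T. scale (k * c t) t) = scale k (w - (\<Sum>t\<in>T. scale (c t) t))"
          by (simp add: scale_right_diff_distrib scale_sum_right)
        then have "scale k w - (\<Sum>t\<in>T. scale (k * c t) t) \<in> ?Z" using subspace_scale[OF Z *] by (simp only:)
        then show "scale k w \<in> W" unfolding W_def by (intro CollectI exI)
      qed
      moreover have "S0 \<subseteq> W"
      proof
        fix s assume s: "s \<in> S0"
        show "s \<in> W"
        proof (cases "s \<in> T")
          case True
          have "(\<Sum>t\<in>T. scale (if t = s then 1 else 0) t) = (\<Sum>t\<in>T. if t = s then s else 0)"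
            by (intro sum.cong) auto
          then have "(\<Sum>t\<in>T. scale (if t = s then 1 else 0) t) = s"
            using True Tf by simp
          then show ?thesis unfolding W_def using subspace_0[OF Z]
            by (intro CollectI exI[of _ "\<lambda>t. if t = s then 1 else 0"]) simp
        next
          case False
          have "\<not> Q (insert s T)"
          proof
            assume "Q (insert s T)"
            then have "card (insert s T) \<le> card T" by (rule T(2))
            then show False using False Tf(2) by simp
          qed
          then obtain c t where c: "(\<Sum>t\<in>insert s T. scale (c t) t) \<in> ?Z" "t \<in> insert s T" "c t \<noteq> 0"
            unfolding Q_def free_def using s Tf S0 by blast
          have cZ: "scale (c s) s + (\<Sum>t\<in>T. scale (c t) t) \<in> ?Z" using c(1) False Tf(2) by simp
          have "c s \<noteq> 0"
          proof
            assume "c s = 0"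
            then have "(\<Sum>t\<in>T. scale (c t) t) \<in> ?Z" using cZ by simp
            then have "\<forall>t\<in>T. c t = 0" using Tf(1) unfolding free_def by blast
            then show False using c \<open>c s = 0\<close> by auto
          qed
          have "scale (inverse (c s)) (scale (c s) s + (\<Sum>t\<in>T. scale (c t) t)) =
              s - (\<Sum>t\<in>T. scale (- (inverse (c s) * c t)) t)"
            using \<open>c s \<noteq> 0\<close> by (simp add: scale_right_distrib scale_sum_right sum_negf)
          then have "s - (\<Sum>t\<in>T. scale (- (inverse (c s) * c t)) t) \<in> ?Z"
            using subspace_scale[OF Z cZ] by metis
          then show ?thesis unfolding W_def by (intro CollectI exI)
        qed
      qed
      ultimately have "a \<in> W" using span_minimal[of S0 W] S0(3) by blast
      then obtain c where c: "a - (\<Sum>t\<in>T. scale (c t) t) \<in> ?Z" unfolding W_def by blast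
      have "d (a - (\<Sum>t\<in>T. scale (c t) t)) = 0" by (rule der_module_kills[OF d c])
      moreover have "d ((a - (\<Sum>t\<in>T. scale (c t) t)) + (\<Sum>t\<in>T. scale (c t) t)) = d a" by simp
      ultimately have "d (\<Sum>t\<in>T. scale (c t) t) = 0"
        unfolding derivation_add[OF d_der] using da by simp
      then have "\<forall>t\<in>T. c t = 0"
        using ind Tf(1) unfolding independent_on_def d_sum by blast
      then show "a \<in> ?Z" using c by simp
    qed
    then have "der_ker d = ?Z"
      using der_module_kills[OF d] by (auto simp: der_ker_def)
    then show "d \<in> minimal_derivations \<F>" using d by (simp add: minimal_derivations_def)
  qed
  then show ?thesis unfolding free_def .
qed

lemma residual_minimal_derivations:
  assumes \<F>: "\<And>\<delta>. \<delta> \<in> \<F> \<Longrightarrow> derivation scale \<delta>"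
  shows "residual_in (fun_scale scale) (der_module \<F>) (minimal_derivations \<F>)"
  unfolding residual_in_def
proof (intro conjI allI impI)
  show "minimal_derivations \<F> \<subseteq> der_module \<F>" by (auto simp: minimal_derivations_def)
  fix F assume F: "finite_dimensional_subspace (fun_scale scale) F \<and> F \<subseteq> der_module \<F>"
  have "finite_type scale" unfolding finite_type_def using finite_S S_generates by blast
  then obtain C where C: "countable C" "span C = UNIV" using countable_spanning_set by blast
  define \<T> where "\<T> = {T. finite T \<and> T \<subseteq> C \<and>
    (\<forall>c. (\<Sum>t\<in>T. scale (c t) t) \<in> family_ker \<F> \<longrightarrow> (\<forall>t\<in>T. c t = 0))}"
  have "\<T> \<subseteq> {T. finite T \<and> T \<subseteq> C}" by (auto simp: \<T>_def)
  then have "countable \<T>" using countable_Collect_finite_subset[OF C(1)] countable_subset by blast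
  \<comment> \<open>The enumeration by \<open>from_nat_into\<close> needs a nonempty set;
    repetitions let even a finite \<open>\<T>\<close> fill a sequence.\<close>
  moreover have "{} \<in> \<T>" by (simp add: \<T>_def)
  ultimately have range_T: "range (from_nat_into \<T>) = \<T>" by (intro range_from_nat_into) auto
  show "\<exists>U :: nat \<Rightarrow> ('a \<Rightarrow> 'a) set. (\<forall>n. zariski_open_in (fun_scale scale) F (U n)) \<and> minimal_derivations \<F> \<inter> F = (\<Inter>n. U n)"
  proof (intro exI[of _ "\<lambda>n. {d \<in> F. independent_on (from_nat_into \<T> n) d}"] conjI allI)
    fix n
    have "finite (from_nat_into \<T> n)" using range_T by (auto simp: \<T>_def)
    then show "zariski_open_in (fun_scale scale) F {d \<in> F. independent_on (from_nat_into \<T> n) d}"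
      by (rule zariski_open_independent_on)
  next
    have "d \<in> minimal_derivations \<F> \<longleftrightarrow> (\<forall>T\<in>range (from_nat_into \<T>). independent_on T d)" if "d \<in> F" for d
    proof -
      have "d \<in> der_module \<F>" using that F by blast
      with \<F> C(2) have "d \<in> minimal_derivations \<F> \<longleftrightarrow> (\<forall>T. finite T \<and> T \<subseteq> C \<and>
          (\<forall>c. (\<Sum>t\<in>T. scale (c t) t) \<in> family_ker \<F> \<longrightarrow> (\<forall>t\<in>T. c t = 0)) \<longrightarrow> independent_on T d)"
        by (rule minimal_iff_independent)
      then show ?thesis unfolding range_T by (simp only: \<T>_def Ball_def mem_Collect_eq)
    qed
    then show "minimal_derivations \<F> \<inter> F = (\<Inter>n. {d \<in> F. independent_on (from_nat_into \<T> n) d})"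
      by auto
  qed
qed

end

theorem theorem1p6:
  fixes scale :: "'k::{alg_closed_field, field_char_0} \<Rightarrow> 'a::idom \<Rightarrow> 'a"
    and \<F> :: "('a \<Rightarrow> 'a) set"
  assumes "k_algebra scale"
    and "finite_type scale"
    and "\<forall>d\<in>\<F>. derivation scale d"
  shows "minimal_derivations \<F> \<noteq> {} \<and>
    residual_in (fun_scale scale) (der_module \<F>) (minimal_derivations \<F>)"
proof -
  interpret k_algebra scale by (fact assms(1))
  obtain S where "finite S" "subalgebra scale hull S = UNIV"
    using assms(2) unfolding finite_type_def by blast
  then interpret finite_type_domain scale S by unfold_locales
  show ?thesis
    using minimal_derivations_nonempty residual_minimal_derivations assms(3) by blast
qed

end
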